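(* Let $\gamma\in(1,2)$ and $\alpha,\beta\in(0,1)$. Let $\langle\cdot\rangle_N$ denote expectation with respect to the unique invariant measure $\mu_N$ of the boundary driven symmetric long jumps exclusion process on $\{1,\dots,N-1\}$ with reservoir densities $\alpha$ (left) and $\beta$ (right), and let $W_1$ be the current defined in the context. Let $\bar\rho:[0,1]\to[0,1]$ be the unique weak solution of the stationary fractional heat equation $(-\Delta)^{\gamma/2}\bar\rho=0$ on $(0,1)$, $\bar\rho(0)=\alpha$, $\bar\rho(1)=\beta$, extended to $\mathbb{R}$ by $\bar\rho(q)=\alpha$ for $q\le0$ and $\bar\rho(q)=\beta$ for $q\ge1$. Then for every $x\in(0,1)$, $$\lim_{N\to\infty}N^{\gamma-1}\langle W_1\rangle_N=c_\gamma\int_{-\infty}^xdy\int_x^{\infty}dz\,\frac{\bar\rho(y)-\bar\rho(z)}{(z-y)^{1+\gamma}}+\frac{c_\gamma}{\gamma(\gamma-1)}(\beta-\alpha).$$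
   Context: **The process.** Fix $\gamma\in(1,2)$, $\alpha,\beta\in(0,1)$. Let $p(z)=c_\gamma|z|^{-(1+\gamma)}$ for $z\in\mathbb{Z}$, $|z|\ge1$, and $p(0)=0$, where $c_\gamma>0$ is the constant making $p$ a probability on $\mathbb{Z}$. For $N\ge2$ let $\Lambda_N=\{1,\dots,N-1\}$ and $\Omega_N=\{0,1\}^{\Lambda_N}$. For $\eta\in\Omega_N$, $\eta^{xy}$ is obtained from $\eta$ by exchanging the values at $x$ and $y$, and $\eta^x$ is obtained by replacing $\eta_x$ by $1-\eta_x$. The boundary driven symmetric long jumps exclusion process is the continuous-time Markov chain on $\Omega_N$ with generator $L_N=L_N^0+L_N^r+L_N^\ell$, where for $f:\Omega_N\to\mathbb{R}$ $$(L_N^0f)(\eta)=\tfrac12\sum_{x,y\in\Lambda_N}p(x-y)[f(\eta^{xy})-f(\eta)],$$ $$(L_N^rf)(\eta)=\sum_{x\in\Lambda_N,\,y\ge N}p(x-y)[\eta_x(1-\beta)+(1-\eta_x)\beta][f(\eta^x)-f(\eta)],$$ $$(L_N^\ell f)(\eta)=\sum_{x\in\Lambda_N,\,y\le0}p(x-y)[\eta_x(1-\alpha)+(1-\eta_x)\alpha][f(\eta^x)-f(\eta)].$$ **The current.** Extend $\eta\in\Omega_N$ to $\mathbb{Z}$ by $\eta_z=\alpha$ for $z\le0$ and $\eta_z=\beta$ for $z\ge N$. For $x=1,\dots,N$, $$W_x=\sum_{y\le x-1}\sum_{z\ge x}p(z-y)[\eta_y-\eta_z]+(\beta-\alpha)\sum_{y\le0,\,z\ge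 N}p(z-y).$$ (These sums converge since $\gamma>1$.) **Fractional Laplacian.** For $H:\mathbb{R}\to\mathbb{R}$ with $\int_{\mathbb{R}}|H(q)|(1+|q|)^{-1-\gamma}dq<\infty$, $$(-\Delta)^{\gamma/2}H(q)=c_\gamma\lim_{\varepsilon\to0}\int_{\mathbb{R}}\mathbf{1}_{|y-q|\ge\varepsilon}\frac{H(q)-H(y)}{|y-q|^{1+\gamma}}dy$$ whenever the limit exists (here $c_\gamma$ is the same constant that makes $p(z)=c_\gamma|z|^{-(1+\gamma)}$, $|z|\ge1$, $p(0)=0$, a probability on $\mathbb{Z}$). **Weak solution.** For $q\in(0,1)$ put $r^-(q)=c_\gamma\gamma^{-1}q^{-\gamma}$, $r^+(q)=c_\gamma\gamma^{-1}(1-q)^{-\gamma}$. Let $C_c^2([0,1])$ be the set of $C^2$ functions with compact support included in $(0,1)$ (extended by $0$ to $\mathbb{R}$). A weak solution of the stationary fractional heat equation with boundary values $\alpha,\beta$ is a continuous function $\rho:[0,1]\to[0,1]$ with $\rho(0)=\alpha$, $\rho(1)=\beta$ and, for all $H\in C_c^2([0,1])$, $$-\langle\rho,(-\Delta)^{\gamma/2}H\rangle+\langle\alpha r^-+\beta r^+,H\rangle=0,$$ where $\langle\cdot,\cdot\rangle$ is the scalar product of $L^2([0,1])$. There is exactly one weak solution, denoted $\bar\rho$; for $q\in(0,1)$ it is given by $$\bar\rho(q)=\int_{|y-\frac12|>\frac12}g(y)\,\frac{\sin(\pi\gamma/2)}{\pi}\left[\frac{\frac14-(q-\frac12)^2}{(y-\frac12)^2-\frac14}\right]^{\gamma/2}\frac{dy}{|q-y|},$$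 with $g(y)=\alpha$ for $y<0$ and $g(y)=\beta$ for $y>1$. *)

theory Defs
  imports "HOL-Probability.Probability"
begin

definition jump_const :: "real \<Rightarrow> real" where
  "jump_const \<gamma> = 1 / (\<Sum>\<^sub>\<infinity>z\<in>UNIV - {0::int}. \<bar>real_of_int z\<bar> powr - (1 + \<gamma>))"

definition jump_prob :: "real \<Rightarrow> int \<Rightarrow> real" where
  "jump_prob \<gamma> z = (if z = 0 then 0 else jump_const \<gamma> * \<bar>real_of_int z\<bar> powr - (1 + \<gamma>))"

lemma powr_summable_on_nonzero_ints:
  assumes "\<gamma> > (0::real)"
  shows "(\<lambda>z::int. \<bar>real_of_int z\<bar> powr - (1 + \<gamma>)) summable_on (UNIV - {0})"
proof -
  let ?f = "\<lambda>z::int. \<bar>real_of_int z\<bar> powr - (1 + \<gamma>)"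
  have "summable (\<lambda>n. real n powr - (1 + \<gamma>))"
    using assms by (subst summable_real_powr_iff) auto
  then have nat: "(\<lambda>n. real n powr - (1 + \<gamma>)) summable_on UNIV"
    by (subst summable_on_UNIV_nonneg_real_iff) auto
  have pos: "?f summable_on range int"
    using nat by (subst summable_on_reindex) (auto simp: o_def)
  have neg: "?f summable_on range (\<lambda>n. - int n)"
    using nat by (subst summable_on_reindex) (auto simp: o_def inj_def)
  have "UNIV - {0} \<subseteq> range int \<union> range (\<lambda>n. - int n)"
  proof
    fix z :: int
    show "z \<in> range int \<union> range (\<lambda>n. - int n)" by (cases z rule: int_cases2) auto
  qed
  moreover have "?f summable_on range int \<union> range (\<lambda>n. - int n)"
    by (rule summable_on_union[OF pos neg])
  ultimately show ?thesis by (rule summable_on_subset_banach[rotated])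
qed

lemma jump_const_pos:
  assumes "\<gamma> > 0"
  shows "jump_const \<gamma> > 0"
proof -
  let ?f = "\<lambda>z::int. \<bar>real_of_int z\<bar> powr - (1 + \<gamma>)"
  have "infsum ?f {1} \<le> infsum ?f (UNIV - {0})"
    by (rule infsum_mono_neutral) (use powr_summable_on_nonzero_ints[OF assms] in auto)
  then show ?thesis by (simp add: jump_const_def)
qed

lemma jump_prob_has_sum_1:
  assumes "\<gamma> > 0"
  shows "(jump_prob \<gamma> has_sum 1) UNIV"
proof -
  let ?f = "\<lambda>z::int. \<bar>real_of_int z\<bar> powr - (1 + \<gamma>)"
  let ?S = "infsum ?f (UNIV - {0})"
  have "?S \<noteq> 0" using jump_const_pos[OF assms] by (auto simp: jump_const_def)
  moreover have "((\<lambda>z. jump_const \<gamma> * ?f z) has_sum (jump_const \<gamma> * ?S)) (UNIV - {0})"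
    by (intro has_sum_cmult_right has_sum_infsum powr_summable_on_nonzero_ints assms)
  ultimately have "((\<lambda>z. jump_const \<gamma> * ?f z) has_sum 1) (UNIV - {0})"
    by (simp add: jump_const_def)
  then show ?thesis
    by (subst (asm) has_sum_cong_neutral[where T = UNIV and g = "jump_prob \<gamma>"])
       (auto simp: jump_prob_def)
qed

definition sites :: "nat \<Rightarrow> int set" where
  "sites N = {1..int N - 1}"

text \<open>A configuration is a function on \<open>sites N\<close>, encoded as a function on \<open>int\<close> that is
  \<open>undefined\<close> elsewhere; occupation numbers are the reals 0 and 1.\<close>

definition configs :: "nat \<Rightarrow> (int \<Rightarrow> real) set" where
  "configs N = sites N \<rightarrow>\<^sub>E {0, 1}"

definition exchange :: "(int \<Rightarrow> real) \<Rightarrow> int \<Rightarrow> int \<Rightarrow> (int \<Rightarrow> real)" where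
  "exchange \<eta> x y = \<eta>(x := \<eta> y, y := \<eta> x)"

definition flip :: "(int \<Rightarrow> real) \<Rightarrow> int \<Rightarrow> (int \<Rightarrow> real)" where
  "flip \<eta> x = \<eta>(x := 1 - \<eta> x)"

definition gen_bulk :: "real \<Rightarrow> nat \<Rightarrow> ((int \<Rightarrow> real) \<Rightarrow> real) \<Rightarrow> (int \<Rightarrow> real) \<Rightarrow> real" where
  "gen_bulk \<gamma> N f \<eta> =
     1/2 * (\<Sum>x\<in>sites N. \<Sum>y\<in>sites N. jump_prob \<gamma> (x - y) * (f (exchange \<eta> x y) - f \<eta>))"

definition gen_right ::
    "real \<Rightarrow> real \<Rightarrow> nat \<Rightarrow> ((int \<Rightarrow> real) \<Rightarrow> real) \<Rightarrow> (int \<Rightarrow> real) \<Rightarrow> real" where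
  "gen_right \<gamma> \<beta> N f \<eta> =
     (\<Sum>x\<in>sites N. \<Sum>\<^sub>\<infinity>y\<in>{int N..}.
        jump_prob \<gamma> (x - y) * (\<eta> x * (1 - \<beta>) + (1 - \<eta> x) * \<beta>) * (f (flip \<eta> x) - f \<eta>))"

definition gen_left ::
    "real \<Rightarrow> real \<Rightarrow> nat \<Rightarrow> ((int \<Rightarrow> real) \<Rightarrow> real) \<Rightarrow> (int \<Rightarrow> real) \<Rightarrow> real" where
  "gen_left \<gamma> \<alpha> N f \<eta> =
     (\<Sum>x\<in>sites N. \<Sum>\<^sub>\<infinity>y\<in>{..0}.
        jump_prob \<gamma> (x - y) * (\<eta> x * (1 - \<alpha>) + (1 - \<eta> x) * \<alpha>) * (f (flip \<eta> x) - f \<eta>))"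

definition generator ::
    "real \<Rightarrow> real \<Rightarrow> real \<Rightarrow> nat \<Rightarrow> ((int \<Rightarrow> real) \<Rightarrow> real) \<Rightarrow> (int \<Rightarrow> real) \<Rightarrow> real" where
  "generator \<gamma> \<alpha> \<beta> N f \<eta> = gen_bulk \<gamma> N f \<eta> + gen_right \<gamma> \<beta> N f \<eta> + gen_left \<gamma> \<alpha> N f \<eta>"

text \<open>The state space is finite, so the Markov semigroup is the exponential of the generator:
  for \<open>\<eta> \<in> configs N\<close>, \<open>semigroup \<gamma> \<alpha> \<beta> N t f \<eta>\<close> is the expectation of \<open>f\<close> at time \<open>t\<close> for
  the chain started from \<open>\<eta>\<close>.\<close>

definition semigroup ::
    "real \<Rightarrow> real \<Rightarrow> real \<Rightarrow> nat \<Rightarrow> real \<Rightarrow> ((int \<Rightarrow> real) \<Rightarrow> real) \<Rightarrow> (int \<Rightarrow> real) \<Rightarrow> real" where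
  "semigroup \<gamma> \<alpha> \<beta> N t f \<eta> = (\<Sum>n. t ^ n / fact n * (generator \<gamma> \<alpha> \<beta> N ^^ n) f \<eta>)"

definition invariant_measure ::
    "real \<Rightarrow> real \<Rightarrow> real \<Rightarrow> nat \<Rightarrow> (int \<Rightarrow> real) pmf \<Rightarrow> bool" where
  "invariant_measure \<gamma> \<alpha> \<beta> N \<mu> \<longleftrightarrow>
     set_pmf \<mu> \<subseteq> configs N \<and>
     (\<forall>f. \<forall>t\<ge>0. measure_pmf.expectation \<mu> (semigroup \<gamma> \<alpha> \<beta> N t f) = measure_pmf.expectation \<mu> f)"

definition extend_config :: "real \<Rightarrow> real \<Rightarrow> nat \<Rightarrow> (int \<Rightarrow> real) \<Rightarrow> int \<Rightarrow> real" where
  "extend_config \<alpha> \<beta> N \<eta> z = (if z \<le> 0 then \<alpha> else if z \<ge> int N then \<beta> else \<eta> z)"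

definition current :: "real \<Rightarrow> real \<Rightarrow> real \<Rightarrow> nat \<Rightarrow> int \<Rightarrow> (int \<Rightarrow> real) \<Rightarrow> real" where
  "current \<gamma> \<alpha> \<beta> N x \<eta> =
     (\<Sum>\<^sub>\<infinity>(y, z)\<in>{..x - 1} \<times> {x..}.
        jump_prob \<gamma> (z - y) * (extend_config \<alpha> \<beta> N \<eta> y - extend_config \<alpha> \<beta> N \<eta> z))
     + (\<beta> - \<alpha>) * (\<Sum>\<^sub>\<infinity>(y, z)\<in>{..0} \<times> {int N..}. jump_prob \<gamma> (z - y))"

definition frac_laplacian :: "real \<Rightarrow> (real \<Rightarrow> real) \<Rightarrow> real \<Rightarrow> real" where
  "frac_laplacian \<gamma> H q =
     jump_const \<gamma> * Lim (at_right 0)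
       (\<lambda>\<epsilon>. LBINT y:{y. \<bar>y - q\<bar> \<ge> \<epsilon>}. (H q - H y) / \<bar>y - q\<bar> powr (1 + \<gamma>))"

text \<open>Test functions are taken already extended by 0 to the real line; as the support is a compact
  subset of the open interval, being \<open>C\<^sup>2\<close> there is the same as being \<open>C\<^sup>2\<close> everywhere.\<close>

definition Cc2 :: "(real \<Rightarrow> real) set" where
  "Cc2 = {H. (\<exists>H' H''. (\<forall>q. (H has_real_derivative H' q) (at q)) \<and>
                       (\<forall>q. (H' has_real_derivative H'' q) (at q)) \<and>
                       continuous_on UNIV H'') \<and>
             compact (closure {q. H q \<noteq> 0}) \<and> closure {q. H q \<noteq> 0} \<subseteq> {0<..<1}}"

definition r_minus :: "real \<Rightarrow> real \<Rightarrow> real" where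
  "r_minus \<gamma> q = jump_const \<gamma> / \<gamma> * q powr - \<gamma>"

definition r_plus :: "real \<Rightarrow> real \<Rightarrow> real" where
  "r_plus \<gamma> q = jump_const \<gamma> / \<gamma> * (1 - q) powr - \<gamma>"

text \<open>Only the values of \<open>\<rho>\<close> on \<open>[0, 1]\<close> matter.\<close>

definition weak_solution :: "real \<Rightarrow> real \<Rightarrow> real \<Rightarrow> (real \<Rightarrow> real) \<Rightarrow> bool" where
  "weak_solution \<gamma> \<alpha> \<beta> \<rho> \<longleftrightarrow>
     continuous_on {0..1} \<rho> \<and> \<rho> ` {0..1} \<subseteq> {0..1} \<and> \<rho> 0 = \<alpha> \<and> \<rho> 1 = \<beta> \<and>
     (\<forall>H\<in>Cc2. - (LBINT q:{0..1}. \<rho> q * frac_laplacian \<gamma> H q)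
               + (LBINT q:{0..1}. (\<alpha> * r_minus \<gamma> q + \<beta> * r_plus \<gamma> q) * H q) = 0)"

definition extend_profile :: "real \<Rightarrow> real \<Rightarrow> (real \<Rightarrow> real) \<Rightarrow> real \<Rightarrow> real" where
  "extend_profile \<alpha> \<beta> \<rho> q = (if q \<le> 0 then \<alpha> else if q \<ge> 1 then \<beta> else \<rho> q)"

end

theory Submission imports Defs begin

text \<open>The mean occupation \<open>u\<close> of a site under an invariant measure solves the linear equation
  \<open>\<Sum>y. p (x - y) (u y - u x) = 0\<close> on the sites, with the reservoir densities as exterior values,
  so the mean current through a bond does not depend on the bond and may be computed at the
  macroscopic point \<open>x\<close>. There the rescaled double sum converges by dominated convergence, given
  two facts. First, \<open>u\<close> is Hoelder continuous with an exponent larger than \<open>\<gamma> - 1\<close> in the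
  interior, uniformly in \<open>N\<close>; this controls the short jumps and is obtained by doubling variables
  and coupling jumps. Second, \<open>u\<close> converges uniformly to the macroscopic profile: a mollification
  of the profile, slightly contracted, is smooth and solves the continuous equation, hence almost
  solves the discrete one, and the maximum principle together with the exit rate of order
  \<open>N powr -\<gamma>\<close> compares it with \<open>u\<close>. No uniqueness of weak solutions is needed.\<close>

section \<open>Step functions and integrable kernels\<close>

text \<open>The threshold for the exponent is a count: \<open>k\<close> pairs at distance
  \<open>k\<close> straddle a bond, each with weight of order
  \<open>k powr - (1 + \<gamma>)\<close>, so increments of order \<open>(k / N) powr a\<close> have
  a convergent flux at short macroscopic distances exactly when \<open>a > \<gamma> - 1\<close>. At
  bond 1 such increments would have to be controlled up to the boundary. Doubling of variables
  penalises the distance from an interior centre on the scale of its distance to the boundary, so it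
  serves interior bonds only; there it yields every exponent in (0, 1), and
  \<open>\<gamma> / 2\<close> lies between \<open>\<gamma> - 1\<close> and 1.

  The profile is a continuous weak solution, so its equation has no pointwise meaning at first.
  Mollification supplies one, but only farther from the boundary than the mollification radius; the
  contraction moves all sites into that region, and by homogeneity of the kernel it changes the
  equation by a constant factor only.

  The term with \<open>\<beta> - \<alpha>\<close> comes from the pairs joining the two reservoirs.
  It passes through the same limit theorem as the flux, with an indicator in place of the density
  difference.\<close>

lemma has_integral_imp_set_integrable_lborel:
  fixes f :: "real \<Rightarrow> real"
  assumes "(f has_integral I) S" "S \<in> sets borel" "f \<in> borel_measurable borel"
    and "\<And>x. x \<in> S \<Longrightarrow> 0 \<le> f x"
  shows "set_integrable lborel S f" "(LBINT x:S. f x) = I"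
proof -
  have "f absolutely_integrable_on S"
    using assms by (intro nonnegative_absolutely_integrable_1) auto
  then show 1: "set_integrable lborel S f"
    using assms(2,3) unfolding set_integrable_def
    by (subst (asm) integrable_completion) (auto intro!: borel_measurable_indicator)
  show "(LBINT x:S. f x) = I"
    using set_borel_integral_eq_integral(2)[OF 1] assms(1) by (simp add: integral_unique)
qed

text \<open>Cells are open on the left and closed on the right. The right endpoint of the cell of
  \<open>s\<close> is thus at least \<open>s\<close>, and a decreasing kernel sampled there stays
  below its value at \<open>s\<close>; sampling never meets the singularity at 0.\<close>

definition cell_index :: "real \<Rightarrow> real \<Rightarrow> nat" where
  "cell_index d s = nat (\<lceil>s / d\<rceil> - 1)"

lemma cell_index_eq_iff:
  assumes "d > 0" "s > 0"
  shows "cell_index d s = n \<longleftrightarrow> d * real n < s \<and> s \<le> d * real (Suc n)"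
proof -
  have "\<lceil>s / d\<rceil> \<ge> 1" using assms by (simp add: le_ceiling_iff)
  then have "cell_index d s = n \<longleftrightarrow> \<lceil>s / d\<rceil> = int n + 1"
    unfolding cell_index_def by auto
  also have "\<dots> \<longleftrightarrow> real n < s / d \<and> s / d \<le> real n + 1"
    by (subst ceiling_eq_iff) auto
  also have "\<dots> \<longleftrightarrow> d * real n < s \<and> s \<le> d * real (Suc n)"
    using assms by (simp add: field_simps)
  finally show ?thesis .
qed

lemma cell_index_bounds:
  assumes "d > 0" "s > 0"
  shows "d * real (cell_index d s) < s" "s \<le> d * real (Suc (cell_index d s))"
    "d * real (Suc (cell_index d s)) < s + d"
  using cell_index_eq_iff[OF assms, of "cell_index d s"] by (auto simp: algebra_simps)

lemma lborel_cell: assumes "d > 0" shows "emeasure lborel {d * real n<..d * real (Suc n)} < \<infinity>"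
   "measure lborel {d * real n<..d * real (Suc n)} = d"
proof -
  have "d * real n \<le> d * real (Suc n)" using assms by (intro mult_left_mono) auto
  then show "emeasure lborel {d * real n<..d * real (Suc n)} < \<infinity>" "measure lborel {d * real n<..d * real (Suc n)} = d"
    by (auto simp: distrib_left)
qed

text \<open>A lattice series becomes an integral over the fixed half-line \<open>{0<..}\<close>, so
  that scaling limits reduce to dominated convergence. At each \<open>s\<close> only one term of the
  series of indicators is nonzero, and the interchange of sum and integral rests on the summability
  of the cell masses.\<close>

lemma
  fixes f :: "nat \<Rightarrow> real"
  assumes d: "d > 0" and f: "summable (\<lambda>n. \<bar>f n\<bar>)"
  shows set_integrable_cells: "set_integrable lborel {0<..} (\<lambda>s. f (cell_index d s))"
    and integral_cells: "(LBINT s:{0<..}. f (cell_index d s)) = d * (\<Sum>n. f n)"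
proof -
  define g where "g n s = indicator {d * real n<..d * real (Suc n)} s * f n" for n s
  have cell: "has_bochner_integral lborel (indicator {d * real n<..d * real (Suc n)}) d" for n
    using has_bochner_integral_real_indicator[OF _ lborel_cell(1)[OF d]]
    unfolding lborel_cell(2)[OF d] by simp
  have g: "has_bochner_integral lborel (g n) (d * f n)" for n
    unfolding g_def by (rule has_bochner_integral_mult_left[OF cell])
  have gn: "has_bochner_integral lborel (\<lambda>s. norm (g n s)) (d * \<bar>f n\<bar>)" for n
    using has_bochner_integral_mult_left[OF cell[of n], where c = "\<bar>f n\<bar>"] by (simp add: g_def abs_mult)
  have single: "g n s = (if n = cell_index d s then indicator {0<..} s * f (cell_index d s) else 0)" for n s
  proof (cases "s > 0")
    case True
    then show ?thesis using cell_index_eq_iff[OF d True, of n] by (auto simp: g_def indicator_def)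
  next
    case False
    then have "\<not> d * real n < s" using d
      using mult_nonneg_nonneg[of d "real n"] by linarith
    then show ?thesis using False by (auto simp: g_def)
  qed
  have sums: "(\<lambda>n. g n s) sums (indicator {0<..} s * f (cell_index d s))" for s
    unfolding single by (rule sums_single)
  have AE: "AE s in lborel. summable (\<lambda>n. norm (g n s))"
  proof (rule AE_I2)
    fix s :: real
    have "(\<lambda>n. norm (g n s)) = (\<lambda>n. if n = cell_index d s then norm (indicator {0<..} s * f (cell_index d s)) else 0)"
      by (auto simp: single)
    then show "summable (\<lambda>n. norm (g n s))"
      using sums_summable[OF sums_single[of "cell_index d s" "\<lambda>_. norm (indicator {0<..} s * f (cell_index d s))"]] by simp
  qed
  have summ: "summable (\<lambda>n. \<integral>s. norm (g n s) \<partial>lborel)"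
    unfolding has_bochner_integral_integral_eq[OF gn] using f by (rule summable_mult)
  have ig: "integrable lborel (g n)" for n using g has_bochner_integral_iff by blast
  have eq: "(\<lambda>s. \<Sum>n. g n s) = (\<lambda>s. indicator {0<..} s *\<^sub>R f (cell_index d s))"
    using sums by (auto simp: sums_iff)
  show "set_integrable lborel {0<..} (\<lambda>s. f (cell_index d s))"
    unfolding set_integrable_def eq[symmetric]
    by (rule integrable_suminf[OF ig AE summ])
  have "(LBINT s:{0<..}. f (cell_index d s)) = (\<Sum>n. \<integral>s. g n s \<partial>lborel)"
    unfolding set_lebesgue_integral_def eq[symmetric]
    by (rule integral_suminf[OF ig AE summ])
  also have "\<dots> = (\<Sum>n. d * f n)"
    by (simp add: has_bochner_integral_integral_eq[OF g])
  also have "\<dots> = d * (\<Sum>n. f n)"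
    using f by (intro suminf_mult) (rule summable_rabs_cancel)
  finally show "(LBINT s:{0<..}. f (cell_index d s)) = d * (\<Sum>n. f n)" .
qed

text \<open>The smaller of \<open>t powr - p\<close> and \<open>t powr (a - p)\<close>: the majorant
  for a kernel of order \<open>- p\<close> times a factor that is both bounded and
  O(\<open>t powr a\<close>). It is integrable at infinity for \<open>p > 1\<close> and at 0 for
  \<open>p - a < 1\<close>. Second differences use \<open>a = 2\<close>, the flux a Hoelder
  exponent.\<close>

definition tail_kernel :: "real \<Rightarrow> real \<Rightarrow> real \<Rightarrow> real" where
  "tail_kernel p a t = t powr - p * min 1 (t powr a)"

lemma tail_kernel_measurable [measurable]: "tail_kernel p a \<in> borel_measurable borel"
  unfolding tail_kernel_def[abs_def] by measurable

lemma tail_kernel_nonneg: "0 \<le> tail_kernel p a t"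
  by (simp add: tail_kernel_def)

lemma tail_kernel_le:
  "tail_kernel p a t \<le> t powr - p" "tail_kernel p a t \<le> t powr (a - p)"
proof -
  show "tail_kernel p a t \<le> t powr - p"
    unfolding tail_kernel_def using mult_left_mono[of "min 1 (t powr a)" 1 "t powr -p"] by simp
  have "t powr - p * min 1 (t powr a) \<le> t powr - p * t powr a"
    by (intro mult_left_mono) auto
  also have "\<dots> = t powr (a - p)" by (simp add: powr_add[symmetric])
  finally show "tail_kernel p a t \<le> t powr (a - p)" unfolding tail_kernel_def .
qed

lemma mult_min_distrib: "0 \<le> c \<Longrightarrow> c * min x y = min (c * x) (c * y)" for c x y :: real
  by (rule min_of_mono[of "\<lambda>x. c * x", symmetric]) (rule monoI, rule mult_left_mono)

lemma tail_kernel_eq_min: "tail_kernel p a t = min (t powr - p) (t powr (a - p))"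
proof -
  have "t powr - p * min 1 (t powr a) = min (t powr - p * 1) (t powr - p * t powr a)"
    by (rule mult_min_distrib) simp
  then show ?thesis unfolding tail_kernel_def by (simp add: powr_add[symmetric])
qed

lemma tail_kernel_antimono:
  assumes "0 < s" "s \<le> t" "0 \<le> p" "a \<le> p"
  shows "tail_kernel p a t \<le> tail_kernel p a s"
  unfolding tail_kernel_eq_min using assms
  by (intro min.mono powr_mono2') auto

section \<open>Integrals of powers and of \<open>tail_kernel\<close> over half-lines\<close>

lemma set_integrable_powr_tail:
  assumes "p > (1::real)" "a > 0"
  shows "set_integrable lborel {a..} (\<lambda>t. t powr - p)" "(LBINT t:{a..}. t powr - p) = a powr (1 - p) / (p - 1)"
proof -
  have "((\<lambda>t. t powr - p) has_integral (- (a powr (- p + 1)) / (- p + 1))) {a..}"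
    using assms by (intro has_integral_powr_to_inf) auto
  moreover have "- (a powr (- p + 1)) / (- p + 1) = a powr (1 - p) / (p - 1)"
    using assms by (simp add: field_simps)
  ultimately have h: "((\<lambda>t. t powr - p) has_integral (a powr (1 - p) / (p - 1))) {a..}" by simp
  show "set_integrable lborel {a..} (\<lambda>t. t powr - p)" "(LBINT t:{a..}. t powr - p) = a powr (1 - p) / (p - 1)"
    using has_integral_imp_set_integrable_lborel[OF h] by auto
qed

lemma set_integrable_tail_kernel:
  assumes "p > 1" "p - a < 1"
  shows "set_integrable lborel {0<..} (tail_kernel p a)"
proof -
  have h: "((\<lambda>t. t powr (a - p)) has_integral (1 powr (a - p + 1) / (a - p + 1))) {0..1::real}"
    using assms by (intro has_integral_powr_from_0) auto
  have "set_integrable lborel {0..1} (\<lambda>t. t powr (a - p))"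
    using has_integral_imp_set_integrable_lborel[OF h] by auto
  then have 1: "set_integrable lborel {0..1} (tail_kernel p a)"
    by (rule set_integrable_bound)
       (use tail_kernel_le tail_kernel_nonneg in \<open>auto simp: set_borel_measurable_def\<close>)
  have 2: "set_integrable lborel {1..} (tail_kernel p a)"
    by (rule set_integrable_bound[OF set_integrable_powr_tail(1)[OF assms(1) zero_less_one]])
       (use tail_kernel_le tail_kernel_nonneg in \<open>auto simp: set_borel_measurable_def\<close>)
  have "set_integrable lborel ({0..1} \<union> {1..}) (tail_kernel p a)"
    by (rule set_integrable_Un[OF 1 2]) auto
  then show ?thesis by (rule set_integrable_subset) auto
qed

lemma set_integral_shift:
  fixes f :: "real \<Rightarrow> real"
  shows "(LBINT t:{a<..}. f t) = (LBINT t:{0<..}. f (a + t))"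
    and "(LBINT t:{..<a}. f t) = (LBINT t:{0<..}. f (a - t))"
    and "set_integrable lborel {a<..} f \<longleftrightarrow> set_integrable lborel {0<..} (\<lambda>t. f (a + t))"
proof -
  have [simp]: "indicator {a<..} (a + t) = (indicator {0<..} t :: real)"
     "indicator {..<a} (a - t) = (indicator {0<..} t :: real)" for t
    by (auto simp: indicator_def)
  show "(LBINT t:{a<..}. f t) = (LBINT t:{0<..}. f (a + t))"
    unfolding set_lebesgue_integral_def
    by (subst lborel_integral_real_affine[where c=1 and t=a]) auto
  show "(LBINT t:{..<a}. f t) = (LBINT t:{0<..}. f (a - t))"
    unfolding set_lebesgue_integral_def
    by (subst lborel_integral_real_affine[where c="-1" and t=a]) auto
  show "set_integrable lborel {a<..} f \<longleftrightarrow> set_integrable lborel {0<..} (\<lambda>t. f (a + t))"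
    unfolding set_integrable_def
    by (subst lborel_integrable_real_affine_iff[where c=1 and t=a, symmetric]) auto
qed

lemma set_integral_Ioi_eq_Ici:
  fixes f :: "real \<Rightarrow> real"
  shows "(LBINT t:{a<..}. f t) = (LBINT t:{a..}. f t)"
    "set_integrable lborel {a<..} f \<longleftrightarrow> set_integrable lborel {a..} f"
  by (rule set_integral_discrete_difference[where X="{a}"]
           set_integrable_discrete_difference[where X="{a}"]; auto)+

lemma
  assumes "p > (1::real)" "s > 0"
  shows set_integrable_shifted_powr: "set_integrable lborel {0<..} (\<lambda>t. (s + t) powr - p)"
    and integral_shifted_powr: "(LBINT t:{0<..}. (s + t) powr - p) = s powr (1 - p) / (p - 1)"
  using set_integrable_powr_tail[OF assms] set_integral_shift(1,3)[of s "\<lambda>t. t powr - p"]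
    set_integral_Ioi_eq_Ici[of s "\<lambda>t. t powr - p"] by auto

lemma set_integrable_shifted_tail_kernel:
  assumes "p > 1" "s > 0"
  shows "set_integrable lborel {0<..} (\<lambda>t. tail_kernel p a (s + t))"
  by (rule set_integrable_bound[OF set_integrable_shifted_powr[OF assms]])
     (use tail_kernel_le tail_kernel_nonneg in \<open>auto simp: set_borel_measurable_def\<close>)

text \<open>Integrating out one variable of a double integral lowers the order of the kernel by one
  and keeps \<open>a\<close>. The two branches of the minimum are integrated separately;
  \<open>1 / (g - a)\<close> dominates \<open>1 / g\<close> and so serves for both.\<close>

lemma integral_shifted_tail_kernel_le:
  assumes "a < g" "g > 0" "0 \<le> a" "s > 0"
  shows "(LBINT t:{0<..}. tail_kernel (1 + g) a (s + t)) \<le> 1 / (g - a) * tail_kernel g a s"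
proof -
  have 1: "(LBINT t:{0<..}. tail_kernel (1 + g) a (s + t)) \<le> (LBINT t:{0<..}. (s + t) powr - (1 + g))"
    using assms by (intro set_integral_mono set_integrable_shifted_tail_kernel set_integrable_shifted_powr tail_kernel_le) auto
  have 2: "(LBINT t:{0<..}. tail_kernel (1 + g) a (s + t)) \<le> (LBINT t:{0<..}. (s + t) powr - (1 + g - a))"
    using assms tail_kernel_le(2)[of "1 + g" a]
    by (intro set_integral_mono set_integrable_shifted_tail_kernel set_integrable_shifted_powr) auto
  have "(LBINT t:{0<..}. tail_kernel (1 + g) a (s + t)) \<le> s powr - g / g"
    using 1 assms by (subst (asm) integral_shifted_powr) auto
  also have "\<dots> \<le> s powr - g / (g - a)" using assms by (intro divide_left_mono) auto
  finally have 3: "(LBINT t:{0<..}. tail_kernel (1 + g) a (s + t)) \<le> 1 / (g - a) * s powr - g" by simp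
  have 4: "(LBINT t:{0<..}. tail_kernel (1 + g) a (s + t)) \<le> 1 / (g - a) * s powr (a - g)"
    using 2 assms by (subst (asm) integral_shifted_powr) (auto simp: algebra_simps)
  show ?thesis unfolding tail_kernel_eq_min[of g] using 3 4 by (auto simp: min_def)
qed

lemma summable_Suc_powr:
  assumes "p > (1::real)"
  shows "summable (\<lambda>n. real (Suc n) powr - p)"
  using summable_real_powr_iff[of "- p"] assms by (subst summable_Suc_iff) auto

text \<open>The factor \<open>d powr - \<gamma>\<close> is the mesh \<open>d\<close> times the
  homogeneity \<open>d powr - (1 + \<gamma>)\<close> of the kernel; it makes a jump operator on a
  lattice of mesh \<open>d\<close> comparable with an integral.\<close>

lemma
  fixes E :: "nat \<Rightarrow> real"
  assumes d: "d > 0" and \<gamma>: "\<gamma> > 0" and E: "\<And>n. \<bar>E n\<bar> \<le> C"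
  shows summable_weighted: "summable (\<lambda>n. \<bar>real (Suc n) powr - (1 + \<gamma>) * E n\<bar>)"
    and set_integrable_weighted_cells:
      "set_integrable lborel {0<..} (\<lambda>s. (d * real (Suc (cell_index d s))) powr - (1 + \<gamma>) * E (cell_index d s))"
    and integral_weighted_cells:
      "(LBINT s:{0<..}. (d * real (Suc (cell_index d s))) powr - (1 + \<gamma>) * E (cell_index d s))
        = d powr - \<gamma> * (\<Sum>n. real (Suc n) powr - (1 + \<gamma>) * E n)"
proof -
  show s: "summable (\<lambda>n. \<bar>real (Suc n) powr - (1 + \<gamma>) * E n\<bar>)"
  proof (rule summable_comparison_test')
    show "summable (\<lambda>n. real (Suc n) powr - (1 + \<gamma>) * C)"
      using \<gamma> by (intro summable_mult2 summable_Suc_powr) auto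
    show "norm \<bar>real (Suc n) powr - (1 + \<gamma>) * E n\<bar> \<le> real (Suc n) powr - (1 + \<gamma>) * C" for n
      using E[of n] by (simp add: abs_mult mult_left_mono del: of_nat_Suc)
  qed
  define f where "f n = (d * real (Suc n)) powr - (1 + \<gamma>) * E n" for n
  have f: "f n = d powr - (1 + \<gamma>) * (real (Suc n) powr - (1 + \<gamma>) * E n)" for n
    using d by (simp add: f_def powr_mult del: of_nat_Suc)
  have "summable (\<lambda>n. \<bar>f n\<bar>)"
    using summable_mult[OF s, of "d powr - (1 + \<gamma>)"] unfolding f by (simp add: abs_mult)
  note * = set_integrable_cells[OF d this] integral_cells[OF d this]
  show "set_integrable lborel {0<..} (\<lambda>s. (d * real (Suc (cell_index d s))) powr - (1 + \<gamma>) * E (cell_index d s))"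
    using *(1) by (simp add: f_def)
  have "(LBINT s:{0<..}. (d * real (Suc (cell_index d s))) powr - (1 + \<gamma>) * E (cell_index d s)) = d * (\<Sum>n. f n)"
    using *(2) by (simp add: f_def)
  also have "(\<Sum>n. f n) = d powr - (1 + \<gamma>) * (\<Sum>n. real (Suc n) powr - (1 + \<gamma>) * E n)"
    unfolding f using summable_rabs_cancel[OF s] by (rule suminf_mult)
  also have "d * (d powr - (1 + \<gamma>) * (\<Sum>n. real (Suc n) powr - (1 + \<gamma>) * E n)) =
     (d powr 1 * d powr - (1 + \<gamma>)) * (\<Sum>n. real (Suc n) powr - (1 + \<gamma>) * E n)"
    using d by simp
  also have "d powr 1 * d powr - (1 + \<gamma>) = d powr - \<gamma>"
    by (subst powr_add[symmetric]) simp
  finally show "(LBINT s:{0<..}. (d * real (Suc (cell_index d s))) powr - (1 + \<gamma>) * E (cell_index d s))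
        = d powr - \<gamma> * (\<Sum>n. real (Suc n) powr - (1 + \<gamma>) * E n)" .
qed

section \<open>Interior regularity of discrete harmonic functions\<close>

text \<open>Up to the factor \<open>jump_const \<gamma>\<close>, the sum of
  \<open>p (z - x) * (u z - u x)\<close> over all integers \<open>z\<close>. Opposite jumps are
  paired because the estimates below are made on second differences.\<close>

definition second_diff_sum :: "real \<Rightarrow> (int \<Rightarrow> real) \<Rightarrow> int \<Rightarrow> real" where
  "second_diff_sum \<gamma> u x = (\<Sum>n. real (Suc n) powr - (1 + \<gamma>) * (u (x + int (Suc n)) + u (x - int (Suc n)) - 2 * u x))"

text \<open>Quantitative concavity. The quadratic gain comes from \<open>1 - s\<close> alone: the
  binomial series of \<open>(1 - s) powr a\<close> has only negative coefficients after the
  constant, so the function lies below its quadratic Taylor polynomial. The range includes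
  \<open>s = 1\<close> because a jump may be as long as the distance of the two points.\<close>

lemma powr_second_difference_le:
  fixes a s :: real
  assumes a: "0 < a" "a < 1" and s: "0 \<le> s" "s \<le> 1"
  shows "(1 + s) powr a + (1 - s) powr a - 2 \<le> - (a * (1 - a) / 2) * s\<^sup>2"
proof -
  \<comment> \<open>The weighted arithmetic-geometric mean inequality for \<open>1 + s\<close> and 1
    with weights \<open>a\<close> and \<open>1 - a\<close>.\<close>
  have 1: "(1 + s) powr a \<le> 1 + a * s"
    using Youngs_inequality_0[of a "1 - a" "1 + s" 1] a s by (simp add: algebra_simps)
  have 2: "(1 - s) powr a \<le> 1 - a * s - a * (1 - a) / 2 * s\<^sup>2"
  proof (cases "s = 1")
    case True
    have "0 \<le> (1 - a) * (1 - a / 2)" using a by (intro mult_nonneg_nonneg) auto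
    then show ?thesis using True by (simp add: algebra_simps)
  next
    case False
    \<comment> \<open>The derivative is nonnegative since \<open>(1 - t) powr (a - 1)\<close> is at
      least \<open>exp ((1 - a) * t)\<close>, hence at least \<open>1 + (1 - a) * t\<close>. The
      endpoint \<open>s = 1\<close> was treated apart because \<open>(1 - t) powr a\<close> is not
      differentiable there.\<close>
    define g where "g t = 1 - a * t - a * (1 - a) / 2 * t\<^sup>2 - (1 - t) powr a" for t
    have "g 0 \<le> g s"
    proof (rule DERIV_nonneg_imp_nondecreasing[OF s(1)])
      fix t assume t: "0 \<le> t" "t \<le> s"
      then have t1: "t < 1" using s False by auto
      have "(g has_real_derivative (- a - a * (1 - a) * t + a * (1 - t) powr (a - 1))) (at t)"
        unfolding g_def[abs_def] using t1
        by (auto intro!: derivative_eq_intros simp: powr_diff field_simps)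
      moreover have "- a - a * (1 - a) * t + a * (1 - t) powr (a - 1) \<ge> 0"
      proof -
        have "ln (1 - t) \<le> - t" using ln_le_minus_one[of "1 - t"] t1 by simp
        then have "(1 - a) * t \<le> (1 - a) * (- ln (1 - t))" using a by (intro mult_left_mono) auto
        then have "(1 - a) * t \<le> (a - 1) * ln (1 - t)" by (simp add: algebra_simps)
        then have "1 + (1 - a) * t \<le> exp ((a - 1) * ln (1 - t))"
          using exp_ge_add_one_self[of "(1 - a) * t"] exp_le_cancel_iff[of "(1 - a) * t" "(a - 1) * ln (1 - t)"] by linarith
        also have "\<dots> = (1 - t) powr (a - 1)" using t1 by (simp add: powr_def)
        finally have "a * (1 + (1 - a) * t) \<le> a * (1 - t) powr (a - 1)" using a by (intro mult_left_mono) auto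
        then show ?thesis by (simp add: algebra_simps)
      qed
      ultimately show "\<exists>y. (g has_real_derivative y) (at t) \<and> 0 \<le> y" by blast
    qed
    then show ?thesis by (simp add: g_def)
  qed
  show ?thesis using 1 2 by simp
qed

lemma powr_second_difference_scaled_le:
  fixes a r k :: real
  assumes a: "0 < a" "a < 1" and "0 < r" "0 \<le> k" "k \<le> r"
  shows "(r + k) powr a + (r - k) powr a - 2 * r powr a \<le> - (a * (1 - a) / 2) * r powr (a - 2) * k\<^sup>2"
proof -
  have "(r + k) powr a = r powr a * (1 + k / r) powr a" "(r - k) powr a = r powr a * (1 - k / r) powr a"
    using assms by (simp_all add: powr_mult[symmetric] distrib_left right_diff_distrib)
  then have "(r + k) powr a + (r - k) powr a - 2 * r powr a
    = r powr a * ((1 + k / r) powr a + (1 - k / r) powr a - 2)" by (simp add: algebra_simps)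
  also have "\<dots> \<le> r powr a * (- (a * (1 - a) / 2) * (k / r)\<^sup>2)"
    using assms by (intro mult_left_mono powr_second_difference_le) auto
  also have "\<dots> = - (a * (1 - a) / 2) * r powr (a - 2) * k\<^sup>2"
  proof -
    have "r powr (a - 2) = r powr a / r\<^sup>2" using assms by (simp add: powr_diff)
    then show ?thesis by (simp add: power_divide)
  qed
  finally show ?thesis .
qed

text \<open>This bounds the jump operator on a cutoff that varies on the scale \<open>M\<close>.
  With mesh \<open>1 / M\<close> the sum is an integral of a sampled
  \<open>tail_kernel (1 + \<gamma>) 2\<close>, which lies below the integral of the kernel itself
  because the kernel decreases. The summand 1 in the witness makes \<open>K\<close> strictly
  positive.\<close>

lemma weighted_min_sum_le:
  assumes \<gamma>: "1 < \<gamma>" "\<gamma> < 2"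
  shows "\<exists>K>0. \<forall>M>0. (\<Sum>n. real (Suc n) powr - (1 + \<gamma>) * min 1 ((real (Suc n) / M)\<^sup>2)) \<le> K * M powr - \<gamma>"
proof (intro exI[of _ "(LBINT s:{0<..}. tail_kernel (1 + \<gamma>) 2 s) + 1"] conjI allI impI)
  have "0 \<le> (LBINT s:{0<..}. tail_kernel (1 + \<gamma>) 2 s)"
    unfolding set_lebesgue_integral_def by (intro Bochner_Integration.integral_nonneg) (auto simp: tail_kernel_nonneg)
  then show "0 < (LBINT s:{0<..}. tail_kernel (1 + \<gamma>) 2 s) + 1" by simp
next
  fix M :: real assume M: "M > 0"
  define E where "E n = min 1 ((real (Suc n) / M)\<^sup>2)" for n
  have E: "\<bar>E n\<bar> \<le> 1" for n by (simp add: E_def)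
  have d: "1 / M > 0" using M by simp
  have g0: "\<gamma> > 0" using \<gamma> by simp
  have "(1/M) powr - \<gamma> * (\<Sum>n. real (Suc n) powr - (1 + \<gamma>) * E n) =
     (LBINT s:{0<..}. (1/M * real (Suc (cell_index (1/M) s))) powr - (1 + \<gamma>) * E (cell_index (1/M) s))"
    using integral_weighted_cells[OF d g0, where E=E, OF E] by simp
  also have "\<dots> = (LBINT s:{0<..}. tail_kernel (1 + \<gamma>) 2 (1/M * real (Suc (cell_index (1/M) s))))"
    by (intro set_lebesgue_integral_cong) (use M in \<open>auto simp: tail_kernel_def E_def powr_numeral\<close>)
  also have "\<dots> \<le> (LBINT s:{0<..}. tail_kernel (1 + \<gamma>) 2 s)"
  proof (intro set_integral_mono)
    have "set_integrable lborel {0<..} (\<lambda>s. (1/M * real (Suc (cell_index (1/M) s))) powr - (1 + \<gamma>) * E (cell_index (1/M) s))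
       \<longleftrightarrow> set_integrable lborel {0<..} (\<lambda>s. tail_kernel (1 + \<gamma>) 2 (1/M * real (Suc (cell_index (1/M) s))))"
      by (intro set_integrable_cong) (use M in \<open>auto simp: tail_kernel_def E_def powr_numeral\<close>)
    then show "set_integrable lborel {0<..} (\<lambda>s. tail_kernel (1 + \<gamma>) 2 (1/M * real (Suc (cell_index (1/M) s))))"
      using set_integrable_weighted_cells[OF d g0, where E=E, OF E] by simp
    show "set_integrable lborel {0<..} (tail_kernel (1 + \<gamma>) 2)"
      using \<gamma> by (intro set_integrable_tail_kernel) auto
    show "tail_kernel (1 + \<gamma>) 2 (1/M * real (Suc (cell_index (1/M) s))) \<le> tail_kernel (1 + \<gamma>) 2 s" if "s \<in> {0<..}" for s
      using that d \<gamma> cell_index_bounds(2)[OF d, of s] by (intro tail_kernel_antimono) auto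
  qed
  also have "\<dots> \<le> (LBINT s:{0<..}. tail_kernel (1 + \<gamma>) 2 s) + 1" by simp
  finally have "(\<Sum>n. real (Suc n) powr - (1 + \<gamma>) * E n) \<le> ((LBINT s:{0<..}. tail_kernel (1 + \<gamma>) 2 s) + 1) / (1/M) powr - \<gamma>"
    using M by (simp add: field_simps)
  also have "\<dots> = ((LBINT s:{0<..}. tail_kernel (1 + \<gamma>) 2 s) + 1) * M powr - \<gamma>"
    using M by (simp add: powr_minus powr_divide field_simps)
  finally show "(\<Sum>n. real (Suc n) powr - (1 + \<gamma>) * min 1 ((real (Suc n) / M)\<^sup>2)) \<le> ((LBINT s:{0<..}. tail_kernel (1 + \<gamma>) 2 s) + 1) * M powr - \<gamma>"
    by (simp add: E_def)
qed


lemma second_diff_sum_summable: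
  assumes "\<gamma> > 0" "\<And>z. \<bar>u z\<bar> \<le> C"
  shows "summable (\<lambda>n. real (Suc n) powr - (1 + \<gamma>) * (u (x + int (Suc n)) + u (x - int (Suc n)) - 2 * u x))"
proof (rule summable_rabs_cancel, rule summable_weighted)
  show "(1::real) > 0" by simp
  show "\<gamma> > 0" by fact
  show "\<bar>u (x + int (Suc n)) + u (x - int (Suc n)) - 2 * u x\<bar> \<le> 4 * C" for n
    using assms(2)[of "x + int (Suc n)"] assms(2)[of "x - int (Suc n)"] assms(2)[of x] by linarith
qed

text \<open>Truncation preserves upper bounds on second differences: where the cutoff equals 1 it
  cannot increase, and elsewhere it agrees with the parabola at \<open>z\<close> and lies below it
  at \<open>z + k\<close> and \<open>z - k\<close>.\<close>

lemma truncated_square_second_diff_le: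
  fixes M :: real and z y0 k :: int
  assumes "M > 0"
  defines "f \<equiv> \<lambda>z. min 1 ((real_of_int (z - y0) / M)\<^sup>2)"
  shows "f (z + k) + f (z - k) - 2 * f z \<le> 2 * min 1 ((real_of_int k / M)\<^sup>2)"
proof (cases "(real_of_int (z - y0) / M)\<^sup>2 \<ge> 1")
  case True
  then have "f z = 1" by (simp add: f_def)
  moreover have "f (z + k) \<le> 1" "f (z - k) \<le> 1" by (auto simp: f_def)
  moreover have "0 \<le> min 1 ((real_of_int k / M)\<^sup>2)" by simp
  ultimately show ?thesis by linarith
next
  case False
  then have z: "f z = (real_of_int (z - y0) / M)\<^sup>2" by (simp add: f_def)
  have "0 \<le> f z" by (simp add: f_def)
  moreover have "f (z + k) \<le> 1" "f (z - k) \<le> 1" by (auto simp: f_def)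
  ultimately have 1: "f (z + k) + f (z - k) - 2 * f z \<le> 2" by linarith
  have "f (z + k) \<le> (real_of_int (z + k - y0) / M)\<^sup>2" "f (z - k) \<le> (real_of_int (z - k - y0) / M)\<^sup>2"
    by (auto simp: f_def)
  then have "f (z + k) + f (z - k) - 2 * f z \<le>
      (real_of_int (z + k - y0) / M)\<^sup>2 + (real_of_int (z - k - y0) / M)\<^sup>2 - 2 * (real_of_int (z - y0) / M)\<^sup>2"
    unfolding z by linarith
  also have "\<dots> = 2 * (real_of_int k / M)\<^sup>2"
    using assms(1) by (simp add: power2_eq_square field_simps)
  finally show ?thesis using 1 by (simp add: min_def)
qed

text \<open>Doubling of variables. At a maximum of
  \<open>u x - u y - A (\<bar>x - y\<bar> / N)\<^sup>a - \<zeta> x - \<zeta> y\<close> the jumps no longer than \<open>\<bar>x - y\<bar>\<close> of the two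
  points are taken independently and the longer ones simultaneously, so that only the former act
  on the concave term, which they decrease.\<close>

lemma one_sided_hoelder_estimate:
  assumes \<gamma>: "1 < \<gamma>" "\<gamma> < 2" and a: "0 < a" "a < 1"
    and K: "\<And>M. M > 0 \<Longrightarrow> (\<Sum>n. real (Suc n) powr - (1 + \<gamma>) * min 1 ((real (Suc n) / M)\<^sup>2)) \<le> K * M powr - \<gamma>"
    and \<kappa>: "0 < \<kappa>" and N: "N > 0"
    and A: "A > 0" "4 * K * \<kappa> powr - \<gamma> < A * (a * (1 - a)) * (2 * \<kappa>) powr (a - \<gamma>)"
    and u: "\<And>z. 0 \<le> u z" "\<And>z. u z \<le> 1" "\<And>x. x \<in> sites N \<Longrightarrow> second_diff_sum \<gamma> u x = 0"
    and y0: "\<kappa> * real N \<le> real_of_int y0" "real_of_int y0 \<le> (1 - \<kappa>) * real N"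
  shows "u x1 - u y1 \<le> A * (\<bar>real_of_int (x1 - y1)\<bar> / N) powr a
     + min 1 ((real_of_int (x1 - y0) / (\<kappa> * N))\<^sup>2) + min 1 ((real_of_int (y1 - y0) / (\<kappa> * N))\<^sup>2)"
proof (rule ccontr)
  define M where "M = \<kappa> * real N"
  have M: "M > 0" using \<kappa> N by (simp add: M_def)
  \<comment> \<open>The penalty reaches 1 at distance \<open>M\<close> from \<open>y0\<close>.
    Differences of \<open>u\<close> are at most 1, so \<open>\<Psi> > 0\<close> confines both points
    to within \<open>M\<close> of \<open>y0\<close>; the position of \<open>y0\<close> then makes
    them sites, where the equation holds.\<close>
  define \<zeta> where "\<zeta> z = min 1 ((real_of_int (z - y0) / M)\<^sup>2)" for z
  define \<phi> where "\<phi> i = A * (\<bar>real_of_int i\<bar> / N) powr a" for i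
  define \<Psi> where "\<Psi> p = u (fst p) - u (snd p) - \<phi> (fst p - snd p) - \<zeta> (fst p) - \<zeta> (snd p)" for p
  assume "\<not> ?thesis"
  then have pos1: "\<Psi> (x1, y1) > 0" by (simp add: \<Psi>_def \<phi>_def \<zeta>_def M_def)
  have \<phi>0: "\<phi> i \<ge> 0" for i using A by (simp add: \<phi>_def)
  have \<zeta>0: "\<zeta> i \<ge> 0" for i by (simp add: \<zeta>_def)
  have near: "\<bar>real_of_int (z - y0)\<bar> < M" if "\<zeta> z < 1" for z
  proof -
    have "(real_of_int (z - y0) / M)\<^sup>2 < 1\<^sup>2" using that by (auto simp: \<zeta>_def min_def split: if_splits)
    then have "\<bar>real_of_int (z - y0) / M\<bar> < 1" by (simp add: abs_square_less_1)
    then show ?thesis using M by (simp add: field_simps)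
  qed
  have near\<Psi>: "\<zeta> (fst p) < 1 \<and> \<zeta> (snd p) < 1" if "\<Psi> p > 0" for p
    using that \<phi>0[of "fst p - snd p"] \<zeta>0[of "fst p"] \<zeta>0[of "snd p"] u(1)[of "snd p"] u(2)[of "fst p"]
    unfolding \<Psi>_def by linarith
  \<comment> \<open>Positivity leaves finitely many pairs, so the maximum over all pairs of integers
    is attained.\<close>
  define S where "S = {p. \<Psi> p > 0}"
  have "S \<subseteq> {y0 - \<lceil>M\<rceil>..y0 + \<lceil>M\<rceil>} \<times> {y0 - \<lceil>M\<rceil>..y0 + \<lceil>M\<rceil>}"
  proof
    fix p assume "p \<in> S"
    then have "\<bar>real_of_int (fst p - y0)\<bar> < M" "\<bar>real_of_int (snd p - y0)\<bar> < M"
      using near\<Psi> near by (auto simp: S_def)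
    then have "\<bar>fst p - y0\<bar> \<le> \<lceil>M\<rceil>" "\<bar>snd p - y0\<bar> \<le> \<lceil>M\<rceil>" by linarith+
    then show "p \<in> {y0 - \<lceil>M\<rceil>..y0 + \<lceil>M\<rceil>} \<times> {y0 - \<lceil>M\<rceil>..y0 + \<lceil>M\<rceil>}"
      by (cases p) auto
  qed
  then have "finite S" by (rule finite_subset) auto
  moreover have "S \<noteq> {}" using pos1 by (auto simp: S_def)
  ultimately have fin: "finite (\<Psi> ` S)" "\<Psi> ` S \<noteq> {}" by auto
  obtain p where p1: "p \<in> S" "\<Psi> p = Max (\<Psi> ` S)" using Max_in[OF fin] by auto
  have p: "p \<in> S" "\<And>q. q \<in> S \<Longrightarrow> \<Psi> q \<le> \<Psi> p"
    unfolding p1(2) using p1(1) Max_ge[OF fin(1)] by auto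
  obtain x y where xy: "p = (x, y)" by (cases p)
  have pos: "\<Psi> (x, y) > 0" using p(1) by (simp add: S_def xy)
  have max: "\<Psi> q \<le> \<Psi> (x, y)" for q
    using p(2)[of q] pos unfolding xy S_def by (cases "\<Psi> q > 0") auto
  have x: "\<bar>real_of_int (x - y0)\<bar> < M" and y: "\<bar>real_of_int (y - y0)\<bar> < M"
    using near\<Psi>[OF pos] near by auto
  have xs: "z \<in> sites N" if "\<bar>real_of_int (z - y0)\<bar> < M" for z
  proof -
    have "0 < real_of_int z" "real_of_int z < real N"
      using that y0 unfolding M_def by (auto simp: algebra_simps abs_less_iff)
    then show ?thesis by (auto simp: sites_def)
  qed
  define r where "r = nat \<bar>x - y\<bar>"
  have "x \<noteq> y"
  proof
    assume "x = y"
    then show False using pos \<phi>0[of 0] \<zeta>0[of y] by (simp add: \<Psi>_def)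
  qed
  then have r1: "r \<ge> 1" by (simp add: r_def)
  have rM: "real r \<le> 2 * M" using x y unfolding r_def by linarith
  have \<phi>r: "\<phi> (x - y) = A * (real r / N) powr a" by (simp add: \<phi>_def r_def)
  define \<delta> where "\<delta> v z k = v (z + k) + v (z - k) - 2 * v z" for v :: "int \<Rightarrow> real" and z k
  \<comment> \<open>Both points move together, so the concave term is unchanged and only the
    penalties are felt.\<close>
  have d1: "\<delta> u x k - \<delta> u y k \<le> \<delta> \<zeta> x k + \<delta> \<zeta> y k" for k
    using max[of "(x + k, y + k)"] max[of "(x - k, y - k)"] by (simp add: \<Psi>_def \<delta>_def)
  define c where "c = a * (1 - a) / 2 * real N powr - a"
  \<comment> \<open>Four comparisons with the maximum: each point moves alone by \<open>k\<close>
    and by \<open>- k\<close>. The second difference of \<open>\<phi>\<close> therefore enters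
    twice, and \<open>k \<le> r\<close> keeps \<open>r - k\<close> nonnegative, as the concavity
    estimate requires.\<close>
  have d2: "\<delta> u x (int k) - \<delta> u y (int k) \<le> \<delta> \<zeta> x (int k) + \<delta> \<zeta> y (int k) - 2 * A * c * real r powr (a - 2) * (real k)\<^sup>2" if "k \<le> r" for k
  proof -
    have e: "\<phi> (x - y + int k) + \<phi> (x - y - int k) - 2 * \<phi> (x - y) =
      A * real N powr - a * ((real r + real k) powr a + (real r - real k) powr a - 2 * real r powr a)"
    proof -
      \<comment> \<open>The sign of \<open>x - y\<close> decides which of the two moves lengthens
        the distance; an equality of unordered pairs covers both cases.\<close>
      have "{\<bar>real_of_int (x - y + int k)\<bar>, \<bar>real_of_int (x - y - int k)\<bar>} = {real r + real k, real r - real k}"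
      proof (cases "x \<ge> y")
        case True
        then have "real r = real_of_int (x - y)" by (simp add: r_def)
        then show ?thesis using that by (auto simp: algebra_simps)
      next
        case False
        then have "real r = real_of_int (y - x)" by (simp add: r_def)
        then show ?thesis using that by (auto simp: algebra_simps)
      qed
      then have "\<phi> (x - y + int k) + \<phi> (x - y - int k) = A * ((real r + real k) / N) powr a + A * ((real r - real k) / N) powr a"
        unfolding \<phi>_def doubleton_eq_iff by (elim disjE conjE) (simp_all only: add.commute)
      then show ?thesis unfolding \<phi>r using N that by (simp add: powr_divide powr_minus field_simps)
    qed
    have "\<delta> u x (int k) - \<delta> u y (int k) \<le> \<delta> \<zeta> x (int k) + \<delta> \<zeta> y (int k)
        + 2 * (\<phi> (x - y + int k) + \<phi> (x - y - int k) - 2 * \<phi> (x - y))"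
      using max[of "(x + int k, y)"] max[of "(x - int k, y)"] max[of "(x, y + int k)"] max[of "(x, y - int k)"]
      unfolding \<Psi>_def \<delta>_def fst_conv snd_conv by (simp add: algebra_simps)
    also have "\<dots> \<le> \<delta> \<zeta> x (int k) + \<delta> \<zeta> y (int k)
        + 2 * (A * real N powr - a * (- (a * (1 - a) / 2) * real r powr (a - 2) * (real k)\<^sup>2))"
      unfolding e using a A r1 that
      by (intro add_left_mono mult_left_mono powr_second_difference_scaled_le) auto
    finally show ?thesis by (simp add: c_def algebra_simps)
  qed
  define m where "m n = min 1 ((real (Suc n) / M)\<^sup>2)" for n
  define w where "w n = real (Suc n) powr - (1 + \<gamma>)" for n
  have w0: "w n \<ge> 0" for n by (simp add: w_def)
  \<comment> \<open>Index \<open>n\<close> stands for the jump length \<open>Suc n\<close>, so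
    \<open>n < r\<close> selects the lengths up to and including \<open>r\<close>.\<close>
  define b where "b n = (if n < r then 2 * A * c * real r powr (a - 2) * (real (Suc n))\<^sup>2 else 0)" for n
  have trm: "w n * \<delta> u x (int (Suc n)) - w n * \<delta> u y (int (Suc n)) \<le> 4 * (w n * m n) - w n * b n" for n
  proof -
    have "\<delta> \<zeta> z (int (Suc n)) \<le> 2 * m n" for z
      using truncated_square_second_diff_le[OF M, where z=z and k = "int (Suc n)" and ?y0.0 = y0]
      by (simp add: \<delta>_def \<zeta>_def m_def)
    from this[of x] this[of y]
    have "\<delta> u x (int (Suc n)) - \<delta> u y (int (Suc n)) \<le> 4 * m n - b n"
      using d1[of "int (Suc n)"] d2[of "Suc n"] by (cases "n < r") (auto simp: b_def simp del: of_nat_Suc)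
    then have "w n * (\<delta> u x (int (Suc n)) - \<delta> u y (int (Suc n))) \<le> w n * (4 * m n - b n)"
      using w0 by (intro mult_left_mono)
    then show ?thesis by (simp add: algebra_simps)
  qed
  have sx: "(\<lambda>n. w n * \<delta> u z (int (Suc n))) sums 0" if "z \<in> sites N" for z
  proof -
    have "summable (\<lambda>n. w n * \<delta> u z (int (Suc n)))"
      unfolding w_def \<delta>_def using \<gamma> u by (intro second_diff_sum_summable[where C=1]) auto
    then show ?thesis using u(3)[OF that] unfolding second_diff_sum_def w_def \<delta>_def by (simp add: sums_iff)
  qed
  have sm: "summable (\<lambda>n. w n * m n)"
    unfolding w_def using \<gamma> by (intro summable_rabs_cancel[OF summable_weighted[where d=1 and C=1]]) (auto simp: m_def)
  have sb: "(\<lambda>n. w n * b n) sums (\<Sum>n<r. w n * b n)"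
    by (rule sums_finite) (auto simp: b_def)
  have "0 - 0 \<le> 4 * (\<Sum>n. w n * m n) - (\<Sum>n<r. w n * b n)"
    by (rule sums_le[OF trm sums_diff[OF sx sx] sums_diff[OF sums_mult[OF summable_sums[OF sm]] sb]])
       (use xs x y in auto)
  moreover have "(\<Sum>n. w n * m n) \<le> K * M powr - \<gamma>"
    using K[OF M] by (simp add: w_def m_def)
  \<comment> \<open>The summand is proportional to \<open>real (Suc n) powr (1 - \<gamma>)\<close>,
    which decreases; bounding all \<open>r\<close> terms by the last one gives a gain of order
    \<open>r powr (a - \<gamma>)\<close>. As \<open>a < \<gamma>\<close>, this is least at the
    largest distance \<open>2 * M\<close>, where it has the same order
    \<open>N powr - \<gamma>\<close> as the cost of the penalties, and \<open>A\<close> decides the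
    comparison.\<close>
  moreover have "(\<Sum>n<r. w n * b n) \<ge> (2 * A * c) * real r powr (a - \<gamma>)"
  proof -
    have "w n * b n \<ge> 2 * A * c * real r powr (a - 2) * real r powr (1 - \<gamma>)" if "n < r" for n
    proof -
      have "w n * b n = 2 * A * c * real r powr (a - 2) * (real (Suc n) powr - (1 + \<gamma>) * real (Suc n) powr 2)"
        using that by (simp add: w_def b_def powr_numeral del: of_nat_Suc)
      also have "real (Suc n) powr - (1 + \<gamma>) * real (Suc n) powr 2 = real (Suc n) powr (1 - \<gamma>)"
        by (subst powr_add[symmetric]) simp
      also have "2 * A * c * real r powr (a - 2) * real (Suc n) powr (1 - \<gamma>) \<ge>
          2 * A * c * real r powr (a - 2) * real r powr (1 - \<gamma>)"
        using that \<gamma> A a N by (intro mult_left_mono powr_mono2') (auto simp: c_def)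
      finally show ?thesis .
    qed
    then have e1: "(\<Sum>n<r. w n * b n) \<ge> (\<Sum>n<r. 2 * A * c * real r powr (a - 2) * real r powr (1 - \<gamma>))"
      by (intro sum_mono) auto
    have e2: "(\<Sum>n<r. 2 * A * c * real r powr (a - 2) * real r powr (1 - \<gamma>))
       = 2 * A * c * (real r powr 1 * real r powr (a - 2) * real r powr (1 - \<gamma>))" using r1 by simp
    have e3: "real r powr 1 * real r powr (a - 2) * real r powr (1 - \<gamma>) = real r powr (a - \<gamma>)"
      unfolding powr_add[symmetric] by simp
    show ?thesis using e1 unfolding e2 e3 .
  qed
  moreover have "(2 * A * c) * real r powr (a - \<gamma>) \<ge> (2 * A * c) * (2 * M) powr (a - \<gamma>)"
    using rM r1 A a N \<gamma> by (intro mult_left_mono powr_mono2') (auto simp: c_def)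
  moreover have "(2 * A * c) * (2 * M) powr (a - \<gamma>) = A * (a * (1 - a)) * (2 * \<kappa>) powr (a - \<gamma>) * real N powr - \<gamma>"
  proof -
    have "(2 * M) powr (a - \<gamma>) = (2 * \<kappa>) powr (a - \<gamma>) * real N powr (a - \<gamma>)"
      using \<kappa> by (simp add: M_def powr_mult)
    moreover have "real N powr - a * real N powr (a - \<gamma>) = real N powr - \<gamma>"
      by (subst powr_add[symmetric]) simp
    ultimately show ?thesis by (simp add: c_def)
  qed
  moreover have "M powr - \<gamma> = \<kappa> powr - \<gamma> * real N powr - \<gamma>" using \<kappa> by (simp add: M_def powr_mult)
  ultimately have "A * (a * (1 - a)) * (2 * \<kappa>) powr (a - \<gamma>) * real N powr - \<gamma> \<le> 4 * K * \<kappa> powr - \<gamma> * real N powr - \<gamma>"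
    by simp
  then have "A * (a * (1 - a)) * (2 * \<kappa>) powr (a - \<gamma>) \<le> 4 * K * \<kappa> powr - \<gamma>"
    using N by simp
  then show False using A by simp
qed

text \<open>With one of the two points placed at \<open>y0\<close> its penalty vanishes, and the
  other penalty is absorbed by \<open>min 1 (t\<^sup>2) \<le> t powr a\<close>. Exchanging the roles
  of the points gives the absolute value. The constant is built from \<open>\<gamma>\<close>,
  \<open>a\<close> and \<open>\<kappa>\<close> alone, hence the uniformity in
  \<open>N\<close>.\<close>

lemma hoelder_estimate:
  assumes \<gamma>: "1 < \<gamma>" "\<gamma> < 2" and a: "0 < a" "a < 1" and \<kappa>: "0 < \<kappa>"
  shows "\<exists>C>0. \<forall>N u y0 x. N > 0 \<longrightarrow> (\<forall>z. 0 \<le> u z \<and> u z \<le> 1) \<longrightarrow> (\<forall>x\<in>sites N. second_diff_sum \<gamma> u x = 0) \<longrightarrow>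
     \<kappa> * real N \<le> real_of_int y0 \<longrightarrow> real_of_int y0 \<le> (1 - \<kappa>) * real N \<longrightarrow>
     \<bar>u x - u y0\<bar> \<le> C * (\<bar>real_of_int (x - y0)\<bar> / real N) powr a"
proof -
  obtain K where K: "K > 0" "\<And>M. M > 0 \<Longrightarrow> (\<Sum>n. real (Suc n) powr - (1 + \<gamma>) * min 1 ((real (Suc n) / M)\<^sup>2)) \<le> K * M powr - \<gamma>"
    using weighted_min_sum_le[OF \<gamma>] by blast
  define B where "B = a * (1 - a) * (2 * \<kappa>) powr (a - \<gamma>)"
  have B: "B > 0" using a \<kappa> by (simp add: B_def)
  \<comment> \<open>Large enough for the concave gain \<open>A * B\<close> to exceed the penalty
    cost; the summand 1 makes the inequality strict.\<close>
  define A where "A = 4 * K * \<kappa> powr - \<gamma> / B + 1"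
  have A: "A > 0" using K B by (simp add: A_def add_nonneg_pos)
  have "4 * K * \<kappa> powr - \<gamma> < A * B" using B by (simp add: A_def field_simps)
  then have A2: "4 * K * \<kappa> powr - \<gamma> < A * (a * (1 - a)) * (2 * \<kappa>) powr (a - \<gamma>)"
    by (simp add: B_def mult.assoc)
  show ?thesis
  proof (intro exI[of _ "A + \<kappa> powr - a"] conjI allI impI)
    show "A + \<kappa> powr - a > 0" using A by (simp add: add_pos_nonneg)
    fix N u y0 x
    assume N: "(N::nat) > 0" and u: "\<forall>z. 0 \<le> u z \<and> u z \<le> 1" and h: "\<forall>x\<in>sites N. second_diff_sum \<gamma> u x = 0"
      and y0: "\<kappa> * real N \<le> real_of_int y0" "real_of_int y0 \<le> (1 - \<kappa>) * real N"
    have u': "\<And>z. 0 \<le> u z" "\<And>z. u z \<le> 1" using u by auto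
    have m: "min 1 ((real_of_int (x - y0) / (\<kappa> * N))\<^sup>2) \<le> \<kappa> powr - a * (\<bar>real_of_int (x - y0)\<bar> / N) powr a"
    proof -
      define t where "t = \<bar>real_of_int (x - y0)\<bar> / (\<kappa> * N)"
      have t0: "t \<ge> 0" using \<kappa> by (simp add: t_def)
      have "min 1 (t\<^sup>2) \<le> t powr a"
      proof (cases "t \<ge> 1")
        case True
        then have "1 \<le> t powr a" using a by (simp add: ge_one_powr_ge_zero)
        then show ?thesis by (simp add: min_def)
      next
        case False
        show ?thesis
        proof (cases "t = 0")
          case False
          then have "t powr 2 \<le> t powr a" using t0 \<open>\<not> t \<ge> 1\<close> a by (intro powr_mono') auto
          then show ?thesis using False t0 by (simp add: powr_numeral)
        qed simp
      qed
      moreover have "t\<^sup>2 = (real_of_int (x - y0) / (\<kappa> * N))\<^sup>2" unfolding t_def by (simp add: power_divide)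
      moreover have "t powr a = \<kappa> powr - a * (\<bar>real_of_int (x - y0)\<bar> / N) powr a"
        using \<kappa> N by (simp add: t_def powr_divide powr_mult powr_minus field_simps)
      ultimately show ?thesis by simp
    qed
    have "u x - u y0 \<le> A * (\<bar>real_of_int (x - y0)\<bar> / N) powr a + min 1 ((real_of_int (x - y0) / (\<kappa> * N))\<^sup>2)"
      using one_sided_hoelder_estimate[where u=u, OF \<gamma> a K(2) \<kappa> N A A2 u' _ y0, where ?x1.0=x and ?y1.0=y0] h by auto
    moreover have "u y0 - u x \<le> A * (\<bar>real_of_int (y0 - x)\<bar> / N) powr a + min 1 ((real_of_int (x - y0) / (\<kappa> * N))\<^sup>2)"
      using one_sided_hoelder_estimate[where u=u, OF \<gamma> a K(2) \<kappa> N A A2 u' _ y0, where ?x1.0=y0 and ?y1.0=x] h by auto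
    moreover have "\<bar>real_of_int (y0 - x)\<bar> = \<bar>real_of_int (x - y0)\<bar>" by auto
    ultimately show "\<bar>u x - u y0\<bar> \<le> (A + \<kappa> powr - a) * (\<bar>real_of_int (x - y0)\<bar> / real N) powr a"
      using m by (auto simp: distrib_right abs_le_iff)
  qed
qed

section \<open>The fractional Laplacian and the weak formulation\<close>

lemma (in pair_sigma_finite) integrable_product_dominated:
  fixes f :: "'a \<Rightarrow> 'b \<Rightarrow> real"
  assumes [measurable]: "case_prod f \<in> borel_measurable (M1 \<Otimes>\<^sub>M M2)"
    and a: "integrable M1 a" and b: "integrable M2 b"
    and le: "\<And>x y. \<bar>f x y\<bar> \<le> a x * b y"
  shows "integrable (M1 \<Otimes>\<^sub>M M2) (case_prod f)"
proof (rule Fubini_integrable)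
  show "case_prod f \<in> borel_measurable (M1 \<Otimes>\<^sub>M M2)" by fact
  have i: "integrable M2 (\<lambda>y. f x y)" if "x \<in> space M1" for x
  proof (rule Bochner_Integration.integrable_bound)
    show "integrable M2 (\<lambda>y. a x * b y)" using b by simp
    show "(\<lambda>y. f x y) \<in> borel_measurable M2" using that by measurable
    show "AE y in M2. norm (f x y) \<le> norm (a x * b y)"
      using le[of x] by (intro AE_I2) (smt (verit) real_norm_def)
  qed
  then show "AE x in M1. integrable M2 (\<lambda>y. case_prod f (x, y))" by (intro AE_I2) auto
  show "integrable M1 (\<lambda>x. \<integral> y. norm (case_prod f (x, y)) \<partial>M2)"
  proof (rule Bochner_Integration.integrable_bound)
    show "integrable M1 (\<lambda>x. a x * (\<integral>y. b y \<partial>M2))" using a by simp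
    show "(\<lambda>x. \<integral> y. norm (case_prod f (x, y)) \<partial>M2) \<in> borel_measurable M1" by measurable
    show "AE x in M1. norm (\<integral> y. norm (case_prod f (x, y)) \<partial>M2) \<le> norm (a x * (\<integral>y. b y \<partial>M2))"
    proof (rule AE_I2)
      fix x assume x: "x \<in> space M1"
      have "(\<integral> y. norm (case_prod f (x, y)) \<partial>M2) \<le> (\<integral>y. a x * b y \<partial>M2)"
        using i[OF x] b le[of x] by (intro integral_mono) auto
      moreover have "0 \<le> (\<integral> y. norm (case_prod f (x, y)) \<partial>M2)" by (intro Bochner_Integration.integral_nonneg) auto
      ultimately show "norm (\<integral> y. norm (case_prod f (x, y)) \<partial>M2) \<le> norm (a x * (\<integral>y. b y \<partial>M2))"
        by simp
    qed
  qed
qed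

section \<open>Second differences and the fractional Laplacian of test functions\<close>

definition second_diff :: "(real \<Rightarrow> real) \<Rightarrow> real \<Rightarrow> real \<Rightarrow> real" where
  "second_diff f q h = f (q + h) + f (q - h) - 2 * f q"

lemma second_diff_bound_tail_kernel:
  assumes "\<And>q. \<bar>f q\<bar> \<le> M" "\<bar>second_diff f q h\<bar> \<le> M * h\<^sup>2" "h > 0"
  shows "\<bar>h powr - (1 + \<gamma>) * second_diff f q h\<bar> \<le> 4 * M * tail_kernel (1 + \<gamma>) 2 h"
proof -
  have M: "M \<ge> 0" using assms(1)[of 0] by simp
  have "\<bar>second_diff f q h\<bar> \<le> 4 * M"
    using assms(1)[of q] assms(1)[of "q + h"] assms(1)[of "q - h"] unfolding second_diff_def by linarith
  moreover have "\<bar>second_diff f q h\<bar> \<le> 4 * M * h\<^sup>2"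
    using assms(2) M mult_nonneg_nonneg[OF M zero_le_power2[of h]] by linarith
  ultimately have "\<bar>second_diff f q h\<bar> \<le> 4 * M * min 1 (h\<^sup>2)" by (simp add: min_def)
  then have "h powr - (1 + \<gamma>) * \<bar>second_diff f q h\<bar> \<le> h powr - (1 + \<gamma>) * (4 * M * min 1 (h\<^sup>2))"
    by (intro mult_left_mono) auto
  then show ?thesis using assms(3) by (simp add: abs_mult tail_kernel_def powr_numeral algebra_simps)
qed

lemma second_diff_measurable [measurable]:
  assumes [measurable]: "f \<in> borel_measurable borel"
  shows "(\<lambda>(q, h). second_diff f q h) \<in> borel_measurable (borel \<Otimes>\<^sub>M borel)"
    "second_diff f q \<in> borel_measurable borel" "(\<lambda>q. second_diff f q h) \<in> borel_measurable borel"
  unfolding second_diff_def[abs_def] by measurable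

lemma set_integrable_second_diff:
  assumes \<gamma>: "1 < \<gamma>" "\<gamma> < 2" and [measurable]: "f \<in> borel_measurable borel"
    and "\<And>q. \<bar>f q\<bar> \<le> M" "\<And>h. \<bar>second_diff f q h\<bar> \<le> M * h\<^sup>2"
  shows "set_integrable lborel {0<..} (\<lambda>h. h powr - (1 + \<gamma>) * second_diff f q h)"
proof (rule set_integrable_bound)
  show "set_integrable lborel {0<..} (\<lambda>h. 4 * M * tail_kernel (1 + \<gamma>) 2 h)"
    using set_integrable_tail_kernel[of "1 + \<gamma>" 2] \<gamma> by simp
  show "set_borel_measurable lborel {0<..} (\<lambda>h. h powr - (1 + \<gamma>) * second_diff f q h)"
    unfolding set_borel_measurable_def by measurable
  show "AE h in lborel. h \<in> {0<..} \<longrightarrow> norm (h powr - (1 + \<gamma>) * second_diff f q h) \<le> norm (4 * M * tail_kernel (1 + \<gamma>) 2 h)"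
    using second_diff_bound_tail_kernel[where f=f and M=M and q=q and \<gamma>=\<gamma>] assms(4,5) by (intro AE_I2) fastforce
qed

text \<open>Folding \<open>q + h\<close> onto \<open>q - h\<close> cancels the odd part of the
  singularity: each truncated integral is minus the integral of the second difference over
  \<open>h \<ge> \<epsilon>\<close>, and that integrand is absolutely integrable down to 0. In
  particular \<open>Lim\<close> denotes an actual limit here.\<close>

lemma frac_laplacian_eq:
  assumes \<gamma>: "1 < \<gamma>" "\<gamma> < 2" and H[measurable]: "H \<in> borel_measurable borel"
    and M: "\<And>q. \<bar>H q\<bar> \<le> M" and M2: "\<And>h. \<bar>second_diff H q h\<bar> \<le> M * h\<^sup>2"
  shows "frac_laplacian \<gamma> H q = - jump_const \<gamma> * (LBINT h:{0<..}. h powr - (1 + \<gamma>) * second_diff H q h)"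
proof -
  define F where "F h = (H q - H (q + h)) / \<bar>h\<bar> powr (1 + \<gamma>)" for h
  define G where "G h = h powr - (1 + \<gamma>) * second_diff H q h" for h
  have [measurable]: "F \<in> borel_measurable borel" "G \<in> borel_measurable borel"
    unfolding F_def[abs_def] G_def[abs_def] by measurable
  have G: "set_integrable lborel {0<..} G"
    unfolding G_def using set_integrable_second_diff[OF \<gamma> H M M2] .
  have Fb: "\<bar>F h\<bar> \<le> 2 * M * \<bar>h\<bar> powr - (1 + \<gamma>)" for h
  proof -
    have "\<bar>H q - H (q + h)\<bar> \<le> 2 * M" using M[of q] M[of "q + h"] by linarith
    then have "\<bar>h\<bar> powr - (1 + \<gamma>) * \<bar>H q - H (q + h)\<bar> \<le> \<bar>h\<bar> powr - (1 + \<gamma>) * (2 * M)" by (intro mult_left_mono) auto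
    moreover have "F h = \<bar>h\<bar> powr - (1 + \<gamma>) * (H q - H (q + h))"
      unfolding F_def by (subst powr_minus) (simp add: field_simps)
    then have "\<bar>F h\<bar> = \<bar>h\<bar> powr - (1 + \<gamma>) * \<bar>H q - H (q + h)\<bar>" by (simp add: abs_mult)
    ultimately show ?thesis by (simp add: algebra_simps)
  qed
  have trunc: "(LBINT y:{y. \<bar>y - q\<bar> \<ge> \<epsilon>}. (H q - H y) / \<bar>y - q\<bar> powr (1 + \<gamma>)) = - (LBINT h:{\<epsilon>..}. G h)"
    if e: "\<epsilon> > 0" for \<epsilon>
  proof -
    have I: "set_integrable lborel {\<epsilon>..} (\<lambda>h. 2 * M * h powr - (1 + \<gamma>))"
      using set_integrable_powr_tail(1)[of "1 + \<gamma>" \<epsilon>] \<gamma> e by simp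
    have i1: "set_integrable lborel {\<epsilon>..} F"
    proof (rule set_integrable_bound[OF I])
      show "set_borel_measurable lborel {\<epsilon>..} F" unfolding set_borel_measurable_def by measurable
      show "AE x in lborel. x \<in> {\<epsilon>..} \<longrightarrow> norm (F x) \<le> norm (2 * M * x powr - (1 + \<gamma>))"
        using Fb[of x for x] e by (intro AE_I2) (smt (verit) atLeast_iff real_norm_def)
    qed
    have i2: "set_integrable lborel {\<epsilon>..} (\<lambda>h. F (- h))"
    proof (rule set_integrable_bound[OF I])
      show "set_borel_measurable lborel {\<epsilon>..} (\<lambda>h. F (- h))" unfolding set_borel_measurable_def by measurable
      show "AE x in lborel. x \<in> {\<epsilon>..} \<longrightarrow> norm (F (- x)) \<le> norm (2 * M * x powr - (1 + \<gamma>))"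
        using Fb[of "- x" for x] e by (intro AE_I2) (smt (verit) abs_minus_cancel atLeast_iff real_norm_def)
    qed
    have i3: "set_integrable lborel {..-\<epsilon>} F"
      using i2 unfolding set_integrable_def
      by (subst lborel_integrable_real_affine_iff[where c="-1" and t=0, symmetric])
         (auto simp: indicator_def le_minus_iff cong: if_cong)
    have "(LBINT y:{y. \<bar>y - q\<bar> \<ge> \<epsilon>}. (H q - H y) / \<bar>y - q\<bar> powr (1 + \<gamma>)) = (LBINT h:{h. \<bar>h\<bar> \<ge> \<epsilon>}. F h)"
      unfolding set_lebesgue_integral_def
      by (subst lborel_integral_real_affine[where c=1 and t=q]) (auto simp: indicator_def F_def)
    also have "{h. \<bar>h\<bar> \<ge> \<epsilon>} = {\<epsilon>..} \<union> {..-\<epsilon>}" by auto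
    also have "(LBINT h:{\<epsilon>..} \<union> {..-\<epsilon>}. F h) = (LBINT h:{\<epsilon>..}. F h) + (LBINT h:{..-\<epsilon>}. F h)"
      using e i1 i3 by (intro set_integral_Un) auto
    also have "(LBINT h:{..-\<epsilon>}. F h) = (LBINT h:{\<epsilon>..}. F (- h))"
      by (subst set_integral_reflect) (simp add: atLeast_def)
    also have "(LBINT h:{\<epsilon>..}. F h) + \<dots> = (LBINT h:{\<epsilon>..}. F h + F (- h))"
      using i1 i2 by (rule set_integral_add(2)[symmetric])
    also have "\<dots> = (LBINT h:{\<epsilon>..}. - G h)"
    proof (intro set_lebesgue_integral_cong allI impI)
      fix h assume "h \<in> {\<epsilon>..}"
      then have "h > 0" using e by simp
      then show "F h + F (- h) = - G h"
        unfolding F_def G_def second_diff_def by (subst powr_minus) (simp add: field_simps)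
    qed auto
    also have "\<dots> = - (LBINT h:{\<epsilon>..}. G h)"
      unfolding set_lebesgue_integral_def by simp
    finally show ?thesis .
  qed
  \<comment> \<open>Substituting the inverse of \<epsilon> turns the one-sided limit at 0 into a
    limit at infinity, to which dominated convergence along a real parameter applies.\<close>
  have "((\<lambda>\<epsilon>. LBINT h:{\<epsilon>..}. G h) \<longlongrightarrow> (LBINT h:{0<..}. G h)) (at_right 0)"
    unfolding filterlim_at_right_to_top set_lebesgue_integral_def
  proof (rule integral_dominated_convergence_at_top)
    show "integrable lborel (\<lambda>h. norm (indicator {0<..} h *\<^sub>R G h))"
      using G unfolding set_integrable_def by (rule integrable_norm)
    show "AE h in lborel. ((\<lambda>t. indicator {inverse t..} h *\<^sub>R G h) \<longlongrightarrow> indicator {0<..} h *\<^sub>R G h) at_top"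
    proof (rule AE_I2)
      fix h :: real
      have "eventually (\<lambda>t. indicator {inverse t..} h *\<^sub>R G h = indicator {0<..} h *\<^sub>R G h) at_top"
      proof (cases "h > 0")
        case True
        show ?thesis
          using eventually_ge_at_top[of "inverse h"]
        proof eventually_elim
          fix t assume "inverse h \<le> t"
          then have "inverse t \<le> inverse (inverse h)" using True by (intro le_imp_inverse_le) auto
          then show "indicator {inverse t..} h *\<^sub>R G h = indicator {0<..} h *\<^sub>R G h" using True by simp
        qed
      next
        case False
        show ?thesis
          using eventually_gt_at_top[of 0]
        proof eventually_elim
          fix t :: real assume "0 < t"
          then have "0 < inverse t" by simp
          then have "\<not> inverse t \<le> h" using False by linarith
          then show "indicator {inverse t..} h *\<^sub>R G h = indicator {0<..} h *\<^sub>R G h" using False by simp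
        qed
      qed
      then show "((\<lambda>t. indicator {inverse t..} h *\<^sub>R G h) \<longlongrightarrow> indicator {0<..} h *\<^sub>R G h) at_top"
        by (rule tendsto_eventually)
    qed
    show "\<forall>\<^sub>F t in at_top. AE h in lborel. norm (indicator {inverse t..} h *\<^sub>R G h) \<le> norm (indicator {0<..} h *\<^sub>R G h)"
      using eventually_gt_at_top[of 0]
    proof eventually_elim
      fix t :: real assume "0 < t"
      then have "0 < inverse t" by simp
      then show "AE h in lborel. norm (indicator {inverse t..} h *\<^sub>R G h) \<le> norm (indicator {0<..} h *\<^sub>R G h)"
        using order.strict_trans2[of 0 "inverse t"] by (intro AE_I2) (simp add: indicator_def)
    qed
  qed measurable
  then have "((\<lambda>\<epsilon>. - (LBINT h:{\<epsilon>..}. G h)) \<longlongrightarrow> - (LBINT h:{0<..}. G h)) (at_right 0)"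
    by (rule tendsto_minus)
  then have "((\<lambda>\<epsilon>. LBINT y:{y. \<bar>y - q\<bar> \<ge> \<epsilon>}. (H q - H y) / \<bar>y - q\<bar> powr (1 + \<gamma>)) \<longlongrightarrow> - (LBINT h:{0<..}. G h)) (at_right 0)"
    by (rule Lim_transform_eventually)
       (auto simp: trunc eventually_at_right_less intro: eventually_mono[OF eventually_at_right_less])
  then have "Lim (at_right 0) (\<lambda>\<epsilon>. LBINT y:{y. \<bar>y - q\<bar> \<ge> \<epsilon>}. (H q - H y) / \<bar>y - q\<bar> powr (1 + \<gamma>)) = - (LBINT h:{0<..}. G h)"
    by (intro tendsto_Lim) auto
  then show ?thesis unfolding frac_laplacian_def G_def by simp
qed

lemma Cc2_bounds:
  assumes "H \<in> Cc2"
  obtains l r M where "0 < l" "l < r" "r < 1" "\<And>q. q \<notin> {l..r} \<Longrightarrow> H q = 0" "\<And>q. \<bar>H q\<bar> \<le> M"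
    "\<And>q h. \<bar>second_diff H q h\<bar> \<le> M * h\<^sup>2" "continuous_on UNIV H"
proof -
  let ?S = "closure {q. H q \<noteq> 0}"
  obtain H' H'' where H': "\<And>q. (H has_real_derivative H' q) (at q)"
    and H'': "\<And>q. (H' has_real_derivative H'' q) (at q)"
    and contH'': "continuous_on UNIV H''" and S: "compact ?S" "?S \<subseteq> {0<..<1}"
    using assms by (auto simp: Cc2_def)
  have out: "H q = 0" if "q \<notin> ?S" for q using that closure_subset[of "{q. H q \<noteq> 0}"] by auto
  obtain l r where lr: "0 < l" "l < r" "r < 1" "?S \<subseteq> {l..r}"
  proof (cases "?S = {}")
    case True
    then show ?thesis using that[of "1/3" "1/2"] by auto
  next
    case False
    obtain a where a: "a \<in> ?S" "\<And>x. x \<in> ?S \<Longrightarrow> a \<le> x" using compact_attains_inf[OF S(1) False] by blast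
    obtain b where b: "b \<in> ?S" "\<And>x. x \<in> ?S \<Longrightarrow> x \<le> b" using compact_attains_sup[OF S(1) False] by blast
    have "0 < a" "a \<le> b" "b < 1" using a b S(2) by auto
    \<comment> \<open>The right end is moved strictly beyond \<open>b\<close> and stays below 1,
      which secures \<open>l < r\<close> even when \<open>a = b\<close>.\<close>
    then show ?thesis using that[of a "(b + 1) / 2"] a b by force
  qed
  have Hout: "H q = 0" if "q \<notin> {l..r}" for q using out lr(4) that by blast
  have H'out: "H' q = 0" if "q \<notin> {l..r}" for q
  proof -
    have "open (- {l..r})" by auto
    then have "(H has_real_derivative 0) (at q)"
      using that Hout by (intro has_field_derivative_transform_within_open[OF DERIV_const[of 0]]) auto
    then show ?thesis using H' DERIV_unique by blast
  qed
  have H''out: "H'' q = 0" if "q \<notin> {l..r}" for q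
  proof -
    have "open (- {l..r})" by auto
    then have "(H' has_real_derivative 0) (at q)"
      using that H'out by (intro has_field_derivative_transform_within_open[OF DERIV_const[of 0]]) auto
    then show ?thesis using H'' DERIV_unique by blast
  qed
  have contH: "continuous_on UNIV H" using H' DERIV_continuous_on by blast
  have bd: "\<exists>M. \<forall>q. \<bar>f q\<bar> \<le> M" if c: "continuous_on UNIV f" and o: "\<And>q. q \<notin> {l..r} \<Longrightarrow> f q = 0" for f :: "real \<Rightarrow> real"
  proof -
    have "bounded (f ` {l..r})"
      using c by (intro compact_imp_bounded compact_continuous_image) (auto intro: continuous_on_subset)
    then obtain M where "\<forall>x\<in>f ` {l..r}. norm x \<le> M" unfolding bounded_iff by blast
    then have M: "\<And>q. q \<in> {l..r} \<Longrightarrow> \<bar>f q\<bar> \<le> M" by auto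
    have "\<bar>f q\<bar> \<le> max M 0" for q using M[of q] o[of q] by (cases "q \<in> {l..r}") auto
    then show ?thesis by blast
  qed
  obtain M0 where M0: "\<And>q. \<bar>H q\<bar> \<le> M0" using bd[OF contH Hout] by blast
  obtain M2 where M2: "\<And>q. \<bar>H'' q\<bar> \<le> M2" using bd[OF contH'' H''out] by blast
  have "\<bar>second_diff H q h\<bar> \<le> 2 * M2 * h\<^sup>2" for q h
  proof -
    have pos: "\<bar>second_diff H q h\<bar> \<le> 2 * M2 * h\<^sup>2" if h: "h > 0" for h
    proof -
      \<comment> \<open>The mean value theorem is used twice: for the even function
        \<open>H (q + t) + H (q - t)\<close> of \<open>t\<close>, whose derivative is a difference
        of values of \<open>H'\<close>, and then for \<open>H'\<close> on an interval of length
        \<open>2 * z\<close>. This is the origin of the factor 2.\<close>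
      have "\<exists>z>0. z < h \<and> (H (q + h) + H (q - h)) - (H (q + 0) + H (q - 0)) = (h - 0) * (H' (q + z) - H' (q - z))"
        using h by (intro MVT2[where f="\<lambda>t. H (q + t) + H (q - t)"])
          (auto intro!: derivative_eq_intros DERIV_chain2[OF H'])
      then obtain z where z: "0 < z" "z < h" "second_diff H q h = h * (H' (q + z) - H' (q - z))"
        by (auto simp: second_diff_def)
      have "\<exists>w>q - z. w < q + z \<and> H' (q + z) - H' (q - z) = ((q + z) - (q - z)) * H'' w"
        using z H'' by (intro MVT2) auto
      then obtain w where "H' (q + z) - H' (q - z) = 2 * z * H'' w" by auto
      then have "\<bar>second_diff H q h\<bar> = h * (2 * z * \<bar>H'' w\<bar>)" using z h by (simp add: abs_mult)
      also have "\<dots> \<le> h * (2 * h * M2)"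
        using z h M2[of w] by (intro mult_left_mono mult_mono) auto
      finally show ?thesis by (simp add: power2_eq_square algebra_simps)
    qed
    consider "h > 0" | "h = 0" | "h < 0" by linarith
    then show ?thesis
    proof cases
      case 3
      then show ?thesis using pos[of "- h"] by (simp add: second_diff_def add.commute)
    qed (use pos in \<open>auto simp: second_diff_def\<close>)
  qed
  moreover have "2 * M2 * h\<^sup>2 \<le> max M0 (2 * M2) * h\<^sup>2" for h :: real by (intro mult_right_mono) auto
  ultimately have "\<bar>second_diff H q h\<bar> \<le> max M0 (2 * M2) * h\<^sup>2" for q h by (meson order.trans)
  moreover have "\<bar>H q\<bar> \<le> max M0 (2 * M2)" for q using M0[of q] by auto
  ultimately show ?thesis using that[OF lr(1-3) Hout _ _ contH] by blast
qed

lemma integrable_indicator_Icc: "integrable lborel (indicator {a..b::real} :: real \<Rightarrow> real)"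
  by (cases "a \<le> b") (auto intro!: integrable_real_indicator)

lemma integrable_bounded_support:
  fixes f :: "real \<Rightarrow> real"
  assumes "f \<in> borel_measurable borel" "\<And>x. \<bar>f x\<bar> \<le> M" "\<And>x. x \<notin> {a..b} \<Longrightarrow> f x = 0"
  shows "integrable lborel f"
proof (rule Bochner_Integration.integrable_bound)
  show "integrable lborel (\<lambda>x. indicator {a..b} x * M)" using integrable_indicator_Icc by simp
  show "AE x in lborel. norm (f x) \<le> norm (indicator {a..b} x * M)"
    using order.trans[OF assms(2) abs_ge_self[of M]] assms(3) by (intro AE_I2) (auto simp: indicator_def)
qed (use assms in auto)

text \<open>The weight of the left reservoir in the weak formulation: for a point \<open>q\<close>
  of the support, the jumps from the negative half-line to \<open>q\<close> are those of length
  above \<open>q\<close>, and the kernel integrates over them to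
  \<open>q powr - \<gamma> / \<gamma>\<close>. The right reservoir follows by reflection.\<close>

lemma exterior_weight_integral:
  fixes H :: "real \<Rightarrow> real"
  assumes \<gamma>: "1 < \<gamma>" "\<gamma> < 2" and [measurable]: "H \<in> borel_measurable borel"
    and lr: "0 < l" "r < 1" and out: "\<And>q. q \<notin> {l..r} \<Longrightarrow> H q = 0" and M: "\<And>q. \<bar>H q\<bar> \<le> M"
  shows "set_integrable lborel {0<..} (\<lambda>h. h powr - (1 + \<gamma>) * (\<integral>y. indicator {..<0} y * H (y + h) \<partial>lborel))" (is ?A)
    and "(LBINT h:{0<..}. h powr - (1 + \<gamma>) * (\<integral>y. indicator {..<0} y * H (y + h) \<partial>lborel)) =
     (LBINT q:{0..1}. q powr - \<gamma> / \<gamma> * H q)" (is ?B)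
proof -
  \<comment> \<open>A jump from \<open>y < 0\<close> shorter than \<open>l\<close> cannot reach the
    support, so cutting at \<open>h \<ge> l\<close> costs nothing and removes the singularity. After
    the shift \<open>q = y + h\<close> the condition \<open>y < 0\<close> reads
    \<open>q < h\<close>.\<close>
  define f where "f h q = indicator {l..} h * h powr - (1 + \<gamma>) * (indicator {..<h} q * H q)" for h q :: real
  have shift: "(\<integral>y. indicator {..<0} y * H (y + h) \<partial>lborel) = (\<integral>q. indicator {..<h} q * H q \<partial>lborel)" for h
    by (subst lborel_integral_real_affine[where c=1 and t="h"])
       (auto simp: indicator_def add.commute intro!: Bochner_Integration.integral_cong)
  have inner: "indicator {0<..} h *\<^sub>R (h powr - (1 + \<gamma>) * (\<integral>y. indicator {..<0} y * H (y + h) \<partial>lborel)) =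
     (\<integral>q. f h q \<partial>lborel)" for h
  proof (cases "h \<ge> l")
    case True
    then show ?thesis using lr unfolding shift f_def by simp
  next
    case False
    then have "(\<lambda>q. indicator {..<h} q * H q) = (\<lambda>_. 0)" using out by (fastforce simp: indicator_def)
    then show ?thesis using False unfolding shift f_def by simp
  qed
  have a: "integrable lborel (\<lambda>h. indicator {l..} h * h powr - (1 + \<gamma>))"
    using set_integrable_powr_tail(1)[of "1 + \<gamma>" l] \<gamma> lr by (simp add: set_integrable_def)
  have b: "integrable lborel (\<lambda>q. M * indicator {l..r} q :: real)" using integrable_indicator_Icc by simp
  have int: "integrable (lborel \<Otimes>\<^sub>M lborel) (case_prod f)"
  proof (rule lborel_pair.integrable_product_dominated[OF _ a b])
    show "case_prod f \<in> borel_measurable (lborel \<Otimes>\<^sub>M lborel)"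
    proof -
      have "(\<lambda>(h, q). indicator {l..} h * h powr - (1 + \<gamma>) * ((if q < h then 1 else 0) * H q)) \<in> borel_measurable (lborel \<Otimes>\<^sub>M lborel)"
        by measurable
      moreover have "case_prod f = (\<lambda>(h, q). indicator {l..} h * h powr - (1 + \<gamma>) * ((if q < h then 1 else 0) * H q))"
        by (auto simp: f_def indicator_def)
      ultimately show ?thesis by simp
    qed
    show "\<bar>f h q\<bar> \<le> indicator {l..} h * h powr - (1 + \<gamma>) * (M * indicator {l..r} q)" for h q
      using M[of q] out[of q] by (auto simp: f_def indicator_def abs_mult mult_left_mono)
  qed
  have "integrable lborel (\<lambda>h. \<integral>q. f h q \<partial>lborel)"
    using lborel_pair.integrable_fst'[OF int] by simp
  then show ?A unfolding set_integrable_def inner .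
  have "(LBINT h:{0<..}. h powr - (1 + \<gamma>) * (\<integral>y. indicator {..<0} y * H (y + h) \<partial>lborel)) = (\<integral>h. \<integral>q. f h q \<partial>lborel \<partial>lborel)"
    unfolding set_lebesgue_integral_def inner ..
  also have "\<dots> = (\<integral>q. \<integral>h. f h q \<partial>lborel \<partial>lborel)"
    using lborel_pair.Fubini_integral[of f] int by simp
  also have "\<dots> = (LBINT q:{0..1}. q powr - \<gamma> / \<gamma> * H q)"
    unfolding set_lebesgue_integral_def
  proof (rule Bochner_Integration.integral_cong)
    fix q :: real
    show "(\<integral>h. f h q \<partial>lborel) = indicator {0..1} q *\<^sub>R (q powr - \<gamma> / \<gamma> * H q)"
    proof (cases "q \<in> {l..r}")
      case True
      then have q: "q > 0" "q \<in> {0..1}" using lr by auto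
      have "(\<integral>h. f h q \<partial>lborel) = (\<integral>h. indicator {q<..} h *\<^sub>R h powr - (1 + \<gamma>) * H q \<partial>lborel)"
        using True by (intro Bochner_Integration.integral_cong) (auto simp: f_def indicator_def)
      also have "\<dots> = (LBINT h:{q<..}. h powr - (1 + \<gamma>)) * H q"
        unfolding set_lebesgue_integral_def by simp
      also have "(LBINT h:{q<..}. h powr - (1 + \<gamma>)) = q powr - \<gamma> / \<gamma>"
        using \<gamma> q set_integrable_powr_tail(2)[of "1 + \<gamma>" q] by (subst set_integral_Ioi_eq_Ici(1)) simp
      finally show ?thesis using q by simp
    next
      case False
      then show ?thesis using out[of q] by (simp add: f_def)
    qed
  qed simp
  finally show ?B .
qed

text \<open>The weak formulation over \<open>[0, 1]\<close>, including the reservoir terms, is the vanishing of the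
  fractional Laplacian of the extended profile as a distribution on \<open>(0, 1)\<close>.\<close>

lemma weak_solution_second_diff:
  assumes \<gamma>: "1 < \<gamma>" "\<gamma> < 2" and weak: "weak_solution \<gamma> \<alpha> \<beta> \<rho>" and H: "H \<in> Cc2"
  shows "(LBINT h:{0<..}. h powr - (1 + \<gamma>) * (\<integral>y. extend_profile \<alpha> \<beta> \<rho> y * second_diff H y h \<partial>lborel)) = 0"
proof -
  obtain l r M where lr: "0 < l" "l < r" "r < 1" and out: "\<And>q. q \<notin> {l..r} \<Longrightarrow> H q = 0"
    and M: "\<And>q. \<bar>H q\<bar> \<le> M" and M2: "\<And>q h. \<bar>second_diff H q h\<bar> \<le> M * h\<^sup>2" and cont: "continuous_on UNIV H"
    using Cc2_bounds[OF H] by metis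
  have [measurable]: "H \<in> borel_measurable borel" using cont by (rule borel_measurable_continuous_onI)
  have Mp: "M \<ge> 0" using M[of 0] by simp
  let ?R = "extend_profile \<alpha> \<beta> \<rho>"
  have \<rho>: "continuous_on {0..1} \<rho>" "\<And>q. q \<in> {0..1} \<Longrightarrow> 0 \<le> \<rho> q \<and> \<rho> q \<le> 1" "\<rho> 0 = \<alpha>" "\<rho> 1 = \<beta>"
    using weak by (auto simp: weak_solution_def image_subset_iff)
  \<comment> \<open>Regularity of \<open>\<rho>\<close> is given on \<open>[0, 1]\<close> only;
    cutting off there produces a measurable function on the line.\<close>
  define \<rho>' where "\<rho>' q = indicator {0..1} q *\<^sub>R \<rho> q" for q
  have [measurable]: "\<rho>' \<in> borel_measurable borel"
    unfolding \<rho>'_def[abs_def] using \<rho>(1) by (intro borel_measurable_continuous_on_indicator) auto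
  have \<rho>'b: "\<bar>\<rho>' q\<bar> \<le> indicator {0..1} q" for q using \<rho>(2)[of q] by (auto simp: \<rho>'_def indicator_def)
  define k where "k h = h powr - (1 + \<gamma>)" for h :: real
  have [measurable]: "k \<in> borel_measurable borel" unfolding k_def[abs_def] by measurable
  define c where "c = jump_const \<gamma>"
  have c: "c > 0" using jump_const_pos[of \<gamma>] \<gamma> by (simp add: c_def)
  let ?L = "\<lambda>q. LBINT h:{0<..}. k h * second_diff H q h"

  \<comment> \<open>The parts from \<open>[0, 1]\<close>, from the left reservoir and from the right
    one. From \<open>y < 0\<close> only \<open>y + h\<close> can meet the support of
    \<open>H\<close>, from \<open>y > 1\<close> only \<open>y - h\<close>. \<open>T3\<close> is
    written with the reflected test function, so that \<open>exterior_weight_integral\<close>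
    evaluates it as well.\<close>
  define T1 where "T1 h = (\<integral>y. \<rho>' y * second_diff H y h \<partial>lborel)" for h
  define T2 where "T2 h = (\<integral>y. indicator {..<0} y * H (y + h) \<partial>lborel)" for h
  define T3 where "T3 h = (\<integral>y. indicator {..<0} y * H (1 - (y + h)) \<partial>lborel)" for h

  define f where "f q h = \<rho>' q * (indicator {0<..} h * (k h * second_diff H q h))" for q h :: real
  have int: "integrable (lborel \<Otimes>\<^sub>M lborel) (case_prod f)"
  proof (rule lborel_pair.integrable_product_dominated)
    show "case_prod f \<in> borel_measurable (lborel \<Otimes>\<^sub>M lborel)"
      unfolding f_def[abs_def] second_diff_def by measurable
    show "integrable lborel (\<lambda>q::real. indicator {0..1} q :: real)" by (rule integrable_indicator_Icc)
    show "integrable lborel (\<lambda>h. 4 * M * (indicator {0<..} h * tail_kernel (1 + \<gamma>) 2 h))"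
      using set_integrable_tail_kernel[of "1 + \<gamma>" 2] \<gamma> by (simp add: set_integrable_def)
    fix q h :: real
    have "\<bar>indicator {0<..} h * (k h * second_diff H q h)\<bar> \<le> 4 * M * (indicator {0<..} h * tail_kernel (1 + \<gamma>) 2 h)"
      using second_diff_bound_tail_kernel[where f=H and M=M and q=q and h=h and \<gamma>=\<gamma>] M M2
      by (auto simp: indicator_def k_def)
    then show "\<bar>f q h\<bar> \<le> indicator {0..1} q * (4 * M * (indicator {0<..} h * tail_kernel (1 + \<gamma>) 2 h))"
      unfolding f_def abs_mult[of "\<rho>' q"] using \<rho>'b[of q] by (intro mult_mono) auto
  qed
  have fh: "(\<integral>q. f q h \<partial>lborel) = indicator {0<..} h *\<^sub>R (k h * T1 h)" for h
  proof -
    have "(\<integral>q. f q h \<partial>lborel) = (\<integral>q. (indicator {0<..} h * k h) * (\<rho>' q * second_diff H q h) \<partial>lborel)"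
      by (intro Bochner_Integration.integral_cong) (auto simp: f_def)
    then show ?thesis by (simp add: T1_def)
  qed
  have fq: "(\<integral>h. f q h \<partial>lborel) = indicator {0..1} q *\<^sub>R (\<rho> q * ?L q)" for q
    unfolding f_def set_lebesgue_integral_def by (simp add: \<rho>'_def)
  have T1i: "set_integrable lborel {0<..} (\<lambda>h. k h * T1 h)"
    using lborel_pair.integrable_fst'[OF lborel_pair.integrable_product_swap[OF int]]
    unfolding set_integrable_def by (simp add: fh)
  have "(LBINT q:{0..1}. \<rho> q * ?L q) = (\<integral>q. \<integral>h. f q h \<partial>lborel \<partial>lborel)"
    unfolding set_lebesgue_integral_def fq[unfolded set_lebesgue_integral_def] ..
  also have "\<dots> = (\<integral>h. \<integral>q. f q h \<partial>lborel \<partial>lborel)"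
    using lborel_pair.Fubini_integral[of f] int by simp
  also have "\<dots> = (LBINT h:{0<..}. k h * T1 h)"
    unfolding fh set_lebesgue_integral_def ..
  finally have e1: "(LBINT q:{0..1}. \<rho> q * ?L q) = (LBINT h:{0<..}. k h * T1 h)" .

  have [measurable]: "(\<lambda>q. H (1 - q)) \<in> borel_measurable borel" by measurable
  have out': "H (1 - q) = 0" if "q \<notin> {1 - r..1 - l}" for q using that by (intro out) auto
  have T2i: "set_integrable lborel {0<..} (\<lambda>h. k h * T2 h)"
    and e2: "(LBINT h:{0<..}. k h * T2 h) = (LBINT q:{0..1}. q powr - \<gamma> / \<gamma> * H q)"
    unfolding k_def T2_def
    by (rule exterior_weight_integral[OF \<gamma>, where l=l and r=r and M=M]; use lr out M in simp)+
  have T3i: "set_integrable lborel {0<..} (\<lambda>h. k h * T3 h)"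
    and e3': "(LBINT h:{0<..}. k h * T3 h) = (LBINT q:{0..1}. q powr - \<gamma> / \<gamma> * H (1 - q))"
    unfolding k_def T3_def
    by (rule exterior_weight_integral[OF \<gamma>, where H="\<lambda>q. H (1 - q)" and l="1 - r" and r="1 - l" and M=M];
        (rule out' | use lr M in simp); assumption?)+
  have "(LBINT q:{0..1}. q powr - \<gamma> / \<gamma> * H (1 - q)) = (LBINT q:{0..1}. (1 - q) powr - \<gamma> / \<gamma> * H q)"
    unfolding set_lebesgue_integral_def
    by (subst lborel_integral_real_affine[where c="-1" and t=1])
       (auto simp: indicator_def intro!: Bochner_Integration.integral_cong)
  with e3' have e3: "(LBINT h:{0<..}. k h * T3 h) = (LBINT q:{0..1}. (1 - q) powr - \<gamma> / \<gamma> * H q)" by simp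

  have iw: "integrable lborel (\<lambda>q. w q * H q)"
    if [measurable]: "w \<in> borel_measurable borel" and w: "\<And>q. q \<in> {l..r} \<Longrightarrow> 0 \<le> w q \<and> w q \<le> D" for w D
  proof (rule integrable_bounded_support)
    show "w q * H q = 0" if "q \<notin> {l..r}" for q using out[OF that] by simp
    show "\<bar>w q * H q\<bar> \<le> max D 0 * M" for q
    proof (cases "q \<in> {l..r}")
      case True
      then show ?thesis using w[OF True] M[of q] unfolding abs_mult by (intro mult_mono) auto
    qed (use out Mp in auto)
  qed measurable
  have ib: "integrable lborel (\<lambda>q. q powr - \<gamma> / \<gamma> * H q)" "integrable lborel (\<lambda>q. (1 - q) powr - \<gamma> / \<gamma> * H q)"
    using lr \<gamma> by (intro iw[where D="l powr - \<gamma> / \<gamma>"] iw[where D="(1 - r) powr - \<gamma> / \<gamma>"];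
      auto intro!: divide_right_mono powr_mono2')+
  have ib': "set_integrable lborel {0..1} (\<lambda>q. q powr - \<gamma> / \<gamma> * H q)" "set_integrable lborel {0..1} (\<lambda>q. (1 - q) powr - \<gamma> / \<gamma> * H q)"
    unfolding set_integrable_def by (rule integrable_mult_indicator; (rule ib | simp))+
  have w: "- (LBINT q:{0..1}. \<rho> q * frac_laplacian \<gamma> H q)
               + (LBINT q:{0..1}. (\<alpha> * r_minus \<gamma> q + \<beta> * r_plus \<gamma> q) * H q) = 0"
    using weak H by (auto simp: weak_solution_def)
  have w1: "(LBINT q:{0..1}. \<rho> q * frac_laplacian \<gamma> H q) = - c * (LBINT q:{0..1}. \<rho> q * ?L q)"
  proof -
    have "\<rho> q * frac_laplacian \<gamma> H q = - c * (\<rho> q * ?L q)" for q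
      using frac_laplacian_eq[OF \<gamma>, where H=H and M=M and q=q] M M2 by (simp add: c_def k_def)
    then show ?thesis by (simp only: set_integral_mult_right)
  qed
  have w2: "(LBINT q:{0..1}. (\<alpha> * r_minus \<gamma> q + \<beta> * r_plus \<gamma> q) * H q) =
     c * (\<alpha> * (LBINT q:{0..1}. q powr - \<gamma> / \<gamma> * H q) + \<beta> * (LBINT q:{0..1}. (1 - q) powr - \<gamma> / \<gamma> * H q))"
  proof -
    have eq: "(\<alpha> * r_minus \<gamma> q + \<beta> * r_plus \<gamma> q) * H q = c * (\<alpha> * (q powr - \<gamma> / \<gamma> * H q) + \<beta> * ((1 - q) powr - \<gamma> / \<gamma> * H q))" for q
      by (simp add: r_minus_def r_plus_def c_def algebra_simps)
    show ?thesis
      unfolding eq set_integral_mult_right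
        set_integral_add(2)[OF set_integrable_mult_right[OF ib'(1)] set_integrable_mult_right[OF ib'(2)]] ..
  qed
  have sum0: "(LBINT h:{0<..}. k h * T1 h) + \<alpha> * (LBINT h:{0<..}. k h * T2 h) + \<beta> * (LBINT h:{0<..}. k h * T3 h) = 0"
  proof -
    have "c * ((LBINT h:{0<..}. k h * T1 h) + \<alpha> * (LBINT h:{0<..}. k h * T2 h) + \<beta> * (LBINT h:{0<..}. k h * T3 h)) = 0"
      using w unfolding w1 w2 e1 e2 e3 by (simp add: algebra_simps)
    then show ?thesis using c by simp
  qed

  have split: "(\<integral>y. ?R y * second_diff H y h \<partial>lborel) = T1 h + \<alpha> * T2 h + \<beta> * T3 h" if h: "h > 0" for h
  proof -
    have T3': "T3 h = (\<integral>y. indicator {1<..} y * H (y - h) \<partial>lborel)"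
      unfolding T3_def
      by (subst lborel_integral_real_affine[where c="-1" and t=1])
         (auto simp: indicator_def algebra_simps intro!: Bochner_Integration.integral_cong)
    have "?R y * second_diff H y h = \<rho>' y * second_diff H y h + \<alpha> * (indicator {..<0} y * H (y + h)) + \<beta> * (indicator {1<..} y * H (y - h))" for y
    proof -
      consider "y < 0" | "0 \<le> y" "y \<le> 1" | "y > 1" by linarith
      then show ?thesis
      proof cases
        case 1
        then have "H y = 0" "H (y - h) = 0" using out lr h by auto
        then show ?thesis using 1 by (simp add: second_diff_def extend_profile_def \<rho>'_def)
      next
        case 2
        then show ?thesis using \<rho>(3,4) by (auto simp: extend_profile_def \<rho>'_def)
      next
        case 3
        then have "H y = 0" "H (y + h) = 0" using out lr h by auto
        then show ?thesis using 3 by (simp add: second_diff_def extend_profile_def \<rho>'_def)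
      qed
    qed
    moreover have "integrable lborel (\<lambda>y. \<rho>' y * second_diff H y h)"
    proof (rule integrable_bounded_support)
      show "\<rho>' y * second_diff H y h = 0" if "y \<notin> {0..1}" for y using that by (simp add: \<rho>'_def)
      show "\<bar>\<rho>' y * second_diff H y h\<bar> \<le> 1 * (M * h\<^sup>2)" for y
      proof -
        have "\<bar>\<rho>' y\<bar> \<le> 1" using \<rho>'b[of y] by (cases "y \<in> {0..1}") auto
        then show ?thesis unfolding abs_mult using M2[of y h] by (intro mult_mono) auto
      qed
    qed measurable
    moreover have "integrable lborel (\<lambda>y. indicator {..<0} y * H (y + h))"
    proof (rule integrable_bounded_support)
      show "indicator {..<0} y * H (y + h) = 0" if "y \<notin> {l - h..r - h}" for y
        using out[of "y + h"] that by auto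
      show "\<bar>indicator {..<0} y * H (y + h)\<bar> \<le> M" for y
        using M[of "y + h"] Mp by (auto simp: indicator_def)
    qed measurable
    moreover have "integrable lborel (\<lambda>y. indicator {1<..} y * H (y - h))"
    proof (rule integrable_bounded_support)
      show "indicator {1<..} y * H (y - h) = 0" if "y \<notin> {l + h..r + h}" for y
        using out[of "y - h"] that by auto
      show "\<bar>indicator {1<..} y * H (y - h)\<bar> \<le> M" for y
        using M[of "y - h"] Mp by (auto simp: indicator_def)
    qed measurable
    ultimately show ?thesis unfolding T1_def T2_def T3' by simp
  qed
  have "(LBINT h:{0<..}. k h * (\<integral>y. ?R y * second_diff H y h \<partial>lborel)) = (LBINT h:{0<..}. k h * T1 h + \<alpha> * (k h * T2 h) + \<beta> * (k h * T3 h))"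
  proof (intro set_lebesgue_integral_cong allI impI)
    fix h :: real assume "h \<in> {0<..}"
    then have "h > 0" by simp
    show "k h * (\<integral>y. ?R y * second_diff H y h \<partial>lborel) = k h * T1 h + \<alpha> * (k h * T2 h) + \<beta> * (k h * T3 h)"
      unfolding split[OF \<open>h > 0\<close>] by (simp add: algebra_simps)
  qed simp
  also have "\<dots> = (LBINT h:{0<..}. k h * T1 h) + \<alpha> * (LBINT h:{0<..}. k h * T2 h) + \<beta> * (LBINT h:{0<..}. k h * T3 h)"
    using T1i T2i T3i by (subst set_integral_add(2); simp)+
  finally show ?thesis using sum0 by (simp add: k_def)
qed

section \<open>Mollification\<close>

text \<open>The cases \<open>n = 1\<close> and \<open>n = 0\<close> make the cube of the positive
  part twice continuously differentiable, the smoothness that \<open>Cc2\<close> asks for.\<close>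

lemma has_real_derivative_pos_part_power:
  "((\<lambda>x. max 0 x ^ (n + 2)) has_real_derivative real (n + 2) * max 0 x ^ (n + 1)) (at x)"
proof -
  consider "x < 0" | "x = 0" | "x > 0" by linarith
  then show ?thesis
  proof cases
    case 1
    have "((\<lambda>x. max 0 x ^ (n + 2)) has_real_derivative 0) (at x)"
      by (rule has_field_derivative_transform_within_open[OF DERIV_const[of 0], where S = "{..<0}"]) (use 1 in auto)
    then show ?thesis using 1 by (simp add: max_def)
  next
    case 3
    have "((\<lambda>x. x ^ (n + 2)) has_real_derivative real (n + 2) * x ^ (n + 1)) (at x)"
      using DERIV_pow[of "n + 2" x] by simp
    then have "((\<lambda>x. max 0 x ^ (n + 2)) has_real_derivative real (n + 2) * x ^ (n + 1)) (at x)"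
      by (rule has_field_derivative_transform_within_open[where S = "{0<..}"]) (use 3 in auto)
    then show ?thesis using 3 by (simp add: max_def)
  next
    case 2
    have "((\<lambda>y. \<bar>y\<bar>) \<longlongrightarrow> 0) (at (0::real))" by (rule tendsto_eq_intros refl | simp)+
    moreover have "norm ((max 0 y ^ (n + 2) - max 0 0 ^ (n + 2)) / (y - 0)) \<le> \<bar>y\<bar>" if "\<bar>y\<bar> < 1" for y :: real
    proof (cases "y > 0")
      case True
      have "y * (y * y ^ n) \<le> y * (y * 1)" using True that by (intro mult_left_mono power_le_one) auto
      then show ?thesis using True by (simp add: field_simps)
    next
      case False
      then show ?thesis by (simp add: max_def)
    qed
    then have "\<forall>\<^sub>F y in at (0::real). norm ((max 0 y ^ (n + 2) - max 0 0 ^ (n + 2)) / (y - 0)) \<le> \<bar>y\<bar>"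
      by (subst eventually_at) (auto intro!: exI[of _ 1])
    ultimately have "((\<lambda>y. (max 0 y ^ (n + 2) - max 0 0 ^ (n + 2)) / (y - 0)) \<longlongrightarrow> 0) (at (0::real))"
      by (rule Lim_null_comparison[rotated])
    then show ?thesis using 2 by (simp add: has_field_derivative_iff)
  qed
qed

lemma Cc2_I:
  assumes "\<And>q. (H has_real_derivative H' q) (at q)" "\<And>q. (H' has_real_derivative H'' q) (at q)"
    "continuous_on UNIV H''" "\<And>q. q \<notin> {l..r} \<Longrightarrow> H q = 0" "0 < l" "r < 1"
  shows "H \<in> Cc2"
proof -
  have sub: "closure {q. H q \<noteq> 0} \<subseteq> {l..r}" using assms(4) by (intro closure_minimal subsetI) (blast, simp)
  then have "closure {q. H q \<noteq> 0} \<subseteq> {0<..<1}" using assms(5,6) by (rule_tac order.trans) auto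
  moreover have "compact (closure {q. H q \<noteq> 0})"
    using compact_Int_closed[of "{l..r}" "closure {q. H q \<noteq> 0}"] using sub by (simp add: Int_absorb1)
  ultimately show ?thesis using assms(1-3) unfolding Cc2_def mem_Collect_eq by (intro conjI exI[of _ H'] exI[of _ H'']) auto
qed

text \<open>The bump is centred at 1/2 because test functions live in (0, 1): the bump itself is
  then one of them, and so are its reflected translates, centred at \<open>q\<close>, as long as
  \<open>q\<close> is farther than \<epsilon> from both ends.\<close>

lemma bump_function:
  assumes \<epsilon>: "0 < \<epsilon>" "\<epsilon> < 1/2"
  obtains G :: "real \<Rightarrow> real" where "G \<in> Cc2" "\<And>t. 0 \<le> G t" "(\<integral>t. G t \<partial>lborel) = 1"
    "\<And>t. \<bar>t - 1/2\<bar> > \<epsilon> \<Longrightarrow> G t = 0"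
    "\<And>q. \<epsilon> < q \<Longrightarrow> q < 1 - \<epsilon> \<Longrightarrow> (\<lambda>y. G (q + 1/2 - y)) \<in> Cc2"
proof -
  define P where "P t = \<epsilon>\<^sup>2 - (t - 1/2)\<^sup>2" for t :: real
  define G0 where "G0 t = max 0 (P t) ^ 3" for t
  define G1 where "G1 t = 3 * max 0 (P t) ^ 2 * (- 2 * (t - 1/2))" for t
  define G2 where "G2 t = 3 * (2 * max 0 (P t) * (- 2 * (t - 1/2))) * (- 2 * (t - 1/2)) + 3 * max 0 (P t) ^ 2 * (- 2)" for t
  have dP: "(P has_real_derivative (- 2 * (t - 1/2))) (at t)" for t
    unfolding P_def[abs_def] by (auto intro!: derivative_eq_intros)
  have d0: "(G0 has_real_derivative G1 t) (at t)" for t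
    using DERIV_chain2[OF has_real_derivative_pos_part_power[of 1] dP, of t]
    unfolding G0_def[abs_def] G1_def by (simp add: numeral_3_eq_3 numeral_2_eq_2)
  have d1: "(G1 has_real_derivative G2 t) (at t)" for t
  proof -
    have A: "((\<lambda>t. max 0 (P t) ^ 2) has_real_derivative 2 * max 0 (P t) * (- 2 * (t - 1/2))) (at t)"
      using DERIV_chain2[OF has_real_derivative_pos_part_power[of 0] dP, of t] by (simp add: numeral_2_eq_2)
    have L: "((\<lambda>t. - 2 * (t - 1/2)) has_real_derivative - 2) (at t)"
      by (auto intro!: derivative_eq_intros)
    show ?thesis unfolding G1_def[abs_def] G2_def
      by (rule DERIV_cong[OF DERIV_mult[OF DERIV_cmult[OF A] L]]) simp
  qed
  have c2: "continuous_on UNIV G2"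
    unfolding G2_def[abs_def] P_def by (intro continuous_intros)
  have out: "G0 t = 0" if "\<bar>t - 1/2\<bar> > \<epsilon>" for t
  proof -
    have "\<epsilon>\<^sup>2 \<le> (t - 1/2)\<^sup>2" using that \<epsilon> power_mono[of \<epsilon> "\<bar>t - 1/2\<bar>" 2] by simp
    then show ?thesis by (simp add: G0_def P_def max_def)
  qed
  have nn: "0 \<le> G0 t" for t by (simp add: G0_def)
  have cont0: "continuous_on UNIV G0" using d0 DERIV_continuous_on by blast
  have [measurable]: "G0 \<in> borel_measurable borel" using cont0 by (rule borel_measurable_continuous_onI)
  have G0le: "\<bar>G0 t\<bar> \<le> (\<epsilon>\<^sup>2) ^ 3" for t
  proof -
    have "max 0 (P t) ^ 3 \<le> (\<epsilon>\<^sup>2) ^ 3" by (intro power_mono) (auto simp: P_def)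
    then show ?thesis using nn[of t] by (simp add: G0_def)
  qed
  have i0: "integrable lborel G0"
  proof (rule integrable_bounded_support[OF _ G0le])
    show "G0 t = 0" if "t \<notin> {1/2 - \<epsilon>..1/2 + \<epsilon>}" for t using that unfolding atLeastAtMost_iff by (intro out) linarith
  qed measurable
  define I where "I = (\<integral>t. G0 t \<partial>lborel)"
  have "I > 0"
  proof -
    \<comment> \<open>On the middle half of the support \<open>P\<close> is at least
      \<open>\<epsilon>\<^sup>2 / 2\<close>, which bounds the mass of \<open>G0\<close> from
      below.\<close>
    have "(\<integral>t. indicator {1/2 - \<epsilon>/2..1/2 + \<epsilon>/2} t * (\<epsilon>\<^sup>2 / 2) ^ 3 \<partial>lborel) \<le> I"
      unfolding I_def
    proof (intro integral_mono i0)
      show "integrable lborel (\<lambda>t. indicator {1/2 - \<epsilon>/2..1/2 + \<epsilon>/2} t * (\<epsilon>\<^sup>2 / 2) ^ 3)"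
        using integrable_indicator_Icc by simp
      fix t :: real
      show "indicator {1/2 - \<epsilon>/2..1/2 + \<epsilon>/2} t * (\<epsilon>\<^sup>2 / 2) ^ 3 \<le> G0 t"
      proof (cases "t \<in> {1/2 - \<epsilon>/2..1/2 + \<epsilon>/2}")
        case True
        then have "\<bar>t - 1/2\<bar> \<le> \<epsilon> / 2" unfolding atLeastAtMost_iff by linarith
        then have "(t - 1/2)\<^sup>2 \<le> (\<epsilon> / 2)\<^sup>2" by (metis abs_ge_zero power2_abs power_mono)
        then have "(t - 1/2)\<^sup>2 \<le> \<epsilon>\<^sup>2 / 4" by (simp add: power_divide)
        then have "\<epsilon>\<^sup>2 / 2 \<le> P t" unfolding P_def using zero_le_power2[of "t - 1/2"] by linarith
        then have "(\<epsilon>\<^sup>2 / 2) ^ 3 \<le> max 0 (P t) ^ 3" by (intro power_mono) auto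
        then show ?thesis using True by (simp add: G0_def)
      qed (simp add: nn)
    qed
    moreover have "(\<integral>t. indicator {1/2 - \<epsilon>/2..1/2 + \<epsilon>/2} t * (\<epsilon>\<^sup>2 / 2) ^ 3 \<partial>lborel) > 0"
      using \<epsilon> by simp
    ultimately show ?thesis by linarith
  qed
  define G where "G t = G0 t / I" for t
  show thesis
  proof
    have D: "(\<lambda>t. G0 t / I) = (\<lambda>t. G t)" by (simp add: G_def)
    have g0: "(G has_real_derivative G1 t / I) (at t)" "((\<lambda>t. G1 t / I) has_real_derivative G2 t / I) (at t)" for t
      unfolding G_def[abs_def] by (rule DERIV_cdivide d0 d1)+
    have c: "continuous_on UNIV (\<lambda>t. G2 t / I)" using c2 \<open>I > 0\<close> by (intro continuous_intros) auto
    show o: "G t = 0" if "\<bar>t - 1/2\<bar> > \<epsilon>" for t using out[OF that] by (simp add: G_def)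
    show "G \<in> Cc2"
      by (rule Cc2_I[OF g0 c, of "1/2 - \<epsilon>" "1/2 + \<epsilon>"]) (use \<epsilon> o in auto)
    show "0 \<le> G t" for t using nn \<open>I > 0\<close> by (simp add: G_def)
    show "(\<integral>t. G t \<partial>lborel) = 1" using \<open>I > 0\<close> by (simp add: G_def I_def)
    show "(\<lambda>y. G (q + 1/2 - y)) \<in> Cc2" if q: "\<epsilon> < q" "q < 1 - \<epsilon>" for q
    proof (rule Cc2_I[of _ "\<lambda>y. - (G1 (q + 1/2 - y) / I)" "\<lambda>y. G2 (q + 1/2 - y) / I" "q - \<epsilon>" "q + \<epsilon>"])
      have l: "((\<lambda>y. q + 1/2 - y) has_real_derivative - 1) (at y)" for y
        by (auto intro!: derivative_eq_intros)
      show "((\<lambda>y. G (q + 1/2 - y)) has_real_derivative - (G1 (q + 1/2 - y) / I)) (at y)" for y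
        using DERIV_chain2[OF g0(1) l] by simp
      show "((\<lambda>y. - (G1 (q + 1/2 - y) / I)) has_real_derivative (G2 (q + 1/2 - y) / I)) (at y)" for y
        using DERIV_minus[OF DERIV_chain2[OF g0(2) l]] by simp
      show "continuous_on UNIV (\<lambda>y. G2 (q + 1/2 - y) / I)"
        by (intro continuous_on_compose2[OF c] continuous_intros) auto
      show "G (q + 1/2 - y) = 0" if "y \<notin> {q - \<epsilon>..q + \<epsilon>}" for y
        using that unfolding atLeastAtMost_iff by (intro o) linarith
    qed (use q in auto)
  qed
qed

text \<open>For a convolution of \<open>R\<close> with the bump, second differences can be put on
  the bump. This bounds them quadratically, and the weak formulation tested with the translate
  centred at \<open>q\<close> becomes the pointwise equation at \<open>q\<close>. As a weighted
  average over translations by at most \<epsilon>, \<open>v\<close> inherits the modulus of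
  continuity of \<open>R\<close>.\<close>

lemma mollified_profile:
  fixes R :: "real \<Rightarrow> real"
  assumes \<epsilon>: "0 < \<epsilon>" "\<epsilon> < 1/2" and [measurable]: "R \<in> borel_measurable borel" and R: "\<And>q. \<bar>R q\<bar> \<le> 1"
    and weak: "\<forall>H\<in>Cc2. (LBINT h:{0<..}. h powr - (1 + \<gamma>) * (\<integral>y. R y * second_diff H y h \<partial>lborel)) = 0"
  shows "\<exists>v C. (\<forall>q q' b. (\<forall>t. \<bar>t\<bar> \<le> \<epsilon> \<longrightarrow> \<bar>R (q + t) - R (q' + t)\<bar> \<le> b) \<longrightarrow> \<bar>v q - v q'\<bar> \<le> b) \<and>
    (\<forall>q b. (\<forall>t. \<bar>t\<bar> \<le> \<epsilon> \<longrightarrow> \<bar>R (q + t) - R q\<bar> \<le> b) \<longrightarrow> \<bar>v q - R q\<bar> \<le> b) \<and>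
    (\<forall>q. \<bar>v q\<bar> \<le> C) \<and> (\<forall>q h. \<bar>second_diff v q h\<bar> \<le> C * h\<^sup>2) \<and>
    (\<forall>q. \<epsilon> < q \<longrightarrow> q < 1 - \<epsilon> \<longrightarrow> (LBINT h:{0<..}. h powr - (1 + \<gamma>) * second_diff v q h) = 0)"
proof -
  obtain G where G: "G \<in> Cc2" "\<And>t. 0 \<le> G t" "(\<integral>t. G t \<partial>lborel) = 1"
    "\<And>t. \<bar>t - 1/2\<bar> > \<epsilon> \<Longrightarrow> G t = 0"
    "\<And>q. \<epsilon> < q \<Longrightarrow> q < 1 - \<epsilon> \<Longrightarrow> (\<lambda>y. G (q + 1/2 - y)) \<in> Cc2"
    using bump_function[OF \<epsilon>] by metis
  obtain l r M where lr: "0 < l" "l < r" "r < 1" and out: "\<And>q. q \<notin> {l..r} \<Longrightarrow> G q = 0"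
    and M: "\<And>q. \<bar>G q\<bar> \<le> M" and M2: "\<And>q h. \<bar>second_diff G q h\<bar> \<le> M * h\<^sup>2" and cont: "continuous_on UNIV G"
    using Cc2_bounds[OF G(1)] by metis
  have [measurable]: "G \<in> borel_measurable borel" using cont by (rule borel_measurable_continuous_onI)
  have Mp: "M \<ge> 0" using M[of 0] by simp
  have iG: "integrable lborel G" by (rule integrable_bounded_support[OF _ M out]) measurable
  have ifG: "integrable lborel (\<lambda>t. f t * G t)"
    if [measurable]: "f \<in> borel_measurable borel" and f: "\<And>t. \<bar>f t\<bar> \<le> B" for f :: "real \<Rightarrow> real" and B
  proof (rule integrable_bounded_support)
    show "\<bar>f t * G t\<bar> \<le> B * M" for t
      unfolding abs_mult using f[of t] M[of t] by (intro mult_mono) auto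
    show "f t * G t = 0" if "t \<notin> {l..r}" for t using out[OF that] by simp
  qed measurable
  have avg: "\<bar>\<integral>t. f t * G t \<partial>lborel\<bar> \<le> b"
    if f: "\<And>t. \<bar>t - 1/2\<bar> \<le> \<epsilon> \<Longrightarrow> \<bar>f t\<bar> \<le> b" and i: "integrable lborel (\<lambda>t. f t * G t)" for f :: "real \<Rightarrow> real" and b
  proof -
    have "norm (\<integral>t. f t * G t \<partial>lborel) \<le> (\<integral>t. norm (f t * G t) \<partial>lborel)"
      by (rule integral_norm_bound)
    also have "\<dots> \<le> (\<integral>t. b * G t \<partial>lborel)"
    proof (intro integral_mono)
      fix t :: real
      show "norm (f t * G t) \<le> b * G t"
      proof (cases "\<bar>t - 1/2\<bar> \<le> \<epsilon>")
        case True
        then show ?thesis using f[OF True] G(2)[of t] by (simp add: abs_mult mult_right_mono)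
      next
        case False
        then show ?thesis using G(4)[of t] by simp
      qed
    qed (use i iG in auto)
    also have "\<dots> = b" using G(3) by simp
    finally show ?thesis by simp
  qed
  \<comment> \<open>The shift by 1/2 compensates the centre of the bump, so \<open>v q\<close>
    averages \<open>R\<close> over \<open>[q - \<epsilon>, q + \<epsilon>]\<close>.\<close>
  define v where "v q = (\<integral>t. R (q + 1/2 - t) * G t \<partial>lborel)" for q
  have iv: "integrable lborel (\<lambda>t. R (q + 1/2 - t) * G t)" for q
    by (rule ifG[where B=1]) (use R in auto)
  have 1: "\<bar>v q - v q'\<bar> \<le> b" if "\<And>t. \<bar>t\<bar> \<le> \<epsilon> \<Longrightarrow> \<bar>R (q + t) - R (q' + t)\<bar> \<le> b" for q q' b
  proof -
    have eq: "R (q + 1/2 - t) * G t - R (q' + 1/2 - t) * G t = (R (q + 1/2 - t) - R (q' + 1/2 - t)) * G t" for t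
      by (simp add: algebra_simps)
    have "v q - v q' = (\<integral>t. (R (q + 1/2 - t) - R (q' + 1/2 - t)) * G t \<partial>lborel)"
      unfolding v_def by (subst Bochner_Integration.integral_diff[OF iv iv, symmetric]) (simp only: eq)
    moreover have "\<bar>\<dots>\<bar> \<le> b"
    proof (rule avg)
      show "\<bar>R (q + 1/2 - t) - R (q' + 1/2 - t)\<bar> \<le> b" if "\<bar>t - 1/2\<bar> \<le> \<epsilon>" for t
        using \<open>\<And>t. \<bar>t\<bar> \<le> \<epsilon> \<Longrightarrow> \<bar>R (q + t) - R (q' + t)\<bar> \<le> b\<close>[of "1/2 - t"] that by (simp add: abs_minus_commute algebra_simps)
      show "integrable lborel (\<lambda>t. (R (q + 1/2 - t) - R (q' + 1/2 - t)) * G t)"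
        using Bochner_Integration.integrable_diff[OF iv[of q] iv[of q']] unfolding eq .
    qed
    ultimately show ?thesis by simp
  qed
  have 2: "\<bar>v q - R q\<bar> \<le> b" if "\<And>t. \<bar>t\<bar> \<le> \<epsilon> \<Longrightarrow> \<bar>R (q + t) - R q\<bar> \<le> b" for q b
  proof -
    have eq: "R (q + 1/2 - t) * G t - R q * G t = (R (q + 1/2 - t) - R q) * G t" for t
      by (simp add: algebra_simps)
    have iq: "integrable lborel (\<lambda>t. R q * G t)" using iG by simp
    have "R q = (\<integral>t. R q * G t \<partial>lborel)" using G(3) by simp
    then have "v q - R q = (\<integral>t. (R (q + 1/2 - t) - R q) * G t \<partial>lborel)"
      unfolding v_def using Bochner_Integration.integral_diff[OF iv iq, symmetric] by (simp only: eq)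
    moreover have "\<bar>\<dots>\<bar> \<le> b"
    proof (rule avg)
      show "\<bar>R (q + 1/2 - t) - R q\<bar> \<le> b" if "\<bar>t - 1/2\<bar> \<le> \<epsilon>" for t
        using \<open>\<And>t. \<bar>t\<bar> \<le> \<epsilon> \<Longrightarrow> \<bar>R (q + t) - R q\<bar> \<le> b\<close>[of "1/2 - t"] that by (simp add: abs_minus_commute algebra_simps)
      show "integrable lborel (\<lambda>t. (R (q + 1/2 - t) - R q) * G t)"
        using Bochner_Integration.integrable_diff[OF iv[of q] iq] unfolding eq .
    qed
    ultimately show ?thesis by simp
  qed
  have v1: "\<bar>v q\<bar> \<le> 1" for q unfolding v_def by (rule avg[OF _ iv]) (rule R)
  have vconv: "v q = (\<integral>y. R y * G (q + 1/2 - y) \<partial>lborel)" for q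
    unfolding v_def by (subst lborel_integral_real_affine[where c="-1" and t="q + 1/2"]) simp_all
  have iconv: "integrable lborel (\<lambda>y. R y * G (q + 1/2 - y))" for q
    using iv[of q] by (subst lborel_integrable_real_affine_iff[where c="-1" and t="q + 1/2", symmetric]) simp_all
  \<comment> \<open>A symmetric second difference is insensitive to reflection, so differencing in
    \<open>q\<close> equals differencing the test function in \<open>y\<close>.\<close>
  have sd: "second_diff v q h = (\<integral>y. R y * second_diff (\<lambda>y. G (q + 1/2 - y)) y h \<partial>lborel)" for q h
  proof -
    have eq: "R y * second_diff (\<lambda>y. G (q + 1/2 - y)) y h =
      R y * G ((q + h) + 1/2 - y) + R y * G ((q - h) + 1/2 - y) - 2 * (R y * G (q + 1/2 - y))" for y
      unfolding second_diff_def by (simp add: algebra_simps)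
    have i2: "integrable lborel (\<lambda>y. 2 * (R y * G (q + 1/2 - y)))" using iconv[of q] by simp
    have "(\<integral>y. R y * second_diff (\<lambda>y. G (q + 1/2 - y)) y h \<partial>lborel) =
       (\<integral>y. R y * G ((q + h) + 1/2 - y) + R y * G ((q - h) + 1/2 - y) \<partial>lborel) - (\<integral>y. 2 * (R y * G (q + 1/2 - y)) \<partial>lborel)"
      unfolding eq by (rule Bochner_Integration.integral_diff[OF Bochner_Integration.integrable_add[OF iconv iconv] i2])
    also have "\<dots> = v (q + h) + v (q - h) - 2 * v q"
      unfolding Bochner_Integration.integral_add[OF iconv iconv] vconv by simp
    finally show ?thesis by (simp add: second_diff_def)
  qed
  \<comment> \<open>For long steps the trivial bound 4 suffices. For
    \<open>\<bar>h\<bar> \<le> 1\<close> the integrand is at most \<open>M * h\<^sup>2\<close> and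
    vanishes outside an interval of length 3.\<close>
  have bound: "\<bar>second_diff v q h\<bar> \<le> max (3 * M) 4 * h\<^sup>2" for q h
  proof (cases "\<bar>h\<bar> \<le> 1")
    case False
    then have "1 \<le> h\<^sup>2" by (metis abs_square_less_1 linorder_not_le not_less_iff_gr_or_eq less_imp_le abs_square_le_1)
    have "\<bar>second_diff v q h\<bar> \<le> 4" using v1[of q] v1[of "q + h"] v1[of "q - h"] unfolding second_diff_def by linarith
    also have "4 \<le> 4 * h\<^sup>2" using \<open>1 \<le> h\<^sup>2\<close> by simp
    also have "\<dots> \<le> max (3 * M) 4 * h\<^sup>2" by (intro mult_right_mono) auto
    finally show ?thesis .
  next
    case True
    have e: "second_diff (\<lambda>y. G (q + 1/2 - y)) y h = second_diff G (q + 1/2 - y) h" for y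
      unfolding second_diff_def by (simp add: algebra_simps)
    have z: "second_diff G t h = 0" if "t \<notin> {-1..2}" for t
    proof -
      have "t \<notin> {l..r}" "t + h \<notin> {l..r}" "t - h \<notin> {l..r}" using that True lr by (auto simp: abs_le_iff)
      then show ?thesis using out by (simp add: second_diff_def)
    qed
    have "\<bar>second_diff v q h\<bar> = norm (\<integral>y. R y * second_diff G (q + 1/2 - y) h \<partial>lborel)"
      unfolding sd e by simp
    also have "\<dots> \<le> (\<integral>y. norm (R y * second_diff G (q + 1/2 - y) h) \<partial>lborel)"
      by (rule integral_norm_bound)
    also have "\<dots> \<le> (\<integral>y. M * h\<^sup>2 * indicator {q - 3/2..q + 3/2} y \<partial>lborel)"
    proof (rule integral_mono)
      have le: "norm (R y * second_diff G (q + 1/2 - y) h) \<le> M * h\<^sup>2 * indicator {q - 3/2..q + 3/2} y" for y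
      proof (cases "y \<in> {q - 3/2..q + 3/2}")
        case True
        have "\<bar>R y\<bar> * \<bar>second_diff G (q + 1/2 - y) h\<bar> \<le> 1 * (M * h\<^sup>2)"
          using R[of y] M2 by (intro mult_mono) auto
        then show ?thesis using True by (simp add: abs_mult)
      next
        case False
        then have "q + 1/2 - y \<notin> {-1..2}" by auto
        then show ?thesis using z False by simp
      qed
      show ig: "integrable lborel (\<lambda>y. M * h\<^sup>2 * indicator {q - 3/2..q + 3/2} y)"
        using integrable_indicator_Icc by simp
      show "integrable lborel (\<lambda>y. norm (R y * second_diff G (q + 1/2 - y) h))"
      proof (rule Bochner_Integration.integrable_bound[OF ig])
        show "AE y in lborel. norm (norm (R y * second_diff G (q + 1/2 - y) h)) \<le> norm (M * h\<^sup>2 * indicator {q - 3/2..q + 3/2} y)"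
          using order.trans[OF le abs_ge_self] by (intro AE_I2) simp
      qed (unfold second_diff_def, measurable)
      show "norm (R y * second_diff G (q + 1/2 - y) h) \<le> M * h\<^sup>2 * indicator {q - 3/2..q + 3/2} y" for y by (rule le)
    qed
    also have "\<dots> = 3 * M * h\<^sup>2" by simp
    also have "\<dots> \<le> max (3 * M) 4 * h\<^sup>2" by (intro mult_right_mono) auto
    finally show ?thesis .
  qed
  have 5: "(LBINT h:{0<..}. h powr - (1 + \<gamma>) * second_diff v q h) = 0" if "\<epsilon> < q" "q < 1 - \<epsilon>" for q
    unfolding sd by (rule bspec[OF weak G(5)[OF that]])
  have v1': "\<bar>v q\<bar> \<le> max (3 * M) 4" for q using v1[of q] by linarith
  show ?thesis
    by (rule exI[of _ v], rule exI[of _ "max (3 * M) 4"]) (intro conjI allI impI 1 2 v1' bound 5; simp)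
qed

section \<open>Convergence to the macroscopic profile\<close>

lemma continuous_on_modulus:
  fixes f :: "real \<Rightarrow> real"
  assumes "\<And>e. e > 0 \<Longrightarrow> \<exists>d>0. \<forall>q q'. \<bar>q - q'\<bar> < d \<longrightarrow> \<bar>f q - f q'\<bar> < e"
  shows "continuous_on UNIV f"
  unfolding continuous_on_iff dist_real_def using assms by blast

text \<open>The scaled lattice sum is the integral of the sampled integrand, and the integral of the
  unsampled one is 0; their difference tends to 0 by dominated convergence with majorant
  \<open>tail_kernel (1 + \<gamma>) 2\<close>. The points \<open>q n\<close> are arbitrary, as they
  will be maximum points that vary with the lattice; pointwise convergence therefore rests on
  uniform continuity of \<open>v\<close>.\<close>

lemma second_diff_sum_consistency:
  fixes v :: "real \<Rightarrow> real" and \<delta> q :: "nat \<Rightarrow> real"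
  assumes \<gamma>: "1 < \<gamma>" "\<gamma> < 2" and C: "\<And>q. \<bar>v q\<bar> \<le> C" "\<And>q h. \<bar>second_diff v q h\<bar> \<le> C * h\<^sup>2"
    and unif: "\<And>e. e > 0 \<Longrightarrow> \<exists>d>0. \<forall>q q'. \<bar>q - q'\<bar> < d \<longrightarrow> \<bar>v q - v q'\<bar> < e"
    and \<delta>: "\<And>n. \<delta> n > 0" "\<delta> \<longlonglongrightarrow> 0"
    and zero: "\<And>n. (LBINT h:{0<..}. h powr - (1 + \<gamma>) * second_diff v (q n) h) = 0"
  shows "(\<lambda>n. \<delta> n powr - \<gamma> * (\<Sum>k. real (Suc k) powr - (1 + \<gamma>) * second_diff v (q n) (\<delta> n * real (Suc k)))) \<longlonglongrightarrow> 0"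
proof -
  have Cp: "C \<ge> 0" using C(1)[of 0] by simp
  have "continuous_on UNIV v" using continuous_on_modulus[OF unif] .
  then have vm[measurable]: "v \<in> borel_measurable borel" by (rule borel_measurable_continuous_onI)
  define p where "p = - (1 + \<gamma>)"
  define U where "U n s = \<delta> n * real (Suc (cell_index (\<delta> n) s))" for n s
  define F where "F n s = U n s powr p * second_diff v (q n) (U n s)" for n s
  define G where "G n s = s powr p * second_diff v (q n) s" for n s
  have sd4: "\<bar>second_diff v q h\<bar> \<le> 4 * C" for q h
    using C(1)[of q] C(1)[of "q + h"] C(1)[of "q - h"] unfolding second_diff_def by linarith
  have U: "s \<le> U n s" "U n s < s + \<delta> n" if "s > 0" for n s
    using cell_index_bounds[OF \<delta>(1)[of n] that] by (auto simp: U_def)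
  have F: "set_integrable lborel {0<..} (F n)"
    and Feq: "(LBINT s:{0<..}. F n s) = \<delta> n powr - \<gamma> * (\<Sum>k. real (Suc k) powr - (1 + \<gamma>) * second_diff v (q n) (\<delta> n * real (Suc k)))" for n
    using set_integrable_weighted_cells[OF \<delta>(1)[of n], where E="\<lambda>k. second_diff v (q n) (\<delta> n * real (Suc k))" and C="4 * C" and \<gamma>=\<gamma>]
      integral_weighted_cells[OF \<delta>(1)[of n], where E="\<lambda>k. second_diff v (q n) (\<delta> n * real (Suc k))" and C="4 * C" and \<gamma>=\<gamma>]
      \<gamma> sd4 unfolding F_def U_def p_def by simp_all
  have G: "set_integrable lborel {0<..} (G n)" for n
    unfolding G_def p_def by (rule set_integrable_second_diff[OF \<gamma> vm C])
  have FG: "(LBINT s:{0<..}. F n s) = (\<integral>s. indicator {0<..} s *\<^sub>R (F n s - G n s) \<partial>lborel)" for n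
    using set_integral_diff(2)[OF F[of n] G[of n]] zero[of n] unfolding set_lebesgue_integral_def[symmetric]
    by (simp add: G_def p_def)
  have "(\<lambda>n. \<integral>s. indicator {0<..} s *\<^sub>R (F n s - G n s) \<partial>lborel) \<longlonglongrightarrow> (\<integral>s. 0 \<partial>(lborel :: real measure))"
  proof (rule integral_dominated_convergence)
    show "(\<lambda>s. indicator {0<..} s *\<^sub>R (F n s - G n s)) \<in> borel_measurable lborel" for n
      using set_integral_diff(1)[OF F[of n] G[of n]] unfolding set_integrable_def by (rule borel_measurable_integrable)
    show "integrable lborel (\<lambda>s. 8 * C * (indicator {0<..} s * tail_kernel (1 + \<gamma>) 2 s))"
      using set_integrable_tail_kernel[of "1 + \<gamma>" 2] \<gamma> by (simp add: set_integrable_def)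
    show "AE s in lborel. norm (indicator {0<..} s *\<^sub>R (F n s - G n s)) \<le> 8 * C * (indicator {0<..} s * tail_kernel (1 + \<gamma>) 2 s)" for n
    proof (rule AE_I2)
      fix s :: real
      show "norm (indicator {0<..} s *\<^sub>R (F n s - G n s)) \<le> 8 * C * (indicator {0<..} s * tail_kernel (1 + \<gamma>) 2 s)"
      proof (cases "s > 0")
        case True
        have "\<bar>G n s\<bar> \<le> 4 * C * tail_kernel (1 + \<gamma>) 2 s"
          unfolding G_def p_def using True by (intro second_diff_bound_tail_kernel C)
        moreover have "\<bar>F n s\<bar> \<le> 4 * C * tail_kernel (1 + \<gamma>) 2 (U n s)"
          unfolding F_def p_def using True U[OF True, of n] by (intro second_diff_bound_tail_kernel C) linarith
        moreover have "4 * C * tail_kernel (1 + \<gamma>) 2 (U n s) \<le> 4 * C * tail_kernel (1 + \<gamma>) 2 s"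
          using True U[OF True, of n] \<gamma> Cp by (intro mult_left_mono tail_kernel_antimono) auto
        ultimately have "\<bar>F n s - G n s\<bar> \<le> 8 * C * tail_kernel (1 + \<gamma>) 2 s" by linarith
        then show ?thesis using True by simp
      qed simp
    qed
    show "AE s in lborel. (\<lambda>n. indicator {0<..} s *\<^sub>R (F n s - G n s)) \<longlonglongrightarrow> 0"
    proof (rule AE_I2)
      fix s :: real
      show "(\<lambda>n. indicator {0<..} s *\<^sub>R (F n s - G n s)) \<longlonglongrightarrow> 0"
      proof (cases "s > 0")
        case True
        have Ul: "(\<lambda>n. U n s) \<longlonglongrightarrow> s"
        proof (rule tendsto_sandwich)
          show "(\<lambda>n. s) \<longlonglongrightarrow> s" by simp
          show "(\<lambda>n. s + \<delta> n) \<longlonglongrightarrow> s" using tendsto_add[OF tendsto_const \<delta>(2), of s] by simp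
        qed (use U[OF True] in \<open>auto intro!: always_eventually less_imp_le\<close>)
        define D where "D n = second_diff v (q n) (U n s) - second_diff v (q n) s" for n
        have D: "D \<longlonglongrightarrow> 0"
        proof (rule LIMSEQ_I)
          fix e :: real assume "e > 0"
          then obtain d where d: "d > 0" "\<forall>q q'. \<bar>q - q'\<bar> < d \<longrightarrow> \<bar>v q - v q'\<bar> < e / 2" using unif[of "e / 2"] by auto
          obtain n0 where n0: "\<And>n. n \<ge> n0 \<Longrightarrow> norm (\<delta> n - 0) < d" using LIMSEQ_D[OF \<delta>(2) d(1)] by blast
          have "norm (D n - 0) < e" if n: "n \<ge> n0" for n
          proof -
            have "\<bar>U n s - s\<bar> < d" using U[OF True, of n] n0[OF n] by auto
            then have "\<bar>(q n + U n s) - (q n + s)\<bar> < d" "\<bar>(q n - U n s) - (q n - s)\<bar> < d" by auto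
            then have "\<bar>v (q n + U n s) - v (q n + s)\<bar> < e / 2" "\<bar>v (q n - U n s) - v (q n - s)\<bar> < e / 2"
              using d(2) by blast+
            then show ?thesis unfolding D_def second_diff_def real_norm_def by linarith
          qed
          then show "\<exists>n0. \<forall>n\<ge>n0. norm (D n - 0) < e" by blast
        qed
        have "(\<lambda>n. F n s - G n s) \<longlonglongrightarrow> 0"
        proof (rule Lim_null_comparison)
          show "\<forall>\<^sub>F n in sequentially. norm (F n s - G n s) \<le> \<bar>U n s powr p - s powr p\<bar> * (4 * C) + s powr p * \<bar>D n\<bar>"
          proof (intro always_eventually allI)
            fix n
            have "F n s - G n s = (U n s powr p - s powr p) * second_diff v (q n) (U n s) + s powr p * D n"
              by (simp add: F_def G_def D_def algebra_simps)
            then have "norm (F n s - G n s) \<le> \<bar>U n s powr p - s powr p\<bar> * \<bar>second_diff v (q n) (U n s)\<bar> + s powr p * \<bar>D n\<bar>"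
              using abs_triangle_ineq[of "(U n s powr p - s powr p) * second_diff v (q n) (U n s)" "s powr p * D n"]
              by (simp add: abs_mult)
            then show "norm (F n s - G n s) \<le> \<bar>U n s powr p - s powr p\<bar> * (4 * C) + s powr p * \<bar>D n\<bar>"
              using mult_left_mono[OF sd4[of "q n" "U n s"], of "\<bar>U n s powr p - s powr p\<bar>"] by linarith
          qed
          have "(\<lambda>n. \<bar>U n s powr p - s powr p\<bar> * (4 * C) + s powr p * \<bar>D n\<bar>) \<longlonglongrightarrow> \<bar>s powr p - s powr p\<bar> * (4 * C) + s powr p * \<bar>0\<bar>"
            using True by (intro tendsto_intros Ul D) auto
          then show "(\<lambda>n. \<bar>U n s powr p - s powr p\<bar> * (4 * C) + s powr p * \<bar>D n\<bar>) \<longlonglongrightarrow> 0" by simp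
        qed
        then show ?thesis using True by simp
      qed simp
    qed
  qed simp
  then show ?thesis unfolding FG[symmetric] Feq by simp
qed

text \<open>At the maximum every second difference is nonpositive. The \<open>N\<close> jump lengths
  from \<open>N + 1\<close> to \<open>2 * N\<close> leave the sites on both sides, and each
  contributes at most \<open>- 2 * (g x - B)\<close> times the smallest weight
  \<open>(2 * N) powr - (1 + \<gamma>)\<close>.\<close>

lemma second_diff_sum_le_at_max:
  fixes g :: "int \<Rightarrow> real"
  assumes \<gamma>: "\<gamma> > 0" and g: "\<And>z. \<bar>g z\<bar> \<le> C" and N: "N > 0" and x: "x \<in> sites N"
    and max: "\<And>z. z \<in> sites N \<Longrightarrow> g z \<le> g x" and out: "\<And>z. z \<notin> sites N \<Longrightarrow> g z \<le> B" and B: "B \<le> g x"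
  shows "second_diff_sum \<gamma> g x \<le> - (g x - B) * (2 powr - \<gamma> * real N powr - \<gamma>)"
proof -
  define w where "w n = real (Suc n) powr - (1 + \<gamma>)" for n
  have le: "g z \<le> g x" for z using max[of z] out[of z] B by (cases "z \<in> sites N") auto
  define b where "b n = (if n \<in> {N..<2 * N} then - 2 * (g x - B) * (2 * real N) powr - (1 + \<gamma>) else 0)" for n
  have summ: "summable (\<lambda>n. w n * (g (x + int (Suc n)) + g (x - int (Suc n)) - 2 * g x))"
    unfolding w_def using \<gamma> g by (rule second_diff_sum_summable)
  have sb: "b sums (\<Sum>n\<in>{N..<2 * N}. b n)" by (rule sums_finite) (auto simp: b_def)
  have "w n * (g (x + int (Suc n)) + g (x - int (Suc n)) - 2 * g x) \<le> b n" for n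
  proof (cases "n \<in> {N..<2 * N}")
    case True
    have "g (x + int (Suc n)) \<le> B" "g (x - int (Suc n)) \<le> B"
      using True x by (intro out; auto simp: sites_def)+
    then have "w n * (g (x + int (Suc n)) + g (x - int (Suc n)) - 2 * g x) \<le> w n * (- 2 * (g x - B))"
      by (intro mult_left_mono) (auto simp: w_def)
    also have "\<dots> \<le> (2 * real N) powr - (1 + \<gamma>) * (- 2 * (g x - B))"
    proof (rule mult_right_mono_neg)
      show "(2 * real N) powr - (1 + \<gamma>) \<le> w n"
        unfolding w_def using True \<gamma> by (intro powr_mono2') auto
      show "- 2 * (g x - B) \<le> 0" using B by simp
    qed
    finally show ?thesis using True by (simp add: b_def mult.commute)
  next
    case False
    have "w n * (g (x + int (Suc n)) + g (x - int (Suc n)) - 2 * g x) \<le> w n * 0"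
      using le[of "x + int (Suc n)"] le[of "x - int (Suc n)"] by (intro mult_left_mono) (auto simp: w_def)
    then show ?thesis using False by (auto simp: b_def)
  qed
  then have "second_diff_sum \<gamma> g x \<le> (\<Sum>n\<in>{N..<2 * N}. b n)"
    using sums_le[OF _ summable_sums[OF summ] sb] unfolding second_diff_sum_def w_def by simp
  also have "\<dots> = real N * (- 2 * (g x - B) * (2 * real N) powr - (1 + \<gamma>))"
    by (simp add: b_def)
  also have "\<dots> = - (g x - B) * ((2 * real N) powr 1 * (2 * real N) powr - (1 + \<gamma>))" using N by simp
  also have "(2 * real N) powr 1 * (2 * real N) powr - (1 + \<gamma>) = (2 * real N) powr - \<gamma>"
    by (subst powr_add[symmetric]) simp
  also have "\<dots> = 2 powr - \<gamma> * real N powr - \<gamma>" by (simp add: powr_mult)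
  finally show ?thesis .
qed

text \<open>Comparison with the mollified profile \<open>v\<close>, contracted so that its equation holds at every
  site. The exit rate \<open>N powr -\<gamma>\<close> from the sites turns the consistency error into a uniform bound.\<close>

lemma harmonic_le_profile:
  fixes R :: "real \<Rightarrow> real" and u :: "nat \<Rightarrow> int \<Rightarrow> real"
  assumes \<gamma>: "1 < \<gamma>" "\<gamma> < 2"
    and unif: "\<And>e. e > 0 \<Longrightarrow> \<exists>d>0. \<forall>q q'. \<bar>q - q'\<bar> < d \<longrightarrow> \<bar>R q - R q'\<bar> < e"
    and R: "\<And>q. \<bar>R q\<bar> \<le> 1" "\<And>q. q \<le> 0 \<Longrightarrow> R q = \<alpha>" "\<And>q. q \<ge> 1 \<Longrightarrow> R q = \<beta>"
    and weak: "\<forall>H\<in>Cc2. (LBINT h:{0<..}. h powr - (1 + \<gamma>) * (\<integral>y. R y * second_diff H y h \<partial>lborel)) = 0"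
    and u: "\<And>N z. N \<ge> 2 \<Longrightarrow> \<bar>u N z\<bar> \<le> 1" "\<And>N z. N \<ge> 2 \<Longrightarrow> z \<le> 0 \<Longrightarrow> u N z = \<alpha>" "\<And>N z. N \<ge> 2 \<Longrightarrow> z \<ge> int N \<Longrightarrow> u N z = \<beta>"
      "\<And>N x. N \<ge> 2 \<Longrightarrow> x \<in> sites N \<Longrightarrow> second_diff_sum \<gamma> (u N) x = 0"
    and e: "e > 0"
  shows "\<forall>\<^sub>F N in sequentially. \<forall>x. u N x \<le> R (real_of_int x / real N) + e"
proof -
  have "continuous_on UNIV R" using continuous_on_modulus[OF unif] .
  then have Rm[measurable]: "R \<in> borel_measurable borel" by (rule borel_measurable_continuous_onI)
  \<comment> \<open>The budget is \<open>2 * b\<close> for the distance of \<open>W\<close> from the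
    profile and \<open>3 * b\<close> for the maximum of \<open>u - W\<close>.\<close>
  define b where "b = e / 5"
  have b: "b > 0" using e by (simp add: b_def)
  obtain d where d: "d > 0" "\<And>q q'. \<bar>q - q'\<bar> < d \<Longrightarrow> \<bar>R q - R q'\<bar> < b" using unif[OF b] by blast
  \<comment> \<open>The bound 1/8 keeps the contraction factor \<open>\<theta>\<close> positive;
    \<open>d / 4\<close> keeps the displacement \<open>2 * \<epsilon>\<close> below the continuity
    scale \<open>d\<close>.\<close>
  define \<epsilon> where "\<epsilon> = min (1/8) (d / 4)"
  have \<epsilon>: "0 < \<epsilon>" "\<epsilon> < 1/2" "\<epsilon> \<le> 1/8" "2 * \<epsilon> < d" using d(1) by (auto simp: \<epsilon>_def)
  obtain v C where v1: "\<forall>q q' b. (\<forall>t. \<bar>t\<bar> \<le> \<epsilon> \<longrightarrow> \<bar>R (q + t) - R (q' + t)\<bar> \<le> b) \<longrightarrow> \<bar>v q - v q'\<bar> \<le> b"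
    and v2: "\<forall>q b. (\<forall>t. \<bar>t\<bar> \<le> \<epsilon> \<longrightarrow> \<bar>R (q + t) - R q\<bar> \<le> b) \<longrightarrow> \<bar>v q - R q\<bar> \<le> b"
    and vC': "\<forall>q. \<bar>v q\<bar> \<le> C" "\<forall>q h. \<bar>second_diff v q h\<bar> \<le> C * h\<^sup>2"
    and v0: "\<forall>q. \<epsilon> < q \<longrightarrow> q < 1 - \<epsilon> \<longrightarrow> (LBINT h:{0<..}. h powr - (1 + \<gamma>) * second_diff v q h) = 0"
    using mollified_profile[OF \<epsilon>(1,2) Rm R(1) weak] by blast
  have vC: "\<bar>v q\<bar> \<le> C" "\<bar>second_diff v q h\<bar> \<le> C * h\<^sup>2" for q h using vC' by auto
  have vunif: "\<exists>d>0. \<forall>q q'. \<bar>q - q'\<bar> < d \<longrightarrow> \<bar>v q - v q'\<bar> < e" if "e > 0" for e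
  proof -
    obtain d where d: "d > 0" "\<And>q q'. \<bar>q - q'\<bar> < d \<Longrightarrow> \<bar>R q - R q'\<bar> < e / 2" using unif[of "e / 2"] \<open>e > 0\<close> by auto
    have "\<bar>v q - v q'\<bar> < e" if "\<bar>q - q'\<bar> < d" for q q'
    proof -
      have "\<bar>v q - v q'\<bar> \<le> e / 2"
        using d(2) that by (intro v1[rule_format] less_imp_le) auto
      then show ?thesis using \<open>e > 0\<close> by simp
    qed
    then show ?thesis using d(1) by blast
  qed
  define \<theta> where "\<theta> = 1 - 4 * \<epsilon>"
  have \<theta>: "\<theta> > 0" using \<epsilon> by (simp add: \<theta>_def)
  \<comment> \<open>The contraction maps the macroscopic interval \<open>[0, 1]\<close> onto
    \<open>[2 * \<epsilon>, 1 - 2 * \<epsilon>]\<close>, strictly inside the region where the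
    equation for \<open>v\<close> holds, and moves its points by at most
    \<open>2 * \<epsilon>\<close>.\<close>
  define P where "P N x = 2 * \<epsilon> + \<theta> / real N * real_of_int x" for N :: nat and x :: int
  define W where "W N x = v (P N x)" for N x
  have WR: "\<bar>W N x - R (real_of_int x / real N)\<bar> \<le> 2 * b" if N: "N \<ge> 2" for N x
  proof -
    have "\<bar>v (P N x) - R (P N x)\<bar> \<le> b"
      using \<epsilon> by (intro v2[rule_format] less_imp_le d(2)) auto
    moreover have "\<bar>R (P N x) - R (real_of_int x / real N)\<bar> \<le> b"
    proof -
      define y where "y = real_of_int x / real N"
      have P: "P N x = 2 * \<epsilon> + \<theta> * y" by (simp add: P_def y_def)
      \<comment> \<open>Beyond an endpoint the displacement is unbounded, but \<open>R\<close> is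
        constant there: the contracted point is either still beyond the endpoint or within
        \<open>2 * \<epsilon>\<close> of it.\<close>
      consider "y < 0" | "0 \<le> y" "y \<le> 1" | "y > 1" by linarith
      then have "\<bar>R (P N x) - R y\<bar> \<le> b"
      proof cases
        case 1
        have "P N x < 2 * \<epsilon>" using 1 \<theta> by (simp add: P mult_pos_neg)
        show ?thesis
        proof (cases "P N x \<le> 0")
          case True
          then show ?thesis using R(2) 1 b by simp
        next
          case False
          then have "\<bar>P N x - 0\<bar> < d" using \<open>P N x < 2 * \<epsilon>\<close> \<epsilon> by simp
          then show ?thesis using d(2)[of "P N x" 0] R(2)[of 0] R(2)[of y] 1 by simp
        qed
      next
        case 2
        have "P N x - y = 2 * \<epsilon> * (1 - 2 * y)" by (simp add: P \<theta>_def algebra_simps)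
        moreover have "\<bar>1 - 2 * y\<bar> \<le> 1" using 2 by (simp add: abs_le_iff)
        ultimately have "\<bar>P N x - y\<bar> \<le> 2 * \<epsilon> * 1" using \<epsilon> by (simp add: abs_mult)
        then show ?thesis using d(2)[of "P N x" y] \<epsilon> by simp
      next
        case 3
        have "\<theta> * 1 < \<theta> * y" using 3 \<theta> by (intro mult_strict_left_mono) auto
        then have "P N x > 1 - 2 * \<epsilon>" by (simp add: P \<theta>_def)
        show ?thesis
        proof (cases "P N x \<ge> 1")
          case True
          then show ?thesis using R(3) 3 b by simp
        next
          case False
          then have "\<bar>P N x - 1\<bar> < d" using \<open>P N x > 1 - 2 * \<epsilon>\<close> \<epsilon> by simp
          then show ?thesis using d(2)[of "P N x" 1] R(3)[of 1] R(3)[of y] 3 by simp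
        qed
      qed
      then show ?thesis by (simp add: y_def)
    qed
    ultimately show ?thesis unfolding W_def by linarith
  qed
  define M where "M N = Max ((\<lambda>z. u N z - W N z) ` sites N)" for N
  have fin: "finite (sites N)" "N \<ge> 2 \<Longrightarrow> sites N \<noteq> {}" for N by (auto simp: sites_def)
  have "\<exists>x. N \<ge> 2 \<longrightarrow> x \<in> sites N \<and> u N x - W N x = M N" for N
    using Max_in[of "(\<lambda>z. u N z - W N z) ` sites N"] fin[of N] unfolding M_def by fastforce
  then obtain X where X: "\<And>N. N \<ge> 2 \<Longrightarrow> X N \<in> sites N \<and> u N (X N) - W N (X N) = M N" by metis
  \<comment> \<open>The mesh of the contracted lattice with \<open>N = n + 2\<close>; the shift of
    the index enforces \<open>N \<ge> 2\<close>.\<close>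
  define \<delta> where "\<delta> n = \<theta> / real (n + 2)" for n :: nat
  define S where "S N = second_diff_sum \<gamma> (W N) (X N)" for N
  have PX: "\<epsilon> < P N (X N) \<and> P N (X N) < 1 - \<epsilon>" if "N \<ge> 2" for N
  proof -
    have x: "1 \<le> X N" "X N \<le> int N - 1" using X[OF that] by (auto simp: sites_def)
    have "0 \<le> real_of_int (X N) / real N" "real_of_int (X N) / real N \<le> 1" using x that by (auto simp: field_simps)
    then have "\<theta> * (real_of_int (X N) / real N) \<ge> 0" "\<theta> * (real_of_int (X N) / real N) \<le> \<theta> * 1"
      using \<theta> by (intro mult_nonneg_nonneg mult_left_mono; simp)+
    then show ?thesis using \<epsilon>(1) by (simp add: P_def \<theta>_def)
  qed
  have "(\<lambda>n. \<delta> n powr - \<gamma> * (\<Sum>k. real (Suc k) powr - (1 + \<gamma>) * second_diff v (P (n + 2) (X (n + 2))) (\<delta> n * real (Suc k)))) \<longlonglongrightarrow> 0"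
  proof (rule second_diff_sum_consistency[OF \<gamma> vC vunif])
    show "\<delta> n > 0" for n using \<theta> by (simp add: \<delta>_def)
    show "\<delta> \<longlonglongrightarrow> 0" unfolding \<delta>_def by real_asymp
    show "(LBINT h:{0<..}. h powr - (1 + \<gamma>) * second_diff v (P (n + 2) (X (n + 2))) h) = 0" for n
      using PX[of "n + 2"] by (intro v0[rule_format]) auto
  qed
  moreover have "(\<Sum>k. real (Suc k) powr - (1 + \<gamma>) * second_diff v (P (n + 2) (X (n + 2))) (\<delta> n * real (Suc k))) = S (n + 2)" for n
  proof -
    have P': "P (n + 2) (x + int m) = P (n + 2) x + \<delta> n * real m" "P (n + 2) (x - int m) = P (n + 2) x - \<delta> n * real m" for x m
      by (simp_all add: P_def \<delta>_def distrib_left right_diff_distrib)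
    show ?thesis unfolding S_def second_diff_sum_def W_def second_diff_def P' by (rule refl)
  qed
  ultimately have "(\<lambda>n. \<delta> n powr - \<gamma> * S (n + 2)) \<longlonglongrightarrow> 0" by simp
  \<comment> \<open>The prefactor converts the mesh scaling into \<open>N powr \<gamma>\<close> and
    cancels the factor \<open>2 powr - \<gamma>\<close> of the exit rate.\<close>
  then have "(\<lambda>n. 2 powr \<gamma> * \<theta> powr \<gamma> * (\<delta> n powr - \<gamma> * S (n + 2))) \<longlonglongrightarrow> 0"
    by (rule tendsto_mult_right_zero)
  then have "\<forall>\<^sub>F n in sequentially. \<bar>2 powr \<gamma> * \<theta> powr \<gamma> * (\<delta> n powr - \<gamma> * S (n + 2))\<bar> < b"
    using b tendstoD by fastforce
  then have "\<forall>\<^sub>F n in sequentially. \<forall>x. u (n + 2) x \<le> R (real_of_int x / real (n + 2)) + e"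
  proof eventually_elim
    fix n
    assume A: "\<bar>2 powr \<gamma> * \<theta> powr \<gamma> * (\<delta> n powr - \<gamma> * S (n + 2))\<bar> < b"
    define N where "N = n + 2"
    have N: "N \<ge> 2" "N > 0" by (auto simp: N_def)
    have "\<delta> n powr - \<gamma> = \<theta> powr - \<gamma> * real N powr \<gamma>"
      using \<theta> unfolding \<delta>_def N_def by (simp add: powr_divide powr_minus field_simps)
    then have E: "2 powr \<gamma> * \<theta> powr \<gamma> * (\<delta> n powr - \<gamma> * S (n + 2)) = 2 powr \<gamma> * real N powr \<gamma> * S N"
      using \<theta> by (simp add: powr_minus N_def)
    have A': "\<bar>2 powr \<gamma> * real N powr \<gamma> * S N\<bar> < b" using A unfolding E by simp
    define g where "g z = u N z - W N z" for z
    have gmax: "g z \<le> g (X N)" if "z \<in> sites N" for z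
      using X[OF N(1)] Max_ge[of "g ` sites N" "g z"] fin(1)[of N] that unfolding M_def g_def by auto
    have gout: "g z \<le> 2 * b" if "z \<notin> sites N" for z
    proof -
      have "u N z = R (real_of_int z / real N)"
      proof (cases "z \<le> 0")
        case True
        then have "real_of_int z / real N \<le> 0" using N by (simp add: divide_nonpos_pos)
        then show ?thesis using u(2)[OF N(1) True] R(2) by simp
      next
        case False
        then have "z \<ge> int N" using that by (auto simp: sites_def)
        moreover from this have "real_of_int z / real N \<ge> 1" using N by (simp add: field_simps)
        ultimately show ?thesis using u(3)[OF N(1)] R(3) by simp
      qed
      then show ?thesis using WR[OF N(1), of z] unfolding g_def by linarith
    qed
    \<comment> \<open>Otherwise the exit term, rescaled by \<open>(2 * N) powr \<gamma>\<close>,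
      would exceed \<open>b\<close>, whereas the consistency error in the same scaling is below
      \<open>b\<close>.\<close>
    have "g (X N) \<le> 3 * b"
    proof (rule ccontr)
      assume "\<not> g (X N) \<le> 3 * b"
      then have gX: "3 * b < g (X N)" by simp
      have gb: "\<bar>g z\<bar> \<le> 1 + C" for z using u(1)[OF N(1), of z] vC(1)[of "P N z"] unfolding g_def W_def by linarith
      have "second_diff_sum \<gamma> g (X N) \<le> - (g (X N) - 2 * b) * (2 powr - \<gamma> * real N powr - \<gamma>)"
        using \<gamma> gX b X[OF N(1)] gmax gout by (intro second_diff_sum_le_at_max[OF _ gb N(2)]) auto
      also have "second_diff_sum \<gamma> g (X N) = second_diff_sum \<gamma> (u N) (X N) - S N"
      proof -
        have "second_diff_sum \<gamma> (u N) (X N) - S N =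
          (\<Sum>n. real (Suc n) powr - (1 + \<gamma>) * (u N (X N + int (Suc n)) + u N (X N - int (Suc n)) - 2 * u N (X N)) -
           real (Suc n) powr - (1 + \<gamma>) * (W N (X N + int (Suc n)) + W N (X N - int (Suc n)) - 2 * W N (X N)))"
          unfolding S_def second_diff_sum_def using \<gamma>
          by (intro suminf_diff second_diff_sum_summable[where C=1] second_diff_sum_summable[where C=C] u(1) N)
             (auto simp: W_def vC)
        also have "\<dots> = second_diff_sum \<gamma> g (X N)"
          unfolding second_diff_sum_def g_def by (intro suminf_cong) (simp add: algebra_simps)
        finally show ?thesis by simp
      qed
      also have "second_diff_sum \<gamma> (u N) (X N) = 0" using X[OF N(1)] by (intro u(4) N) auto
      finally have "(g (X N) - 2 * b) * (2 powr - \<gamma> * real N powr - \<gamma>) \<le> S N" by (simp only: mult_minus_left)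
      then have "(2 powr \<gamma> * real N powr \<gamma>) * ((g (X N) - 2 * b) * (2 powr - \<gamma> * real N powr - \<gamma>)) \<le> (2 powr \<gamma> * real N powr \<gamma>) * S N"
        by (intro mult_left_mono) auto
      also have "(2 powr \<gamma> * real N powr \<gamma>) * ((g (X N) - 2 * b) * (2 powr - \<gamma> * real N powr - \<gamma>)) = g (X N) - 2 * b"
        using N by (simp add: powr_minus field_simps)
      finally show False using gX A' by linarith
    qed
    have "u N x \<le> R (real_of_int x / real N) + e" for x
    proof -
      have "g x \<le> 3 * b"
        using \<open>g (X N) \<le> 3 * b\<close> gmax[of x] gout[of x] b by (cases "x \<in> sites N") auto
      then show ?thesis using WR[OF N(1), of x] unfolding g_def b_def by linarith
    qed
    then show "\<forall>x. u (n + 2) x \<le> R (real_of_int x / real (n + 2)) + e" by (simp add: N_def)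
  qed
  then show ?thesis by (rule eventually_sequentially_seg[of _ 2, THEN iffD1])
qed

text \<open>All hypotheses are invariant under a change of sign of \<open>u\<close>,
  \<open>R\<close> and the reservoir densities, so the one-sided bound gives the other side
  too.\<close>

lemma harmonic_tendsto_profile:
  fixes R :: "real \<Rightarrow> real" and u :: "nat \<Rightarrow> int \<Rightarrow> real"
  assumes \<gamma>: "1 < \<gamma>" "\<gamma> < 2"
    and unif: "\<And>e. e > 0 \<Longrightarrow> \<exists>d>0. \<forall>q q'. \<bar>q - q'\<bar> < d \<longrightarrow> \<bar>R q - R q'\<bar> < e"
    and R: "\<And>q. \<bar>R q\<bar> \<le> 1" "\<And>q. q \<le> 0 \<Longrightarrow> R q = \<alpha>" "\<And>q. q \<ge> 1 \<Longrightarrow> R q = \<beta>"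
    and weak: "\<forall>H\<in>Cc2. (LBINT h:{0<..}. h powr - (1 + \<gamma>) * (\<integral>y. R y * second_diff H y h \<partial>lborel)) = 0"
    and u: "\<And>N z. N \<ge> 2 \<Longrightarrow> \<bar>u N z\<bar> \<le> 1" "\<And>N z. N \<ge> 2 \<Longrightarrow> z \<le> 0 \<Longrightarrow> u N z = \<alpha>" "\<And>N z. N \<ge> 2 \<Longrightarrow> z \<ge> int N \<Longrightarrow> u N z = \<beta>"
      "\<And>N x. N \<ge> 2 \<Longrightarrow> x \<in> sites N \<Longrightarrow> second_diff_sum \<gamma> (u N) x = 0"
    and e: "e > 0"
  shows "\<forall>\<^sub>F N in sequentially. \<forall>x. \<bar>u N x - R (real_of_int x / real N)\<bar> \<le> e"
proof -
  have neg: "second_diff_sum \<gamma> (\<lambda>z. - u N z) x = - second_diff_sum \<gamma> (u N) x" if "N \<ge> 2" for N x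
  proof -
    have "second_diff_sum \<gamma> (\<lambda>z. - u N z) x =
       (\<Sum>n. - (real (Suc n) powr - (1 + \<gamma>) * (u N (x + int (Suc n)) + u N (x - int (Suc n)) - 2 * u N x)))"
      unfolding second_diff_sum_def by (intro suminf_cong) (simp add: algebra_simps)
    also have "\<dots> = - second_diff_sum \<gamma> (u N) x"
      unfolding second_diff_sum_def using \<gamma> u(1)[OF that]
      by (intro suminf_minus second_diff_sum_summable[where C=1]) auto
    finally show ?thesis .
  qed
  have "\<forall>\<^sub>F N in sequentially. \<forall>x. u N x \<le> R (real_of_int x / real N) + e"
    by (rule harmonic_le_profile) (fact \<gamma> unif R weak u e)+
  moreover have "\<forall>\<^sub>F N in sequentially. \<forall>x. - u N x \<le> - R (real_of_int x / real N) + e"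
  proof (rule harmonic_le_profile[OF \<gamma>, where \<alpha>="- \<alpha>" and \<beta>="- \<beta>"])
    show "\<exists>d>0. \<forall>q q'. \<bar>q - q'\<bar> < d \<longrightarrow> \<bar>- R q - - R q'\<bar> < e" if "e > 0" for e
    proof -
      obtain d where "d > 0" "\<forall>q q'. \<bar>q - q'\<bar> < d \<longrightarrow> \<bar>R q - R q'\<bar> < e" using unif[OF \<open>e > 0\<close>] by blast
      then have "\<forall>q q'. \<bar>q - q'\<bar> < d \<longrightarrow> \<bar>- R q - - R q'\<bar> < e" by (simp add: abs_minus_commute)
      then show ?thesis using \<open>d > 0\<close> by blast
    qed
    show "\<forall>H\<in>Cc2. (LBINT h:{0<..}. h powr - (1 + \<gamma>) * (\<integral>y. - R y * second_diff H y h \<partial>lborel)) = 0"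
      using weak by (simp add: set_lebesgue_integral_def)
  qed (use R u neg e in auto)
  ultimately show ?thesis
  proof eventually_elim
    fix N
    assume 1: "\<forall>x. u N x \<le> R (real_of_int x / real N) + e" and 2: "\<forall>x. - u N x \<le> - R (real_of_int x / real N) + e"
    show "\<forall>x. \<bar>u N x - R (real_of_int x / real N)\<bar> \<le> e"
    proof
      fix x
      show "\<bar>u N x - R (real_of_int x / real N)\<bar> \<le> e" using 1[rule_format, of x] 2[rule_format, of x] by linarith
    qed
  qed
qed

section \<open>Scaling limit of the flux\<close>

text \<open>A pair of cells is sampled at \<open>i + j + 1\<close>, one less than the sum
  \<open>i + j + 2\<close> of the right endpoints in units of the mesh. The sample point is
  therefore only known to be at least \<open>(s + t) / 2\<close>.\<close>

lemma tail_kernel_half: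
  assumes "0 \<le> a" "x > 0"
  shows "tail_kernel p a (x / 2) \<le> 2 powr p * tail_kernel p a x"
proof -
  have "(x / 2) powr - p = 2 powr p * x powr - p"
    using assms by (simp add: powr_divide powr_minus field_simps)
  moreover have "min 1 ((x / 2) powr a) \<le> min 1 (x powr a)"
    using assms by (intro min.mono powr_mono2) auto
  ultimately show ?thesis
    unfolding tail_kernel_def using mult_left_mono[of "min 1 ((x / 2) powr a)" "min 1 (x powr a)" "(x / 2) powr - p"]
    by simp
qed

text \<open>Here \<open>i\<close> and \<open>j\<close> count positions on the two sides of a bond
  from 0, so \<open>i + j + 1\<close> is the length of a jump across it. The factor
  \<open>N powr (\<gamma> - 1)\<close> is the homogeneity \<open>N powr (1 + \<gamma>)\<close> of
  the kernel times the area \<open>N powr - 2\<close> of a product of two cells.\<close>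

lemma double_sum_eq_integral:
  fixes A :: "nat \<Rightarrow> nat \<Rightarrow> real"
  assumes \<gamma>: "1 < \<gamma>" "\<gamma> < 2" and a: "0 \<le> a" "a < \<gamma>" and N: "N > 0"
    and A: "\<And>i j. \<bar>A i j\<bar> \<le> C" "\<And>i j. \<bar>A i j\<bar> \<le> C * (real (i + j + 1) / real N) powr a"
  defines "f \<equiv> \<lambda>s t. (real (cell_index (1 / N) s + cell_index (1 / N) t + 1) / real N) powr - (1 + \<gamma>) * A (cell_index (1 / N) s) (cell_index (1 / N) t)"
  shows "\<And>s t. s > 0 \<Longrightarrow> t > 0 \<Longrightarrow> \<bar>f s t\<bar> \<le> C * 2 powr (1 + \<gamma>) * tail_kernel (1 + \<gamma>) a (s + t)"
    and "\<And>s. s > 0 \<Longrightarrow> set_integrable lborel {0<..} (f s)"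
    and "set_integrable lborel {0<..} (\<lambda>s. LBINT t:{0<..}. f s t)"
    and "(LBINT s:{0<..}. LBINT t:{0<..}. f s t) = real N powr (\<gamma> - 1) * (\<Sum>i. \<Sum>j. real (i + j + 1) powr - (1 + \<gamma>) * A i j)"
proof -
  have Cp: "C \<ge> 0" using A(1)[of 0 0] by simp
  define d where "d = 1 / real N"
  have d: "d > 0" using N by (simp add: d_def)
  show bound: "\<bar>f s t\<bar> \<le> C * 2 powr (1 + \<gamma>) * tail_kernel (1 + \<gamma>) a (s + t)" if "s > 0" "t > 0" for s t
  proof -
    define i j where "i = cell_index d s" and "j = cell_index d t"
    have "s \<le> d * real (Suc i)" "t \<le> d * real (Suc j)"
      using cell_index_bounds(2)[OF d that(1)] cell_index_bounds(2)[OF d that(2)] by (auto simp: i_def j_def)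
    then have "s + t \<le> d * (real i + real j + 2)" by (simp add: algebra_simps)
    also have "\<dots> \<le> d * (2 * real (i + j + 1))" using d by (intro mult_left_mono) auto
    finally have le: "(s + t) / 2 \<le> real (i + j + 1) / N" using N by (simp add: d_def field_simps)
    have "\<bar>f s t\<bar> = (real (i + j + 1) / N) powr - (1 + \<gamma>) * \<bar>A i j\<bar>"
      by (simp add: f_def i_def j_def d_def abs_mult)
    also have "\<dots> \<le> (real (i + j + 1) / N) powr - (1 + \<gamma>) * (C * min 1 ((real (i + j + 1) / real N) powr a))"
      using A[of i j] by (intro mult_left_mono) (auto simp: min_def)
    also have "\<dots> = C * tail_kernel (1 + \<gamma>) a (real (i + j + 1) / N)" by (simp add: tail_kernel_def)
    also have "\<dots> \<le> C * tail_kernel (1 + \<gamma>) a ((s + t) / 2)"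
      using le that \<gamma> a Cp by (intro mult_left_mono tail_kernel_antimono) auto
    also have "\<dots> \<le> C * (2 powr (1 + \<gamma>) * tail_kernel (1 + \<gamma>) a (s + t))"
      using that a Cp by (intro mult_left_mono tail_kernel_half) auto
    finally show ?thesis by simp
  qed
  define g where "g i j = (real (i + j + 1) / real N) powr - (1 + \<gamma>) * A i j" for i j
  have g: "g i j = real N powr (1 + \<gamma>) * (real (i + j + 1) powr - (1 + \<gamma>) * A i j)" for i j
  proof -
    have "(real (i + j + 1) / real N) powr - (1 + \<gamma>) = real N powr (1 + \<gamma>) * real (i + j + 1) powr - (1 + \<gamma>)"
      by (subst powr_divide) (simp_all add: powr_minus[of "real N" "1 + \<gamma>", simplified] divide_inverse mult.commute)
    then show ?thesis by (simp add: g_def)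
  qed
  have sg: "summable (\<lambda>j. \<bar>g i j\<bar>)" for i
  proof (rule summable_comparison_test')
    show "summable (\<lambda>j. real N powr (1 + \<gamma>) * C * real (Suc j) powr - (1 + \<gamma>))"
      using \<gamma> by (intro summable_mult summable_Suc_powr) auto
    fix j
    have "real (i + j + 1) powr - (1 + \<gamma>) \<le> real (Suc j) powr - (1 + \<gamma>)"
      using \<gamma> by (intro powr_mono2') auto
    then have "real (i + j + 1) powr - (1 + \<gamma>) * \<bar>A i j\<bar> \<le> real (Suc j) powr - (1 + \<gamma>) * C"
      using A(1)[of i j] by (intro mult_mono) auto
    then have "real N powr (1 + \<gamma>) * (real (i + j + 1) powr - (1 + \<gamma>) * \<bar>A i j\<bar>) \<le> real N powr (1 + \<gamma>) * (real (Suc j) powr - (1 + \<gamma>) * C)"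
      by (intro mult_left_mono) auto
    then show "norm \<bar>g i j\<bar> \<le> real N powr (1 + \<gamma>) * C * real (Suc j) powr - (1 + \<gamma>)"
      unfolding g by (simp add: abs_mult mult_ac del: of_nat_Suc of_nat_add)
  qed
  have fg: "f s t = g (cell_index d s) (cell_index d t)" for s t by (simp add: f_def g_def d_def)
  show inner: "set_integrable lborel {0<..} (f s)" for s
    unfolding fg by (rule set_integrable_cells[OF d sg])
  have innereq: "(LBINT t:{0<..}. f s t) = d * (\<Sum>j. g (cell_index d s) j)" for s
    unfolding fg by (rule integral_cells[OF d sg])
  define I where "I i = d * (\<Sum>j. g i j)" for i
  have sI: "summable (\<lambda>i. \<bar>I i\<bar>)"
  proof (rule summable_comparison_test')
    show "summable (\<lambda>i. C * 2 powr (1 + \<gamma>) * (1 / (\<gamma> - a) * d powr - \<gamma>) * real (Suc i) powr - \<gamma>)"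
      using \<gamma> by (intro summable_mult summable_Suc_powr)
    fix i
    \<comment> \<open>The right endpoint represents the cell of index \<open>i\<close>; the bound on
      the inner integral at this point is a bound on row \<open>i\<close>.\<close>
    define s where "s = d * real (Suc i)"
    have s: "s > 0" using d by (simp add: s_def)
    have "cell_index d s = i" using d s by (subst cell_index_eq_iff) (auto simp: s_def)
    then have "I i = (LBINT t:{0<..}. f s t)" by (simp add: innereq I_def)
    also have "\<bar>\<dots>\<bar> \<le> (LBINT t:{0<..}. \<bar>f s t\<bar>)"
      using integral_norm_bound[of lborel "\<lambda>t. indicator {0<..} t *\<^sub>R f s t"]
      unfolding set_lebesgue_integral_def by (simp add: abs_mult)
    also have "\<dots> \<le> (LBINT t:{0<..}. C * 2 powr (1 + \<gamma>) * tail_kernel (1 + \<gamma>) a (s + t))"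
      using \<gamma> s bound[OF s] set_integrable_shifted_tail_kernel[of "1 + \<gamma>" s a]
      by (intro set_integral_mono set_integrable_abs inner) auto
    also have "\<dots> = C * 2 powr (1 + \<gamma>) * (LBINT t:{0<..}. tail_kernel (1 + \<gamma>) a (s + t))" by simp
    also have "\<dots> \<le> C * 2 powr (1 + \<gamma>) * (1 / (\<gamma> - a) * tail_kernel \<gamma> a s)"
      using \<gamma> a s Cp by (intro mult_left_mono integral_shifted_tail_kernel_le) auto
    also have "\<dots> \<le> C * 2 powr (1 + \<gamma>) * (1 / (\<gamma> - a) * s powr - \<gamma>)"
      using a Cp by (intro mult_left_mono tail_kernel_le) auto
    also have "s powr - \<gamma> = d powr - \<gamma> * real (Suc i) powr - \<gamma>" using d by (simp add: s_def powr_mult)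
    finally show "norm \<bar>I i\<bar> \<le> C * 2 powr (1 + \<gamma>) * (1 / (\<gamma> - a) * d powr - \<gamma>) * real (Suc i) powr - \<gamma>"
      by (simp add: mult_ac)
  qed
  show "set_integrable lborel {0<..} (\<lambda>s. LBINT t:{0<..}. f s t)"
    unfolding innereq I_def[symmetric] by (rule set_integrable_cells[OF d sI])
  have "(LBINT s:{0<..}. LBINT t:{0<..}. f s t) = d * (\<Sum>i. I i)"
    unfolding innereq I_def[symmetric] by (rule integral_cells[OF d sI])
  also have "(\<Sum>i. I i) = d * real N powr (1 + \<gamma>) * (\<Sum>i. \<Sum>j. real (i + j + 1) powr - (1 + \<gamma>) * A i j)"
  proof -
    have eq: "I i = d * real N powr (1 + \<gamma>) * (\<Sum>j. real (i + j + 1) powr - (1 + \<gamma>) * A i j)" for i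
    proof -
      have "summable (\<lambda>j. real (i + j + 1) powr - (1 + \<gamma>) * A i j)"
        using summable_mult[OF summable_rabs_cancel[OF sg[of i]], of "real N powr - (1 + \<gamma>)"] N
        unfolding g by (simp add: powr_minus)
      then show ?thesis unfolding I_def g by (simp add: suminf_mult)
    qed
    have "summable (\<lambda>i. \<Sum>j. real (i + j + 1) powr - (1 + \<gamma>) * A i j)"
      using summable_mult[OF summable_rabs_cancel[OF sI], of "inverse (d * real N powr (1 + \<gamma>))"] d N
      unfolding eq by simp
    then show ?thesis unfolding eq by (rule suminf_mult)
  qed
  also have "d * (d * real N powr (1 + \<gamma>) * X) = real N powr (\<gamma> - 1) * X" for X
  proof -
    have "d * d * real N powr (1 + \<gamma>) = real N powr (-2) * real N powr (1 + \<gamma>)"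
      using N by (simp add: d_def powr_minus powr_numeral power2_eq_square field_simps)
    also have "\<dots> = real N powr (\<gamma> - 1)" by (subst powr_add[symmetric]) simp
    finally show ?thesis by (metis mult.assoc)
  qed
  finally show "(LBINT s:{0<..}. LBINT t:{0<..}. f s t) = real N powr (\<gamma> - 1) * (\<Sum>i. \<Sum>j. real (i + j + 1) powr - (1 + \<gamma>) * A i j)" .
qed

text \<open>Dominated convergence, first in \<open>t\<close> and then in \<open>s\<close>. The outer
  majorant \<open>tail_kernel \<gamma> a\<close> is integrable at 0 precisely because
  \<open>\<gamma> - 1 < a\<close>. The null lines \<open>s = s0\<close> and \<open>t = t0\<close>
  leave room for limits with jumps there, such as the indicator of the reservoirs.\<close>

lemma double_sum_tendsto_integral:
  fixes A :: "nat \<Rightarrow> nat \<Rightarrow> nat \<Rightarrow> real" and B :: "real \<Rightarrow> real \<Rightarrow> real"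
  assumes \<gamma>: "1 < \<gamma>" "\<gamma> < 2" and a: "0 \<le> a" "a < \<gamma>" "\<gamma> - 1 < a"
    and A: "\<And>N i j. N \<ge> 2 \<Longrightarrow> \<bar>A N i j\<bar> \<le> C" "\<And>N i j. N \<ge> 2 \<Longrightarrow> \<bar>A N i j\<bar> \<le> C * (real (i + j + 1) / real N) powr a"
    and B[measurable]: "case_prod B \<in> borel_measurable (borel \<Otimes>\<^sub>M borel)"
    and lim: "\<And>s t. s > 0 \<Longrightarrow> t > 0 \<Longrightarrow> s \<noteq> s0 \<Longrightarrow> t \<noteq> t0 \<Longrightarrow>
       (\<lambda>N. A N (cell_index (1 / N) s) (cell_index (1 / N) t)) \<longlonglongrightarrow> B s t"
  shows "(\<lambda>N. real N powr (\<gamma> - 1) * (\<Sum>i. \<Sum>j. real (i + j + 1) powr - (1 + \<gamma>) * A N i j)) \<longlonglongrightarrow>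
    (LBINT s:{0<..}. LBINT t:{0<..}. (s + t) powr - (1 + \<gamma>) * B s t)"
proof -
  define f where "f N s t = (real (cell_index (1 / real N) s + cell_index (1 / real N) t + 1) / real N) powr - (1 + \<gamma>)
     * A N (cell_index (1 / real N) s) (cell_index (1 / real N) t)" for N s t
  have N2: "n + 2 > 0" "n + 2 \<ge> 2" for n :: nat by auto
  define D where "D = C * 2 powr (1 + \<gamma>)"
  have Cp: "C \<ge> 0" using A(1)[of 2 0 0] by simp
  have D: "D \<ge> 0" using Cp by (simp add: D_def)
  have f1: "\<bar>f (n + 2) s t\<bar> \<le> D * tail_kernel (1 + \<gamma>) a (s + t)" if "s > 0" "t > 0" for n s t
    unfolding f_def D_def
    by (rule double_sum_eq_integral(1)[OF \<gamma> a(1,2) N2(1), where A="A (n + 2)" and C=C]) (rule A(1)[OF N2(2)] A(2)[OF N2(2)] that)+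
  have f2: "set_integrable lborel {0<..} (f (n + 2) s)" if "s > 0" for n s
    unfolding f_def
    by (rule double_sum_eq_integral(2)[OF \<gamma> a(1,2) N2(1), where A="A (n + 2)" and C=C]) (rule A(1)[OF N2(2)] A(2)[OF N2(2)] that)+
  have f3: "set_integrable lborel {0<..} (\<lambda>s. LBINT t:{0<..}. f (n + 2) s t)" for n
    unfolding f_def
    by (rule double_sum_eq_integral(3)[OF \<gamma> a(1,2) N2(1), where A="A (n + 2)" and C=C]) (rule A(1)[OF N2(2)] A(2)[OF N2(2)])+
  have f4: "(LBINT s:{0<..}. LBINT t:{0<..}. f (n + 2) s t) = real (n + 2) powr (\<gamma> - 1) * (\<Sum>i. \<Sum>j. real (i + j + 1) powr - (1 + \<gamma>) * A (n + 2) i j)" for n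
    unfolding f_def
    by (rule double_sum_eq_integral(4)[OF \<gamma> a(1,2) N2(1), where A="A (n + 2)" and C=C]) (rule A(1)[OF N2(2)] A(2)[OF N2(2)])+
  have flim: "(\<lambda>n. f (n + 2) s t) \<longlonglongrightarrow> (s + t) powr - (1 + \<gamma>) * B s t" if st: "s > 0" "t > 0" "s \<noteq> s0" "t \<noteq> t0" for s t
  proof -
    have cell: "(\<lambda>n. 1 / real (n + 2) * real (Suc (cell_index (1 / real (n + 2)) s))) \<longlonglongrightarrow> s" if "s > 0" for s
    proof (rule tendsto_sandwich)
      show "(\<lambda>n. s) \<longlonglongrightarrow> s" by simp
      have "(\<lambda>n. 1 / real (n + 2)) \<longlonglongrightarrow> 0" by real_asymp
      from tendsto_add[OF tendsto_const this, of s]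
      show "(\<lambda>n. s + 1 / real (n + 2)) \<longlonglongrightarrow> s" by simp
    qed (use cell_index_bounds(2,3)[of "1 / real (n + 2)" s for n] that in \<open>auto intro!: always_eventually less_imp_le simp del: of_nat_Suc of_nat_add\<close>)
    have "(\<lambda>n. 1 / real (n + 2) * real (Suc (cell_index (1 / real (n + 2)) s)) + 1 / real (n + 2) * real (Suc (cell_index (1 / real (n + 2)) t)) - 1 / real (n + 2)) \<longlonglongrightarrow> s + t - 0"
      by (intro tendsto_diff tendsto_add cell st) real_asymp
    moreover have "1 / real (n + 2) * real (Suc i) + 1 / real (n + 2) * real (Suc j) - 1 / real (n + 2) = real (i + j + 1) / real (n + 2)" for n i j
      by (simp add: add_divide_distrib[symmetric] diff_divide_distrib[symmetric])
    ultimately have L: "(\<lambda>n. real (cell_index (1 / real (n + 2)) s + cell_index (1 / real (n + 2)) t + 1) / real (n + 2)) \<longlonglongrightarrow> s + t" by simp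
    have "s + t \<noteq> 0" using st by simp
    then show ?thesis
      unfolding f_def by (rule tendsto_mult[OF tendsto_powr[OF L tendsto_const] LIMSEQ_ignore_initial_segment[OF lim[OF st], of 2]])
  qed
  have AEne: "AE t in lborel. t \<noteq> c" for c :: real
    by (rule AE_I[of _ _ "{c}"]) auto
  have inner: "(\<lambda>n. LBINT t:{0<..}. f (n + 2) s t) \<longlonglongrightarrow> (LBINT t:{0<..}. (s + t) powr - (1 + \<gamma>) * B s t)" if s: "s > 0" "s \<noteq> s0" for s
    unfolding set_lebesgue_integral_def
  proof (rule integral_dominated_convergence)
    show "integrable lborel (\<lambda>t. D * (indicator {0<..} t * tail_kernel (1 + \<gamma>) a (s + t)))"
      using set_integrable_shifted_tail_kernel[of "1 + \<gamma>" s a] \<gamma> s by (simp add: set_integrable_def)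
    show "AE t in lborel. norm (indicator {0<..} t *\<^sub>R f (n + 2) s t) \<le> D * (indicator {0<..} t * tail_kernel (1 + \<gamma>) a (s + t))" for n
      using f1[OF s(1)] by (intro AE_I2) (auto simp: indicator_def)
    show "AE t in lborel. (\<lambda>n. indicator {0<..} t *\<^sub>R f (n + 2) s t) \<longlonglongrightarrow> indicator {0<..} t *\<^sub>R ((s + t) powr - (1 + \<gamma>) * B s t)"
      using AEne[of t0]
    proof eventually_elim
      fix t assume "t \<noteq> t0"
      then show "(\<lambda>n. indicator {0<..} t *\<^sub>R f (n + 2) s t) \<longlonglongrightarrow> indicator {0<..} t *\<^sub>R ((s + t) powr - (1 + \<gamma>) * B s t)"
        using flim[OF s(1) _ s(2)] by (cases "t > 0") auto
    qed
    show "(\<lambda>t. indicator {0<..} t *\<^sub>R f (n + 2) s t) \<in> borel_measurable lborel" for n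
      using f2[OF s(1)] unfolding set_integrable_def by (rule borel_measurable_integrable)
    show "(\<lambda>t. indicator {0<..} t *\<^sub>R ((s + t) powr - (1 + \<gamma>) * B s t)) \<in> borel_measurable lborel"
      by measurable
  qed
  have "(\<lambda>n. LBINT s:{0<..}. LBINT t:{0<..}. f (n + 2) s t) \<longlonglongrightarrow> (LBINT s:{0<..}. LBINT t:{0<..}. (s + t) powr - (1 + \<gamma>) * B s t)"
    unfolding set_lebesgue_integral_def[of lborel "{0<..}" "\<lambda>s. set_lebesgue_integral lborel {0<..} (h s)" for h]
  proof (rule integral_dominated_convergence)
    show "integrable lborel (\<lambda>s. D * (1 / (\<gamma> - a)) * (indicator {0<..} s * tail_kernel \<gamma> a s))"
      using set_integrable_tail_kernel[of \<gamma> a] \<gamma> a by (simp add: set_integrable_def)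
    show "AE s in lborel. norm (indicator {0<..} s *\<^sub>R (LBINT t:{0<..}. f (n + 2) s t)) \<le> D * (1 / (\<gamma> - a)) * (indicator {0<..} s * tail_kernel \<gamma> a s)" for n
    proof (rule AE_I2)
      fix s :: real
      show "norm (indicator {0<..} s *\<^sub>R (LBINT t:{0<..}. f (n + 2) s t)) \<le> D * (1 / (\<gamma> - a)) * (indicator {0<..} s * tail_kernel \<gamma> a s)"
      proof (cases "s > 0")
        case True
        have "\<bar>LBINT t:{0<..}. f (n + 2) s t\<bar> \<le> (LBINT t:{0<..}. \<bar>f (n + 2) s t\<bar>)"
          using integral_norm_bound[of lborel "\<lambda>t. indicator {0<..} t *\<^sub>R f (n + 2) s t"]
          unfolding set_lebesgue_integral_def by (simp add: abs_mult)
        also have "\<dots> \<le> (LBINT t:{0<..}. D * tail_kernel (1 + \<gamma>) a (s + t))"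
          using \<gamma> True f1[OF True] set_integrable_shifted_tail_kernel[of "1 + \<gamma>" s a]
          by (intro set_integral_mono set_integrable_abs f2) auto
        also have "\<dots> = D * (LBINT t:{0<..}. tail_kernel (1 + \<gamma>) a (s + t))" by simp
        also have "\<dots> \<le> D * (1 / (\<gamma> - a) * tail_kernel \<gamma> a s)"
          using \<gamma> a True D by (intro mult_left_mono integral_shifted_tail_kernel_le) auto
        finally show ?thesis using True by simp
      qed simp
    qed
    show "AE s in lborel. (\<lambda>n. indicator {0<..} s *\<^sub>R (LBINT t:{0<..}. f (n + 2) s t)) \<longlonglongrightarrow> indicator {0<..} s *\<^sub>R (LBINT t:{0<..}. (s + t) powr - (1 + \<gamma>) * B s t)"
      using AEne[of s0]
    proof eventually_elim
      fix s assume "s \<noteq> s0"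
      then show "(\<lambda>n. indicator {0<..} s *\<^sub>R (LBINT t:{0<..}. f (n + 2) s t)) \<longlonglongrightarrow> indicator {0<..} s *\<^sub>R (LBINT t:{0<..}. (s + t) powr - (1 + \<gamma>) * B s t)"
        using inner[of s] by (cases "s > 0") auto
    qed
    show "(\<lambda>s. indicator {0<..} s *\<^sub>R (LBINT t:{0<..}. f (n + 2) s t)) \<in> borel_measurable lborel" for n
      using f3 unfolding set_integrable_def by (rule borel_measurable_integrable)
    show "(\<lambda>s. indicator {0<..} s *\<^sub>R (LBINT t:{0<..}. (s + t) powr - (1 + \<gamma>) * B s t)) \<in> borel_measurable lborel"
      unfolding set_lebesgue_integral_def by measurable
  qed
  then have "(\<lambda>n. real (n + 2) powr (\<gamma> - 1) * (\<Sum>i. \<Sum>j. real (i + j + 1) powr - (1 + \<gamma>) * A (n + 2) i j)) \<longlonglongrightarrow>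
    (LBINT s:{0<..}. LBINT t:{0<..}. (s + t) powr - (1 + \<gamma>) * B s t)"
    unfolding f4 .
  then show ?thesis by (rule LIMSEQ_offset)
qed

section \<open>The flux through a bond\<close>

lemma summable_on_mult_bounded:
  fixes f g :: "'a \<Rightarrow> real"
  assumes "f summable_on A" "\<And>x. x \<in> A \<Longrightarrow> 0 \<le> f x" "\<And>x. x \<in> A \<Longrightarrow> \<bar>g x\<bar> \<le> M"
  shows "(\<lambda>x. f x * g x) summable_on A"
proof (rule Infinite_Sum.abs_summable_summable, rule Infinite_Sum.abs_summable_on_comparison_test')
  show "(\<lambda>x. f x * M) summable_on A" using assms(1) by (rule summable_on_cmult_left)
  show "norm (f x * g x) \<le> f x * M" if "x \<in> A" for x
    using assms(2,3)[OF that] by (simp add: abs_mult mult_left_mono)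
qed

lemma has_sum_sum_finite:
  fixes f :: "'b \<Rightarrow> 'a \<Rightarrow> real"
  assumes "finite I" "\<And>i. i \<in> I \<Longrightarrow> (f i has_sum s i) A"
  shows "((\<lambda>x. \<Sum>i\<in>I. f i x) has_sum (\<Sum>i\<in>I. s i)) A"
  using assms by (induction I) (auto intro!: has_sum_add)

lemma jump_prob_nonneg: "\<gamma> > 0 \<Longrightarrow> 0 \<le> jump_prob \<gamma> z"
  using jump_const_pos[of \<gamma>] by (simp add: jump_prob_def)

lemma jump_prob_uminus: "jump_prob \<gamma> (- z) = jump_prob \<gamma> z"
  by (simp add: jump_prob_def)

lemma jump_prob_pos_int: "n > 0 \<Longrightarrow> jump_prob \<gamma> (int n) = jump_const \<gamma> * real n powr - (1 + \<gamma>)"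
  by (simp add: jump_prob_def)

lemma suminf_eq_infsum: "(f :: nat \<Rightarrow> real) summable_on UNIV \<Longrightarrow> infsum f UNIV = suminf f"
  using has_sum_imp_sums[OF has_sum_infsum] sums_unique by blast

lemma summable_on_Suc_powr: "p > (1::real) \<Longrightarrow> (\<lambda>n. real (Suc n) powr - p) summable_on UNIV"
  using summable_Suc_powr[of p] by (subst summable_on_UNIV_nonneg_real_iff) auto

text \<open>Splitting the power evenly between the indices gives a product of one-dimensional
  weights with exponent \<open>(1 + \<gamma>) / 2\<close>, and this exceeds 1 because
  \<open>\<gamma> > 1\<close>.\<close>

lemma summable_on_pair_powr:
  assumes "\<gamma> > 1"
  shows "(\<lambda>(i, j). real (i + j + 1) powr - (1 + \<gamma>)) summable_on (UNIV :: (nat \<times> nat) set)"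
proof -
  define p where "p = (1 + \<gamma>) / 2"
  have p: "p > 1" using assms by (simp add: p_def)
  define h where "h n = real (Suc n) powr - p" for n
  have h: "h summable_on UNIV" unfolding h_def using summable_on_Suc_powr[OF p] .
  have prod: "(\<lambda>(i, j). h i * h j) summable_on UNIV \<times> UNIV"
  proof (rule summable_on_SigmaI[where g = "\<lambda>i. h i * infsum h UNIV"])
    show "((\<lambda>j. case (i, j) of (i, j) \<Rightarrow> h i * h j) has_sum h i * infsum h UNIV) UNIV" for i
      using has_sum_cmult_right[OF has_sum_infsum[OF h], of "h i"] by simp
    show "(\<lambda>i. h i * infsum h UNIV) summable_on UNIV" using h by (rule summable_on_cmult_left)
  qed (auto simp: h_def)
  have "(\<lambda>x. norm ((\<lambda>(i, j). real (i + j + 1) powr - (1 + \<gamma>)) x)) summable_on (UNIV \<times> UNIV :: (nat \<times> nat) set)"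
  proof (rule Infinite_Sum.abs_summable_on_comparison_test'[OF prod])
    fix x :: "nat \<times> nat"
    obtain i j where x: "x = (i, j)" by (cases x)
    have "real (i + j + 1) powr - (1 + \<gamma>) = real (i + j + 1) powr - p * real (i + j + 1) powr - p"
      by (subst powr_add[symmetric]) (simp add: p_def)
    also have "\<dots> \<le> h i * h j"
      unfolding h_def using p by (intro mult_mono powr_mono2') auto
    finally show "norm (case x of (i, j) \<Rightarrow> real (i + j + 1) powr - (1 + \<gamma>)) \<le> (case x of (i, j) \<Rightarrow> h i * h j)"
      by (simp add: x)
  qed
  then show ?thesis using Infinite_Sum.abs_summable_summable[of "\<lambda>(i, j). real (i + j + 1) powr - (1 + \<gamma>)" "UNIV \<times> UNIV"] by simp
qed

lemma bij_betw_crossing_pairs: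
  "bij_betw (\<lambda>(i, j). (x - 1 - int i, x + int j)) (UNIV :: (nat \<times> nat) set) ({..x - 1} \<times> {x..})"
  by (rule bij_betw_byWitness[where f' = "\<lambda>(y, z). (nat (x - 1 - y), nat (z - x))"]) auto

lemma
  assumes \<gamma>: "\<gamma> > 1" and B: "\<And>y z. \<bar>B y z\<bar> \<le> M"
  shows crossing_summable: "(\<lambda>(y, z). jump_prob \<gamma> (z - y) * B y z) summable_on ({..x - 1} \<times> {x..})"
    and crossing_infsum: "(\<Sum>\<^sub>\<infinity>(y, z)\<in>{..x - 1} \<times> {x..}. jump_prob \<gamma> (z - y) * B y z) =
      jump_const \<gamma> * (\<Sum>i. \<Sum>j. real (i + j + 1) powr - (1 + \<gamma>) * B (x - 1 - int i) (x + int j))"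
proof -
  define g where "g i j = real (i + j + 1) powr - (1 + \<gamma>) * B (x - 1 - int i) (x + int j)" for i j
  have gs: "(\<lambda>(i, j). g i j) summable_on UNIV"
    using summable_on_mult_bounded[OF summable_on_pair_powr[OF \<gamma>], of "\<lambda>(i, j). B (x - 1 - int i) (x + int j)" M] B
    unfolding g_def by (simp add: case_prod_unfold)
  have re: "(\<lambda>p. (case (case p of (i, j) \<Rightarrow> (x - 1 - int i, x + int j)) of (y, z) \<Rightarrow> jump_prob \<gamma> (z - y) * B y z)) =
     (\<lambda>p. jump_const \<gamma> * (case p of (i, j) \<Rightarrow> g i j))"
  proof
    fix p :: "nat \<times> nat"
    obtain i j where p: "p = (i, j)" by (cases p)
    have e: "x + int j - (x - 1 - int i) = int (i + j + 1)" by simp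
    show "(case (case p of (i, j) \<Rightarrow> (x - 1 - int i, x + int j)) of (y, z) \<Rightarrow> jump_prob \<gamma> (z - y) * B y z) =
       jump_const \<gamma> * (case p of (i, j) \<Rightarrow> g i j)"
      unfolding p prod.case e g_def by (subst jump_prob_pos_int) simp_all
  qed
  have "(\<lambda>p. jump_const \<gamma> * (case p of (i, j) \<Rightarrow> g i j)) summable_on UNIV"
    using gs by (rule summable_on_cmult_right)
  then show "(\<lambda>(y, z). jump_prob \<gamma> (z - y) * B y z) summable_on ({..x - 1} \<times> {x..})"
    unfolding re[symmetric] by (subst (asm) summable_on_reindex_bij_betw[OF bij_betw_crossing_pairs])
  have "(\<Sum>\<^sub>\<infinity>(y, z)\<in>{..x - 1} \<times> {x..}. jump_prob \<gamma> (z - y) * B y z) = (\<Sum>\<^sub>\<infinity>p. jump_const \<gamma> * (case p of (i, j) \<Rightarrow> g i j))"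
    unfolding re[symmetric] by (rule infsum_reindex_bij_betw[OF bij_betw_crossing_pairs, symmetric])
  also have "\<dots> = jump_const \<gamma> * (\<Sum>\<^sub>\<infinity>p. (case p of (i, j) \<Rightarrow> g i j))" by (rule infsum_cmult_right')
  also have "(\<Sum>\<^sub>\<infinity>p. (case p of (i, j) \<Rightarrow> g i j)) = (\<Sum>i. \<Sum>j. g i j)"
  proof -
    have gs': "(\<lambda>(i, j). g i j) summable_on UNIV \<times> UNIV" using gs by simp
    have row: "g i summable_on UNIV" for i using summable_on_SigmaD1[OF gs'] by simp
    have "(\<Sum>\<^sub>\<infinity>p. (case p of (i, j) \<Rightarrow> g i j)) = (\<Sum>\<^sub>\<infinity>i. \<Sum>\<^sub>\<infinity>j. g i j)"
      using infsum_Sigma'_banach[OF gs'] by simp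
    also have "\<dots> = (\<Sum>i. \<Sum>\<^sub>\<infinity>j. g i j)"
      by (rule suminf_eq_infsum[OF summable_on_Sigma_banach[OF gs']])
    finally show ?thesis using suminf_eq_infsum[OF row] by simp
  qed
  finally show "(\<Sum>\<^sub>\<infinity>(y, z)\<in>{..x - 1} \<times> {x..}. jump_prob \<gamma> (z - y) * B y z) =
      jump_const \<gamma> * (\<Sum>i. \<Sum>j. real (i + j + 1) powr - (1 + \<gamma>) * B (x - 1 - int i) (x + int j))"
    by (simp add: g_def)
qed

lemma
  assumes \<gamma>: "\<gamma> > 1" and B: "\<And>z. \<bar>B z\<bar> \<le> M"
  shows right_jumps_infsum: "(\<Sum>\<^sub>\<infinity>z\<in>{m + 1..}. jump_prob \<gamma> (z - m) * B z) = jump_const \<gamma> * (\<Sum>n. real (Suc n) powr - (1 + \<gamma>) * B (m + int (Suc n)))"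
    and left_jumps_infsum: "(\<Sum>\<^sub>\<infinity>y\<in>{..m - 1}. jump_prob \<gamma> (m - y) * B y) = jump_const \<gamma> * (\<Sum>n. real (Suc n) powr - (1 + \<gamma>) * B (m - int (Suc n)))"
proof -
  have s: "(\<lambda>n. real (Suc n) powr - (1 + \<gamma>) * C n) summable_on UNIV" if "\<And>n. \<bar>C n\<bar> \<le> M" for C
    using summable_on_Suc_powr[of "1 + \<gamma>"] \<gamma> that by (intro summable_on_mult_bounded[where M=M]) auto
  have b1: "bij_betw (\<lambda>n. m + int (Suc n)) UNIV {m + 1..}"
    by (rule bij_betw_byWitness[where f' = "\<lambda>z. nat (z - m - 1)"]) auto
  have b2: "bij_betw (\<lambda>n. m - int (Suc n)) UNIV {..m - 1}"
    by (rule bij_betw_byWitness[where f' = "\<lambda>z. nat (m - 1 - z)"]) auto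
  have e1: "jump_prob \<gamma> (m + int (Suc n) - m) * B (m + int (Suc n)) = jump_const \<gamma> * (real (Suc n) powr - (1 + \<gamma>) * B (m + int (Suc n)))" for n
    using jump_prob_pos_int[of "Suc n" \<gamma>] by simp
  have e2: "jump_prob \<gamma> (m - (m - int (Suc n))) * B (m - int (Suc n)) = jump_const \<gamma> * (real (Suc n) powr - (1 + \<gamma>) * B (m - int (Suc n)))" for n
    using jump_prob_pos_int[of "Suc n" \<gamma>] by simp
  show "(\<Sum>\<^sub>\<infinity>z\<in>{m + 1..}. jump_prob \<gamma> (z - m) * B z) = jump_const \<gamma> * (\<Sum>n. real (Suc n) powr - (1 + \<gamma>) * B (m + int (Suc n)))"
    unfolding infsum_reindex_bij_betw[OF b1, symmetric] e1 infsum_cmult_right'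
    using suminf_eq_infsum[OF s[of "\<lambda>n. B (m + int (Suc n))"]] B by simp
  show "(\<Sum>\<^sub>\<infinity>y\<in>{..m - 1}. jump_prob \<gamma> (m - y) * B y) = jump_const \<gamma> * (\<Sum>n. real (Suc n) powr - (1 + \<gamma>) * B (m - int (Suc n)))"
    unfolding infsum_reindex_bij_betw[OF b2, symmetric] e2 infsum_cmult_right'
    using suminf_eq_infsum[OF s[of "\<lambda>n. B (m - int (Suc n))"]] B by simp
qed

lemma second_diff_sum_eq_infsum:
  assumes \<gamma>: "\<gamma> > 1" and u: "\<And>z. \<bar>u z\<bar> \<le> M"
  shows "jump_const \<gamma> * second_diff_sum \<gamma> u m =
    (\<Sum>\<^sub>\<infinity>z\<in>{m + 1..}. jump_prob \<gamma> (z - m) * (u z - u m)) + (\<Sum>\<^sub>\<infinity>y\<in>{..m - 1}. jump_prob \<gamma> (m - y) * (u y - u m))"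
proof -
  have b: "\<bar>u z - u m\<bar> \<le> 2 * M" for z using u[of z] u[of m] by linarith
  have s: "summable (\<lambda>n. real (Suc n) powr - (1 + \<gamma>) * C n)" if "\<And>n. \<bar>C n\<bar> \<le> 2 * M" for C
    using \<gamma> that by (intro summable_rabs_cancel[OF summable_weighted[where d=1 and C="2 * M"]]) auto
  have "second_diff_sum \<gamma> u m = (\<Sum>n. real (Suc n) powr - (1 + \<gamma>) * (u (m + int (Suc n)) - u m) + real (Suc n) powr - (1 + \<gamma>) * (u (m - int (Suc n)) - u m))"
    unfolding second_diff_sum_def by (intro suminf_cong) (simp add: algebra_simps)
  also have "\<dots> = (\<Sum>n. real (Suc n) powr - (1 + \<gamma>) * (u (m + int (Suc n)) - u m)) + (\<Sum>n. real (Suc n) powr - (1 + \<gamma>) * (u (m - int (Suc n)) - u m))"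
    by (intro suminf_add[symmetric] s b)
  finally show ?thesis
    unfolding right_jumps_infsum[OF \<gamma> b] left_jumps_infsum[OF \<gamma> b] by (simp add: distrib_left)
qed

text \<open>Moving the bond past \<open>m\<close> leaves the jumps that pass over \<open>m\<close>
  untouched. It gains the jumps from \<open>m\<close> to the right and loses those from the left
  into \<open>m\<close>; the change is minus the jump operator at \<open>m\<close>.\<close>

lemma crossing_flux_step:
  assumes \<gamma>: "\<gamma> > 1" and u: "\<And>z. \<bar>u z\<bar> \<le> M" and harm: "second_diff_sum \<gamma> u m = 0"
  shows "(\<Sum>\<^sub>\<infinity>(y, z)\<in>{..m} \<times> {m + 1..}. jump_prob \<gamma> (z - y) * (u y - u z)) =
    (\<Sum>\<^sub>\<infinity>(y, z)\<in>{..m - 1} \<times> {m..}. jump_prob \<gamma> (z - y) * (u y - u z))"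
proof -
  define h where "h = (\<lambda>(y, z). jump_prob \<gamma> (z - y) * (u y - u z))"
  have b: "\<bar>u y - u z\<bar> \<le> 2 * M" for y z using u[of z] u[of y] by linarith
  have s: "h summable_on ({..x - 1} \<times> {x..})" for x
    unfolding h_def by (rule crossing_summable[OF \<gamma> b])
  have s1: "h summable_on ({m} \<times> {m + 1..})" "h summable_on ({..m - 1} \<times> {m + 1..})"
    using s[of "m + 1"] by (auto elim!: summable_on_subset_banach)
  have s2: "h summable_on ({..m - 1} \<times> {m})"
    using s[of m] by (rule summable_on_subset_banach) auto
  have 1: "infsum h ({..m} \<times> {m + 1..}) = infsum h ({m} \<times> {m + 1..}) + infsum h ({..m - 1} \<times> {m + 1..})"
  proof -
    have "{..m} \<times> {m + 1..} = ({m} \<times> {m + 1..}) \<union> ({..m - 1} \<times> {m + 1..})" by auto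
    then show ?thesis using s1 by (simp only:) (rule infsum_Un_disjoint; auto)
  qed
  have 2: "infsum h ({..m - 1} \<times> {m..}) = infsum h ({..m - 1} \<times> {m}) + infsum h ({..m - 1} \<times> {m + 1..})"
  proof -
    have "{..m - 1} \<times> {m..} = ({..m - 1} \<times> {m}) \<union> ({..m - 1} \<times> {m + 1..})" by auto
    then show ?thesis using s1 s2 by (simp only:) (rule infsum_Un_disjoint; auto)
  qed
  have bb: "bij_betw (\<lambda>z. (m, z)) {m + 1..} ({m} \<times> {m + 1..})" "bij_betw (\<lambda>y. (y, m)) {..m - 1} ({..m - 1} \<times> {m})"
    by (auto simp: bij_betw_def inj_on_def)
  have 3: "infsum h ({m} \<times> {m + 1..}) = - (\<Sum>\<^sub>\<infinity>z\<in>{m + 1..}. jump_prob \<gamma> (z - m) * (u z - u m))"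
    unfolding infsum_reindex_bij_betw[OF bb(1), symmetric] infsum_uminus[symmetric]
    by (intro infsum_cong) (simp add: h_def algebra_simps)
  have 4: "infsum h ({..m - 1} \<times> {m}) = (\<Sum>\<^sub>\<infinity>y\<in>{..m - 1}. jump_prob \<gamma> (m - y) * (u y - u m))"
    unfolding infsum_reindex_bij_betw[OF bb(2), symmetric] by (simp add: h_def)
  show ?thesis
    using second_diff_sum_eq_infsum[where u=u and m=m, OF \<gamma> u] harm unfolding h_def[symmetric] 1 2 3 4 by simp
qed

section \<open>The invariant measure\<close>

lemma finite_configs: "finite (configs N)"
  unfolding configs_def sites_def by (intro finite_PiE) auto

lemma config_values: "\<eta> \<in> configs N \<Longrightarrow> x \<in> sites N \<Longrightarrow> \<eta> x = 0 \<or> \<eta> x = 1"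
  unfolding configs_def by (auto simp: PiE_def Pi_def)

lemma exchange_configs: "\<eta> \<in> configs N \<Longrightarrow> x \<in> sites N \<Longrightarrow> y \<in> sites N \<Longrightarrow> exchange \<eta> x y \<in> configs N"
  unfolding configs_def exchange_def by (auto simp: PiE_def Pi_def extensional_def)

lemma flip_configs: "\<eta> \<in> configs N \<Longrightarrow> x \<in> sites N \<Longrightarrow> flip \<eta> x \<in> configs N"
  unfolding configs_def flip_def by (auto simp: PiE_def Pi_def extensional_def)

lemma finite_sites: "finite (sites N)" by (simp add: sites_def)

text \<open>Exchanges and flips preserve \<open>configs N\<close>, so the generator is bounded in
  the supremum norm there. This makes the exponential series of the semigroup converge for all
  times.\<close>

lemma generator_bounded:
  assumes \<gamma>: "\<gamma> > 0" and \<alpha>: "\<alpha> \<in> {0<..<1}" and \<beta>: "\<beta> \<in> {0<..<1}"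
  shows "\<exists>K\<ge>0. \<forall>f B. (\<forall>\<eta>\<in>configs N. \<bar>f \<eta>\<bar> \<le> B) \<longrightarrow> (\<forall>\<eta>\<in>configs N. \<bar>generator \<gamma> \<alpha> \<beta> N f \<eta>\<bar> \<le> K * B)"
proof -
  define Pr where "Pr x = (\<Sum>\<^sub>\<infinity>y\<in>{int N..}. jump_prob \<gamma> (x - y))" for x
  define Pl where "Pl x = (\<Sum>\<^sub>\<infinity>y\<in>{..0}. jump_prob \<gamma> (x - y))" for x
  define K where "K = (\<Sum>x\<in>sites N. \<Sum>y\<in>sites N. jump_prob \<gamma> (x - y)) + (\<Sum>x\<in>sites N. \<bar>Pr x\<bar> * 2) + (\<Sum>x\<in>sites N. \<bar>Pl x\<bar> * 2)"
  have p0: "0 \<le> jump_prob \<gamma> z" for z using \<gamma> by (rule jump_prob_nonneg)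
  have K0: "K \<ge> 0" unfolding K_def using p0 by (intro add_nonneg_nonneg sum_nonneg) auto
  have "\<bar>generator \<gamma> \<alpha> \<beta> N f \<eta>\<bar> \<le> K * B" if f: "\<And>\<eta>. \<eta> \<in> configs N \<Longrightarrow> \<bar>f \<eta>\<bar> \<le> B" and \<eta>: "\<eta> \<in> configs N" for f B \<eta>
  proof -
    have d: "\<bar>f \<xi> - f \<eta>\<bar> \<le> 2 * B" if "\<xi> \<in> configs N" for \<xi> using f[OF that] f[OF \<eta>] by linarith
    have "\<bar>gen_bulk \<gamma> N f \<eta>\<bar> \<le> 1/2 * (\<Sum>x\<in>sites N. \<Sum>y\<in>sites N. jump_prob \<gamma> (x - y) * (2 * B))"
      unfolding gen_bulk_def abs_mult
      using d exchange_configs[OF \<eta>] p0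
      by (intro mult_mono order.trans[OF sum_abs] sum_mono) (auto simp: abs_mult intro!: mult_left_mono sum_nonneg)
    also have "\<dots> = (\<Sum>x\<in>sites N. \<Sum>y\<in>sites N. jump_prob \<gamma> (x - y)) * B"
      by (simp add: sum_distrib_right[symmetric])
    finally have 1: "\<bar>gen_bulk \<gamma> N f \<eta>\<bar> \<le> (\<Sum>x\<in>sites N. \<Sum>y\<in>sites N. jump_prob \<gamma> (x - y)) * B" .
    have rate: "\<bar>\<eta> x * (1 - a) + (1 - \<eta> x) * a\<bar> \<le> 1" if "x \<in> sites N" "a \<in> {0<..<1}" for x a
      using config_values[OF \<eta> that(1)] that(2) by auto
    have res: "\<bar>\<Sum>x\<in>sites N. P x * (\<eta> x * (1 - a) + (1 - \<eta> x) * a) * (f (flip \<eta> x) - f \<eta>)\<bar> \<le> (\<Sum>x\<in>sites N. \<bar>P x\<bar> * 2) * B"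
      if a: "a \<in> {0<..<1}" for P a
      unfolding sum_distrib_right
    proof (intro order.trans[OF sum_abs] sum_mono)
      fix x assume x: "x \<in> sites N"
      have "\<bar>P x * (\<eta> x * (1 - a) + (1 - \<eta> x) * a) * (f (flip \<eta> x) - f \<eta>)\<bar> \<le> \<bar>P x\<bar> * 1 * (2 * B)"
        unfolding abs_mult[of _ "f (flip \<eta> x) - f \<eta>"] abs_mult[of "P x"]
        using rate[OF x a] d[OF flip_configs[OF \<eta> x]] by (intro mult_mono) auto
      then show "\<bar>P x * (\<eta> x * (1 - a) + (1 - \<eta> x) * a) * (f (flip \<eta> x) - f \<eta>)\<bar> \<le> \<bar>P x\<bar> * 2 * B" by simp
    qed
    have 2: "\<bar>gen_right \<gamma> \<beta> N f \<eta>\<bar> \<le> (\<Sum>x\<in>sites N. \<bar>Pr x\<bar> * 2) * B"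
      unfolding gen_right_def infsum_cmult_left' Pr_def[symmetric] by (rule res[OF \<beta>])
    have 3: "\<bar>gen_left \<gamma> \<alpha> N f \<eta>\<bar> \<le> (\<Sum>x\<in>sites N. \<bar>Pl x\<bar> * 2) * B"
      unfolding gen_left_def infsum_cmult_left' Pl_def[symmetric] by (rule res[OF \<alpha>])
    show ?thesis unfolding generator_def K_def distrib_right using 1 2 3 by linarith
  qed
  then show ?thesis using K0 by blast
qed

lemma expectation_config_sum:
  assumes "set_pmf \<mu> \<subseteq> configs N"
  shows "measure_pmf.expectation \<mu> f = (\<Sum>\<eta>\<in>configs N. pmf \<mu> \<eta> * f \<eta>)"
  using assms by (subst integral_measure_pmf_real[where A = "configs N"]) (auto simp: finite_configs mult.commute)

text \<open>The expectation of the semigroup is a power series in the time, constant on \<open>t \<ge> 0\<close>; its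
  linear coefficient is the expectation of the generator.\<close>

lemma invariant_expectation_generator:
  assumes \<gamma>: "\<gamma> > 0" and \<alpha>: "\<alpha> \<in> {0<..<1}" and \<beta>: "\<beta> \<in> {0<..<1}"
    and inv: "invariant_measure \<gamma> \<alpha> \<beta> N \<mu>"
  shows "measure_pmf.expectation \<mu> (generator \<gamma> \<alpha> \<beta> N f) = 0"
proof -
  let ?G = "generator \<gamma> \<alpha> \<beta> N"
  have supp: "set_pmf \<mu> \<subseteq> configs N"
    and inv': "\<And>f t. t \<ge> 0 \<Longrightarrow> measure_pmf.expectation \<mu> (semigroup \<gamma> \<alpha> \<beta> N t f) = measure_pmf.expectation \<mu> f"
    using inv by (auto simp: invariant_measure_def)
  obtain K where K: "K \<ge> 0" "\<And>f B \<eta>. (\<forall>\<eta>\<in>configs N. \<bar>f \<eta>\<bar> \<le> B) \<Longrightarrow> \<eta> \<in> configs N \<Longrightarrow> \<bar>?G f \<eta>\<bar> \<le> K * B"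
    using generator_bounded[OF \<gamma> \<alpha> \<beta>, of N] by blast
  define B where "B = (\<Sum>\<eta>\<in>configs N. \<bar>f \<eta>\<bar>)"
  have B: "\<bar>f \<eta>\<bar> \<le> B" if "\<eta> \<in> configs N" for \<eta>
    unfolding B_def using that finite_configs by (intro member_le_sum) auto
  have iter: "\<forall>\<eta>\<in>configs N. \<bar>(?G ^^ n) f \<eta>\<bar> \<le> K ^ n * B" for n
  proof (induction n)
    case 0
    then show ?case using B by simp
  next
    case (Suc n)
    show ?case
    proof
      fix \<eta> assume "\<eta> \<in> configs N"
      from K(2)[OF Suc this] show "\<bar>(?G ^^ Suc n) f \<eta>\<bar> \<le> K ^ Suc n * B" by (simp add: mult.assoc)
    qed
  qed
  have summ: "summable (\<lambda>n. t ^ n / fact n * (?G ^^ n) f \<eta>)" if "\<eta> \<in> configs N" for t \<eta>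
  proof (rule summable_comparison_test')
    show "summable (\<lambda>n. inverse (fact n) * (\<bar>t\<bar> * K) ^ n * B)"
      by (intro summable_mult2 summable_exp)
    fix n
    have "norm (t ^ n / fact n * (?G ^^ n) f \<eta>) = \<bar>t\<bar> ^ n / fact n * \<bar>(?G ^^ n) f \<eta>\<bar>"
      by (simp add: abs_mult power_abs)
    also have "\<dots> \<le> \<bar>t\<bar> ^ n / fact n * (K ^ n * B)"
      using iter[of n] that by (intro mult_left_mono) auto
    finally show "norm (t ^ n / fact n * (?G ^^ n) f \<eta>) \<le> inverse (fact n) * (\<bar>t\<bar> * K) ^ n * B"
      by (simp add: power_mult_distrib field_simps)
  qed
  define c where "c n = (\<Sum>\<eta>\<in>configs N. pmf \<mu> \<eta> * (?G ^^ n) f \<eta>) / fact n" for n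
  have cs: "(\<lambda>n. c n * t ^ n) sums measure_pmf.expectation \<mu> (semigroup \<gamma> \<alpha> \<beta> N t f)" for t
  proof -
    have "(\<lambda>n. \<Sum>\<eta>\<in>configs N. pmf \<mu> \<eta> * (t ^ n / fact n * (?G ^^ n) f \<eta>)) sums
      (\<Sum>\<eta>\<in>configs N. pmf \<mu> \<eta> * (\<Sum>n. t ^ n / fact n * (?G ^^ n) f \<eta>))"
      by (intro sums_sum sums_mult summable_sums summ)
    moreover have "(\<Sum>\<eta>\<in>configs N. pmf \<mu> \<eta> * (t ^ n / fact n * (?G ^^ n) f \<eta>)) = c n * t ^ n" for n
      unfolding c_def by (simp add: sum_distrib_left sum_divide_distrib sum_distrib_right field_simps)
    ultimately show ?thesis unfolding expectation_config_sum[OF supp] semigroup_def by simp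
  qed
  have der: "((\<lambda>t. \<Sum>n. c n * t ^ n) has_field_derivative (\<Sum>n. diffs c n * 0 ^ n)) (at 0)"
    by (rule termdiffs_strong_converges_everywhere) (use cs sums_summable in blast)
  have const: "(\<Sum>n. c n * t ^ n) = measure_pmf.expectation \<mu> f" if "t \<ge> 0" for t
    using cs[of t] inv'[OF that] by (simp add: sums_iff)
  \<comment> \<open>Invariance is given for nonnegative times only, so the derivative at 0 is
    evaluated from the right.\<close>
  have "((\<lambda>t. ((\<Sum>n. c n * t ^ n) - (\<Sum>n. c n * 0 ^ n)) / (t - 0)) \<longlongrightarrow> (\<Sum>n. diffs c n * 0 ^ n)) (at_right 0)"
    using der unfolding has_field_derivative_iff by (rule tendsto_within_subset) simp
  moreover have "((\<lambda>t. ((\<Sum>n. c n * t ^ n) - (\<Sum>n. c n * 0 ^ n)) / (t - 0)) \<longlongrightarrow> 0) (at_right 0)"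
  proof (rule tendsto_eventually)
    show "\<forall>\<^sub>F t in at_right 0. ((\<Sum>n. c n * t ^ n) - (\<Sum>n. c n * 0 ^ n)) / (t - 0) = 0"
      using eventually_at_right_less[of 0] by eventually_elim (simp only: const[OF less_imp_le] const[OF order_refl] diff_self div_0)
  qed
  ultimately have "(\<Sum>n. diffs c n * 0 ^ n) = 0"
    using tendsto_unique trivial_limit_at_right_real by blast
  moreover have "(\<Sum>n. diffs c n * 0 ^ n) = diffs c 0" by (rule powser_zero)
  ultimately show ?thesis unfolding expectation_config_sum[OF supp] by (simp add: diffs_def c_def)
qed

section \<open>The mean occupation and its linear equation\<close>

lemma jump_prob_translate_summable: "\<gamma> > 0 \<Longrightarrow> (\<lambda>y. jump_prob \<gamma> (x - y)) summable_on A"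
proof -
  assume "\<gamma> > 0"
  have bij: "bij_betw (\<lambda>y. x - y) UNIV (UNIV :: int set)"
    by (rule bij_betw_byWitness[where f' = "\<lambda>y. x - y"]) auto
  have "(\<lambda>y. jump_prob \<gamma> (x - y)) summable_on UNIV"
    using has_sum_imp_summable[OF jump_prob_has_sum_1[OF \<open>\<gamma> > 0\<close>]]
    by (subst summable_on_reindex_bij_betw[OF bij])
  then show ?thesis by (rule summable_on_subset_banach) auto
qed

text \<open>The densities close: no correlations appear. An exchange changes the coordinate only
  when one of its sites is \<open>x\<close>, and the two orderings cancel the factor 1/2. Since
  occupation numbers are 0 or 1, the flip rate times \<open>1 - 2 * \<eta> x\<close> is linear in
  \<open>\<eta> x\<close>.\<close>

lemma generator_coordinate:
  assumes \<eta>: "\<eta> \<in> configs N" and x: "x \<in> sites N"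
  shows "generator \<gamma> \<alpha> \<beta> N (\<lambda>\<eta>. \<eta> x) \<eta> =
    (\<Sum>y\<in>sites N. jump_prob \<gamma> (x - y) * (\<eta> y - \<eta> x))
    + (\<Sum>\<^sub>\<infinity>y\<in>{int N..}. jump_prob \<gamma> (x - y)) * (\<beta> - \<eta> x) + (\<Sum>\<^sub>\<infinity>y\<in>{..0}. jump_prob \<gamma> (x - y)) * (\<alpha> - \<eta> x)"
proof -
  have ex: "exchange \<eta> a b x - \<eta> x = (if a = x then \<eta> b - \<eta> x else 0) + (if b = x then \<eta> a - \<eta> x else 0)" for a b
    by (auto simp: exchange_def)
  have "gen_bulk \<gamma> N (\<lambda>\<eta>. \<eta> x) \<eta> = 1/2 * ((\<Sum>a\<in>sites N. \<Sum>b\<in>sites N. if a = x then jump_prob \<gamma> (a - b) * (\<eta> b - \<eta> x) else 0)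
     + (\<Sum>a\<in>sites N. \<Sum>b\<in>sites N. if b = x then jump_prob \<gamma> (a - b) * (\<eta> a - \<eta> x) else 0))"
    unfolding gen_bulk_def ex distrib_left sum.distrib by (simp add: if_distrib cong: if_cong)
  also have "(\<Sum>a\<in>sites N. \<Sum>b\<in>sites N. if a = x then jump_prob \<gamma> (a - b) * (\<eta> b - \<eta> x) else 0) = (\<Sum>b\<in>sites N. jump_prob \<gamma> (x - b) * (\<eta> b - \<eta> x))"
    by (subst sum.swap) (simp add: sum.delta finite_sites x)
  also have "(\<Sum>a\<in>sites N. \<Sum>b\<in>sites N. if b = x then jump_prob \<gamma> (a - b) * (\<eta> a - \<eta> x) else 0) = (\<Sum>a\<in>sites N. jump_prob \<gamma> (a - x) * (\<eta> a - \<eta> x))"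
    by (simp add: sum.delta finite_sites x)
  also have "(\<Sum>a\<in>sites N. jump_prob \<gamma> (a - x) * (\<eta> a - \<eta> x)) = (\<Sum>b\<in>sites N. jump_prob \<gamma> (x - b) * (\<eta> b - \<eta> x))"
  proof (rule sum.cong[OF refl])
    fix a show "jump_prob \<gamma> (a - x) * (\<eta> a - \<eta> x) = jump_prob \<gamma> (x - a) * (\<eta> a - \<eta> x)"
      using jump_prob_uminus[of \<gamma> "x - a"] by simp
  qed
  finally have 1: "gen_bulk \<gamma> N (\<lambda>\<eta>. \<eta> x) \<eta> = (\<Sum>y\<in>sites N. jump_prob \<gamma> (x - y) * (\<eta> y - \<eta> x))" by simp
  have fl: "flip \<eta> a x - \<eta> x = (if a = x then 1 - 2 * \<eta> x else 0)" for a
    by (auto simp: flip_def)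
  have r: "(\<eta> x * (1 - b) + (1 - \<eta> x) * b) * (1 - 2 * \<eta> x) = b - \<eta> x" for b
    using config_values[OF \<eta> x] by auto
  have res: "(\<Sum>a\<in>sites N. P a * (\<eta> a * (1 - b) + (1 - \<eta> a) * b) * (flip \<eta> a x - \<eta> x)) = P x * (b - \<eta> x)" for P b
  proof -
    have "(\<Sum>a\<in>sites N. P a * (\<eta> a * (1 - b) + (1 - \<eta> a) * b) * (flip \<eta> a x - \<eta> x)) =
      (\<Sum>a\<in>sites N. if a = x then P x * ((\<eta> x * (1 - b) + (1 - \<eta> x) * b) * (1 - 2 * \<eta> x)) else 0)"
      unfolding fl by (intro sum.cong) auto
    then show ?thesis unfolding r by (simp add: sum.delta finite_sites x)
  qed
  have 2: "gen_right \<gamma> \<beta> N (\<lambda>\<eta>. \<eta> x) \<eta> = (\<Sum>\<^sub>\<infinity>y\<in>{int N..}. jump_prob \<gamma> (x - y)) * (\<beta> - \<eta> x)"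
    unfolding gen_right_def infsum_cmult_left' by (rule res)
  have 3: "gen_left \<gamma> \<alpha> N (\<lambda>\<eta>. \<eta> x) \<eta> = (\<Sum>\<^sub>\<infinity>y\<in>{..0}. jump_prob \<gamma> (x - y)) * (\<alpha> - \<eta> x)"
    unfolding gen_left_def infsum_cmult_left' by (rule res)
  show ?thesis unfolding generator_def 1 2 3 ..
qed

text \<open>Taking the mean of the extended configuration turns the reservoir terms of the generator
  into ordinary jumps to exterior sites, so that one jump operator on the integers describes them
  all.\<close>

definition mean_profile :: "real \<Rightarrow> real \<Rightarrow> nat \<Rightarrow> (int \<Rightarrow> real) pmf \<Rightarrow> int \<Rightarrow> real" where
  "mean_profile \<alpha> \<beta> N \<mu> z = measure_pmf.expectation \<mu> (\<lambda>\<eta>. extend_config \<alpha> \<beta> N \<eta> z)"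

lemma extend_config_bounds:
  assumes "\<alpha> \<in> {0<..<1}" "\<beta> \<in> {0<..<1}" "\<eta> \<in> configs N"
  shows "0 \<le> extend_config \<alpha> \<beta> N \<eta> z" "extend_config \<alpha> \<beta> N \<eta> z \<le> 1"
  using assms config_values[OF assms(3), of z] by (auto simp: extend_config_def sites_def)

lemma mean_profile_simps:
  "z \<le> 0 \<Longrightarrow> mean_profile \<alpha> \<beta> N \<mu> z = \<alpha>" "N > 0 \<Longrightarrow> z \<ge> int N \<Longrightarrow> mean_profile \<alpha> \<beta> N \<mu> z = \<beta>"
  by (simp_all add: mean_profile_def extend_config_def)

lemma mean_profile_bounds:
  assumes "\<alpha> \<in> {0<..<1}" "\<beta> \<in> {0<..<1}" "set_pmf \<mu> \<subseteq> configs N"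
  shows "0 \<le> mean_profile \<alpha> \<beta> N \<mu> z" "mean_profile \<alpha> \<beta> N \<mu> z \<le> 1"
proof -
  have i: "integrable (measure_pmf \<mu>) (\<lambda>\<eta>. extend_config \<alpha> \<beta> N \<eta> z)"
    using assms(3) finite_configs finite_subset by (intro integrable_measure_pmf_finite) blast
  show "0 \<le> mean_profile \<alpha> \<beta> N \<mu> z"
    unfolding mean_profile_def using extend_config_bounds(1)[OF assms(1,2)] assms(3)
    by (intro integral_nonneg_AE) (auto simp: AE_measure_pmf_iff)
  show "mean_profile \<alpha> \<beta> N \<mu> z \<le> 1"
    unfolding mean_profile_def using extend_config_bounds(2)[OF assms(1,2)] assms(3)
    by (intro measure_pmf.integral_le_const i) (auto simp: AE_measure_pmf_iff)
qed

lemma mean_profile_harmonic: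
  assumes \<gamma>: "\<gamma> > 1" and \<alpha>: "\<alpha> \<in> {0<..<1}" and \<beta>: "\<beta> \<in> {0<..<1}"
    and inv: "invariant_measure \<gamma> \<alpha> \<beta> N \<mu>" and x: "x \<in> sites N"
  shows "second_diff_sum \<gamma> (mean_profile \<alpha> \<beta> N \<mu>) x = 0"
proof -
  define u where "u = mean_profile \<alpha> \<beta> N \<mu>"
  have supp: "set_pmf \<mu> \<subseteq> configs N" using inv by (simp add: invariant_measure_def)
  have N: "N > 0" using x by (auto simp: sites_def)
  have ub: "\<bar>u z\<bar> \<le> 1" for z using mean_profile_bounds[OF \<alpha> \<beta> supp, of z] by (simp add: u_def)
  have ui: "u z = (\<Sum>\<eta>\<in>configs N. pmf \<mu> \<eta> * \<eta> z)" if "z \<in> sites N" for z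
    using that unfolding u_def mean_profile_def expectation_config_sum[OF supp] by (simp add: extend_config_def sites_def)
  have one: "(\<Sum>\<eta>\<in>configs N. pmf \<mu> \<eta>) = 1"
    using sum_pmf_eq_1[OF finite_configs supp] .
  define Pr where "Pr = (\<Sum>\<^sub>\<infinity>y\<in>{int N..}. jump_prob \<gamma> (x - y))"
  define Pl where "Pl = (\<Sum>\<^sub>\<infinity>y\<in>{..0}. jump_prob \<gamma> (x - y))"
  define h where "h y = jump_prob \<gamma> (x - y) * (u y - u x)" for y
  have "0 = (\<Sum>\<eta>\<in>configs N. pmf \<mu> \<eta> * generator \<gamma> \<alpha> \<beta> N (\<lambda>\<eta>. \<eta> x) \<eta>)"
    using invariant_expectation_generator[OF _ \<alpha> \<beta> inv, of "\<lambda>\<eta>. \<eta> x"] \<gamma> unfolding expectation_config_sum[OF supp] by simp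
  also have "\<dots> = (\<Sum>\<eta>\<in>configs N. pmf \<mu> \<eta> * ((\<Sum>y\<in>sites N. jump_prob \<gamma> (x - y) * (\<eta> y - \<eta> x)) + Pr * (\<beta> - \<eta> x) + Pl * (\<alpha> - \<eta> x)))"
    unfolding Pr_def Pl_def by (intro sum.cong refl) (simp add: generator_coordinate x)
  also have "\<dots> = (\<Sum>\<eta>\<in>configs N. \<Sum>y\<in>sites N. jump_prob \<gamma> (x - y) * (pmf \<mu> \<eta> * \<eta> y - pmf \<mu> \<eta> * \<eta> x))
     + (\<Sum>\<eta>\<in>configs N. Pr * (pmf \<mu> \<eta> * \<beta> - pmf \<mu> \<eta> * \<eta> x)) + (\<Sum>\<eta>\<in>configs N. Pl * (pmf \<mu> \<eta> * \<alpha> - pmf \<mu> \<eta> * \<eta> x))"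
    unfolding sum.distrib[symmetric] by (intro sum.cong refl) (simp add: algebra_simps sum_distrib_left)
  also have "\<dots> = (\<Sum>y\<in>sites N. jump_prob \<gamma> (x - y) * (u y - u x)) + Pr * (\<beta> - u x) + Pl * (\<alpha> - u x)"
    unfolding sum_distrib_left[symmetric] sum_subtractf sum_distrib_right[symmetric] one ui[OF x, symmetric]
    by (subst sum.swap) (simp add: sum_distrib_left[symmetric] sum_subtractf ui x)
  also have "\<dots> = infsum h (sites N) + infsum h {int N..} + infsum h {..0}"
  proof -
    have "infsum h {int N..} = (\<Sum>\<^sub>\<infinity>y\<in>{int N..}. jump_prob \<gamma> (x - y) * (\<beta> - u x))"
      using N by (intro infsum_cong) (simp add: h_def u_def mean_profile_simps)
    moreover have "infsum h {..0} = (\<Sum>\<^sub>\<infinity>y\<in>{..0}. jump_prob \<gamma> (x - y) * (\<alpha> - u x))"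
      by (intro infsum_cong) (simp add: h_def u_def mean_profile_simps)
    ultimately show ?thesis
      unfolding infsum_cmult_left' Pr_def Pl_def by (simp add: h_def finite_sites)
  qed
  finally have z: "infsum h (sites N) + infsum h {int N..} + infsum h {..0} = 0" by simp
  have d2: "\<bar>u y - u x\<bar> \<le> 2" for y using ub[of y] ub[of x] by linarith
  have hs: "h summable_on A" for A
    unfolding h_def using \<gamma> d2
    by (intro summable_on_mult_bounded[where M=2] jump_prob_translate_summable jump_prob_nonneg) auto
  have "infsum h (sites N) + infsum h {int N..} + infsum h {..0} = infsum h UNIV"
  proof -
    have U: "UNIV = (sites N \<union> {int N..}) \<union> {..0}" by (auto simp: sites_def)
    show ?thesis
      unfolding U using N
      by (subst infsum_Un_disjoint[OF hs hs], force simp: sites_def)+ simp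
  qed
  also have "infsum h UNIV = infsum h ({x} \<union> ({x + 1..} \<union> {..x - 1}))"
    by (rule arg_cong[where f="infsum h"]) auto
  also have "\<dots> = infsum h {x} + (infsum h {x + 1..} + infsum h {..x - 1})"
    by (subst infsum_Un_disjoint[OF hs hs], force)+ simp
  also have "infsum h {x} = 0" by (simp add: h_def)
  also have "infsum h {x + 1..} = (\<Sum>\<^sub>\<infinity>z\<in>{x + 1..}. jump_prob \<gamma> (z - x) * (u z - u x))"
  proof (rule infsum_cong)
    fix z show "h z = jump_prob \<gamma> (z - x) * (u z - u x)"
      using jump_prob_uminus[of \<gamma> "z - x"] by (simp add: h_def)
  qed
  also have "infsum h {..x - 1} = (\<Sum>\<^sub>\<infinity>y\<in>{..x - 1}. jump_prob \<gamma> (x - y) * (u y - u x))"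
    by (rule infsum_cong) (simp add: h_def)
  finally have "jump_const \<gamma> * second_diff_sum \<gamma> u x = 0"
    using z second_diff_sum_eq_infsum[where u=u and m=x, OF \<gamma> ub] by simp
  then show ?thesis using jump_const_pos[of \<gamma>] \<gamma> by (simp add: u_def)
qed

section \<open>The limit of the current\<close>

lemma expectation_current:
  assumes \<gamma>: "\<gamma> > 1" and \<alpha>: "\<alpha> \<in> {0<..<1}" and \<beta>: "\<beta> \<in> {0<..<1}" and supp: "set_pmf \<mu> \<subseteq> configs N"
  shows "measure_pmf.expectation \<mu> (current \<gamma> \<alpha> \<beta> N x) =
    (\<Sum>\<^sub>\<infinity>(y, z)\<in>{..x - 1} \<times> {x..}. jump_prob \<gamma> (z - y) * (mean_profile \<alpha> \<beta> N \<mu> y - mean_profile \<alpha> \<beta> N \<mu> z))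
    + (\<beta> - \<alpha>) * (\<Sum>\<^sub>\<infinity>(y, z)\<in>{..0} \<times> {int N..}. jump_prob \<gamma> (z - y))"
proof -
  define h where "h \<eta> = (\<lambda>(y, z). jump_prob \<gamma> (z - y) * (extend_config \<alpha> \<beta> N \<eta> y - extend_config \<alpha> \<beta> N \<eta> z))" for \<eta>
  define k where "k = (\<beta> - \<alpha>) * (\<Sum>\<^sub>\<infinity>(y, z)\<in>{..0} \<times> {int N..}. jump_prob \<gamma> (z - y))"
  let ?P = "{..x - 1} \<times> {x..}"
  have one: "(\<Sum>\<eta>\<in>configs N. pmf \<mu> \<eta>) = 1" using sum_pmf_eq_1[OF finite_configs supp] .
  have hs: "((\<lambda>p. pmf \<mu> \<eta> * h \<eta> p) has_sum pmf \<mu> \<eta> * infsum (h \<eta>) ?P) ?P" if \<eta>: "\<eta> \<in> configs N" for \<eta>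
  proof -
    define B where "B y z = (if \<eta> \<in> configs N then extend_config \<alpha> \<beta> N \<eta> y - extend_config \<alpha> \<beta> N \<eta> z else 0)" for y z
    have "\<bar>B y z\<bar> \<le> 1" for y z
      using extend_config_bounds[OF \<alpha> \<beta> \<eta>, of y] extend_config_bounds[OF \<alpha> \<beta> \<eta>, of z] by (auto simp: B_def)
    from crossing_summable[OF \<gamma> this] have "h \<eta> summable_on ?P" using \<eta> by (simp add: h_def B_def)
    then show ?thesis by (intro has_sum_cmult_right has_sum_infsum)
  qed
  have "((\<lambda>p. \<Sum>\<eta>\<in>configs N. pmf \<mu> \<eta> * h \<eta> p) has_sum (\<Sum>\<eta>\<in>configs N. pmf \<mu> \<eta> * infsum (h \<eta>) ?P)) ?P"
    by (rule has_sum_sum_finite[OF finite_configs hs])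
  moreover have "(\<Sum>\<eta>\<in>configs N. pmf \<mu> \<eta> * h \<eta> p) =
    (case p of (y, z) \<Rightarrow> jump_prob \<gamma> (z - y) * (mean_profile \<alpha> \<beta> N \<mu> y - mean_profile \<alpha> \<beta> N \<mu> z))" for p
    unfolding h_def mean_profile_def expectation_config_sum[OF supp]
    by (cases p) (simp add: sum_distrib_left sum_subtractf[symmetric] algebra_simps)
  ultimately have "(\<Sum>\<eta>\<in>configs N. pmf \<mu> \<eta> * infsum (h \<eta>) ?P) =
    (\<Sum>\<^sub>\<infinity>(y, z)\<in>?P. jump_prob \<gamma> (z - y) * (mean_profile \<alpha> \<beta> N \<mu> y - mean_profile \<alpha> \<beta> N \<mu> z))"
    by (simp add: infsumI)
  moreover have "measure_pmf.expectation \<mu> (current \<gamma> \<alpha> \<beta> N x) = (\<Sum>\<eta>\<in>configs N. pmf \<mu> \<eta> * (infsum (h \<eta>) ?P + k))"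
    unfolding expectation_config_sum[OF supp] current_def h_def k_def ..
  moreover have "\<dots> = (\<Sum>\<eta>\<in>configs N. pmf \<mu> \<eta> * infsum (h \<eta>) ?P) + k"
    unfolding distrib_left sum.distrib sum_distrib_right[symmetric] one by simp
  ultimately show ?thesis by (simp add: k_def)
qed

section \<open>Macroscopic limits of lattice points, the reservoir integral and regularity of the
  profile\<close>

lemma floor_over_tendsto: "(\<lambda>N. real_of_int \<lfloor>x * real N\<rfloor> / real N) \<longlonglongrightarrow> x"
proof (rule tendsto_sandwich)
  show "\<forall>\<^sub>F N in sequentially. x - 1 / real N \<le> real_of_int \<lfloor>x * real N\<rfloor> / real N"
    using eventually_gt_at_top[of 0]
  proof eventually_elim
    fix N :: nat assume "0 < N"
    have "(x * real N - 1) / real N \<le> real_of_int \<lfloor>x * real N\<rfloor> / real N"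
      by (intro divide_right_mono) linarith+
    then show "x - 1 / real N \<le> real_of_int \<lfloor>x * real N\<rfloor> / real N"
      using \<open>0 < N\<close> by (simp add: diff_divide_distrib)
  qed
  show "\<forall>\<^sub>F N in sequentially. real_of_int \<lfloor>x * real N\<rfloor> / real N \<le> x"
    using eventually_gt_at_top[of 0]
  proof eventually_elim
    fix N :: nat assume "0 < N"
    then show "real_of_int \<lfloor>x * real N\<rfloor> / real N \<le> x"
      by (simp add: field_simps)
  qed
  show "(\<lambda>N. x - 1 / real N) \<longlonglongrightarrow> x" by real_asymp
qed simp

lemma cell_index_over_tendsto:
  assumes "s > 0"
  shows "(\<lambda>N. real (cell_index (1 / real N) s) / real N) \<longlonglongrightarrow> s"
proof (rule tendsto_sandwich)
  show "\<forall>\<^sub>F N in sequentially. s - 1 / real N \<le> real (cell_index (1 / real N) s) / real N"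
    using eventually_gt_at_top[of 0]
  proof eventually_elim
    fix N :: nat assume "0 < N"
    then show "s - 1 / real N \<le> real (cell_index (1 / real N) s) / real N"
      using cell_index_bounds(2)[of "1 / real N" s] assms \<open>0 < N\<close> by (simp add: add_divide_distrib)
  qed
  show "\<forall>\<^sub>F N in sequentially. real (cell_index (1 / real N) s) / real N \<le> s"
    using eventually_gt_at_top[of 0]
  proof eventually_elim
    fix N :: nat assume "0 < N"
    then show "real (cell_index (1 / real N) s) / real N \<le> s"
      using cell_index_bounds(1)[of "1 / real N" s] assms by (simp add: field_simps)
  qed
  show "(\<lambda>N. s - 1 / real N) \<longlonglongrightarrow> s" by real_asymp
qed simp

text \<open>Decides whether lattice points eventually lie in a reservoir; a limit
  \<open>q = 0\<close> would not determine the sign.\<close>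

lemma eventually_nonpos_iff:
  assumes "(\<lambda>N. real_of_int (k N) / real N) \<longlonglongrightarrow> q" "q \<noteq> 0"
  shows "\<forall>\<^sub>F N in sequentially. (k N \<le> 0) = (q \<le> 0)"
proof (cases "q < 0")
  case True
  from order_tendstoD(2)[OF assms(1) this] show ?thesis
    by eventually_elim (use True in \<open>auto simp: divide_less_0_iff\<close>)
next
  case False
  then have "0 < q" using assms(2) by simp
  from order_tendstoD(1)[OF assms(1) this] show ?thesis
    by eventually_elim (use \<open>0 < q\<close> in \<open>auto simp: zero_less_divide_iff\<close>)
qed

text \<open>In the coordinates \<open>y = x - s\<close> and \<open>z = x + t\<close> the region is
  \<open>y \<le> 0\<close> and \<open>z \<ge> 1\<close>, which explains why the value does not
  depend on \<open>x\<close>.\<close>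

lemma reservoir_integral:
  fixes \<gamma> x :: real
  assumes \<gamma>: "\<gamma> > 1" and x: "0 < x" "x < 1"
  shows "(LBINT s:{0<..}. LBINT t:{0<..}. (s + t) powr - (1 + \<gamma>) * (if x \<le> s \<and> 1 - x \<le> t then 1 else 0)) = 1 / (\<gamma> * (\<gamma> - 1))"
proof -
  have inner: "(LBINT t:{0<..}. (s + t) powr - (1 + \<gamma>) * (if x \<le> s \<and> 1 - x \<le> t then 1 else 0)) =
     (if x \<le> s then (1 - x + s) powr - \<gamma> / \<gamma> else 0)" if s: "s > 0" for s
  proof (cases "x \<le> s")
    case True
    have "(LBINT t:{0<..}. (s + t) powr - (1 + \<gamma>) * (if x \<le> s \<and> 1 - x \<le> t then 1 else 0)) = (LBINT t:{1 - x..}. (s + t) powr - (1 + \<gamma>))"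
      unfolding set_lebesgue_integral_def
    proof (intro Bochner_Integration.integral_cong refl)
      fix t :: real
      show "indicator {0<..} t *\<^sub>R ((s + t) powr - (1 + \<gamma>) * (if x \<le> s \<and> 1 - x \<le> t then 1 else 0)) = indicator {1 - x..} t *\<^sub>R (s + t) powr - (1 + \<gamma>)"
      proof (cases "1 - x \<le> t")
        case t: True
        then have "t > 0" using x by linarith
        then show ?thesis using True t by simp
      qed simp
    qed
    also have "\<dots> = (LBINT t:{0<..}. ((1 - x + s) + t) powr - (1 + \<gamma>))"
      unfolding set_integral_Ioi_eq_Ici(1)[symmetric] set_integral_shift(1)[of "1 - x"] by (simp add: algebra_simps)
    also have "\<dots> = (1 - x + s) powr - \<gamma> / \<gamma>"
      using integral_shifted_powr[of "1 + \<gamma>" "1 - x + s"] \<gamma> x s by simp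
    finally show ?thesis using True by simp
  qed (simp add: set_lebesgue_integral_def)
  have "(LBINT s:{0<..}. LBINT t:{0<..}. (s + t) powr - (1 + \<gamma>) * (if x \<le> s \<and> 1 - x \<le> t then 1 else 0)) =
     (LBINT s:{0<..}. if x \<le> s then (1 - x + s) powr - \<gamma> / \<gamma> else 0)"
    by (intro set_lebesgue_integral_cong allI impI inner) auto
  also have "\<dots> = (LBINT s:{x..}. (1 - x + s) powr - \<gamma> / \<gamma>)"
    unfolding set_lebesgue_integral_def using x by (intro Bochner_Integration.integral_cong) (auto simp: indicator_def)
  also have "\<dots> = (LBINT s:{0<..}. (1 + s) powr - \<gamma> / \<gamma>)"
    unfolding set_integral_Ioi_eq_Ici(1)[symmetric] set_integral_shift(1)[of x] by (simp add: algebra_simps)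
  also have "\<dots> = (LBINT s:{0<..}. (1 + s) powr - \<gamma>) / \<gamma>" by simp
  also have "(LBINT s:{0<..}. (1 + s) powr - \<gamma>) = 1 / (\<gamma> - 1)"
    using integral_shifted_powr[of \<gamma> 1] \<gamma> by simp
  finally show ?thesis by (simp add: mult.commute)
qed

text \<open>The extended profile is \<open>\<rho>\<close> composed with the projection onto
  \<open>[0, 1]\<close>. The projection is 1-Lipschitz, so uniform continuity on the compact
  interval carries over to the line.\<close>

lemma extend_profile_regular:
  assumes "weak_solution \<gamma> \<alpha> \<beta> \<rho>"
  shows "\<And>e. e > 0 \<Longrightarrow> \<exists>d>0. \<forall>q q'. \<bar>q - q'\<bar> < d \<longrightarrow> \<bar>extend_profile \<alpha> \<beta> \<rho> q - extend_profile \<alpha> \<beta> \<rho> q'\<bar> < e"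
    and "\<And>q. 0 \<le> extend_profile \<alpha> \<beta> \<rho> q" "\<And>q. extend_profile \<alpha> \<beta> \<rho> q \<le> 1"
proof -
  have \<rho>: "continuous_on {0..1} \<rho>" "\<And>q. q \<in> {0..1} \<Longrightarrow> 0 \<le> \<rho> q \<and> \<rho> q \<le> 1" "\<rho> 0 = \<alpha>" "\<rho> 1 = \<beta>"
    using assms by (auto simp: weak_solution_def image_subset_iff)
  define P where "P q = max 0 (min 1 q)" for q :: real
  have P: "P q \<in> {0..1}" for q by (auto simp: P_def)
  have ext: "extend_profile \<alpha> \<beta> \<rho> q = \<rho> (P q)" for q
    using \<rho>(3,4) by (auto simp: extend_profile_def P_def max_def min_def)
  show "0 \<le> extend_profile \<alpha> \<beta> \<rho> q" "extend_profile \<alpha> \<beta> \<rho> q \<le> 1" for q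
    using \<rho>(2)[OF P[of q]] by (auto simp: ext)
  fix e :: real assume e: "e > 0"
  have "uniformly_continuous_on {0..1} \<rho>" using \<rho>(1) by (rule compact_uniformly_continuous) simp
  then obtain d where d: "d > 0" "\<forall>a\<in>{0..1}. \<forall>b\<in>{0..1}. dist b a < d \<longrightarrow> dist (\<rho> b) (\<rho> a) < e"
    using e unfolding uniformly_continuous_on_def by blast
  have "\<bar>\<rho> (P q) - \<rho> (P q')\<bar> < e" if "\<bar>q - q'\<bar> < d" for q q'
  proof -
    have "\<bar>P q - P q'\<bar> \<le> \<bar>q - q'\<bar>" by (auto simp: P_def max_def min_def)
    then have "dist (P q) (P q') < d" using that by (simp add: dist_real_def)
    then have "dist (\<rho> (P q)) (\<rho> (P q')) < e" using d(2) P by blast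
    then show ?thesis by (simp add: dist_real_def)
  qed
  then show "\<exists>d>0. \<forall>q q'. \<bar>q - q'\<bar> < d \<longrightarrow> \<bar>extend_profile \<alpha> \<beta> \<rho> q - extend_profile \<alpha> \<beta> \<rho> q'\<bar> < e"
    using d(1) unfolding ext by blast
qed

lemma crossing_flux_constant:
  assumes \<gamma>: "\<gamma> > 1" and u: "\<And>z. \<bar>u z\<bar> \<le> M" and harm: "\<And>x. x \<in> sites N \<Longrightarrow> second_diff_sum \<gamma> u x = 0"
    and m: "1 \<le> m" "m \<le> int N"
  shows "(\<Sum>\<^sub>\<infinity>(y, z)\<in>{..m - 1} \<times> {m..}. jump_prob \<gamma> (z - y) * (u y - u z)) =
    (\<Sum>\<^sub>\<infinity>(y, z)\<in>{..1 - 1} \<times> {1..}. jump_prob \<gamma> (z - y) * (u y - u z))"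
  using m
proof (induction m rule: int_ge_induct)
  case (step m)
  then have "second_diff_sum \<gamma> u m = 0" by (intro harm) (simp add: sites_def)
  from crossing_flux_step[where u=u, OF \<gamma> u this] step show ?case by simp
qed simp

theorem theorem2p4:
  fixes \<gamma> \<alpha> \<beta> x :: real
    and \<mu> :: "nat \<Rightarrow> (int \<Rightarrow> real) pmf"
    and \<rho> :: "real \<Rightarrow> real"
  assumes "\<gamma> \<in> {1<..<2}" and "\<alpha> \<in> {0<..<1}" and "\<beta> \<in> {0<..<1}"
    and "\<And>N. N \<ge> 2 \<Longrightarrow> invariant_measure \<gamma> \<alpha> \<beta> N (\<mu> N)"
    and "weak_solution \<gamma> \<alpha> \<beta> \<rho>"
    and "x \<in> {0<..<1}"
  shows "(\<lambda>N. real N powr (\<gamma> - 1) * measure_pmf.expectation (\<mu> N) (current \<gamma> \<alpha> \<beta> N 1))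
           \<longlonglongrightarrow>
         jump_const \<gamma> *
           (LBINT y:{..<x}. LBINT z:{x<..}.
              (extend_profile \<alpha> \<beta> \<rho> y - extend_profile \<alpha> \<beta> \<rho> z) / (z - y) powr (1 + \<gamma>))
         + jump_const \<gamma> / (\<gamma> * (\<gamma> - 1)) * (\<beta> - \<alpha>)"
proof -
  have \<gamma>: "1 < \<gamma>" "\<gamma> < 2" and \<alpha>: "\<alpha> \<in> {0<..<1}" and \<beta>: "\<beta> \<in> {0<..<1}" and x: "0 < x" "x < 1"
    using assms by auto
  define R where "R = extend_profile \<alpha> \<beta> \<rho>"
  have Runif: "\<exists>d>0. \<forall>q q'. \<bar>q - q'\<bar> < d \<longrightarrow> \<bar>R q - R q'\<bar> < e" if "e > 0" for e
    unfolding R_def by (rule extend_profile_regular(1)[OF assms(5) that])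
  have Rb: "0 \<le> R q" "R q \<le> 1" for q
    unfolding R_def using extend_profile_regular(2,3)[OF assms(5)] by auto
  have R0: "R q = \<alpha>" if "q \<le> 0" for q using that by (simp add: R_def extend_profile_def)
  have R1: "R q = \<beta>" if "q \<ge> 1" for q using that by (simp add: R_def extend_profile_def)
  have "continuous_on UNIV R" using continuous_on_modulus[OF Runif] .
  then have Rcont: "isCont R q" for q by (simp add: continuous_on_eq_continuous_at)
  have Rm[measurable]: "R \<in> borel_measurable borel"
    using \<open>continuous_on UNIV R\<close> by (rule borel_measurable_continuous_onI)
  define u where "u N = mean_profile \<alpha> \<beta> N (\<mu> N)" for N
  have supp: "set_pmf (\<mu> N) \<subseteq> configs N" if "N \<ge> 2" for N
    using assms(4)[OF that] by (simp add: invariant_measure_def)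
  have ub: "0 \<le> u N z" "u N z \<le> 1" if "N \<ge> 2" for N z
    unfolding u_def using mean_profile_bounds[OF \<alpha> \<beta> supp[OF that]] by auto
  have harm: "second_diff_sum \<gamma> (u N) z = 0" if "N \<ge> 2" "z \<in> sites N" for N z
    unfolding u_def using mean_profile_harmonic[OF \<gamma>(1) \<alpha> \<beta> assms(4)[OF that(1)] that(2)] .
  have conv: "\<forall>\<^sub>F N in sequentially. \<forall>z. \<bar>u N z - R (real_of_int z / real N)\<bar> \<le> e" if "e > 0" for e
  proof (rule harmonic_tendsto_profile[OF \<gamma> Runif])
    show "\<forall>H\<in>Cc2. (LBINT h:{0<..}. h powr - (1 + \<gamma>) * (\<integral>y. R y * second_diff H y h \<partial>lborel)) = 0"
      unfolding R_def using weak_solution_second_diff[OF \<gamma> assms(5)] by blast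
    show "u N z = \<alpha>" if "2 \<le> N" "z \<le> 0" for N z using that by (simp add: u_def mean_profile_simps)
    show "u N z = \<beta>" if "2 \<le> N" "z \<ge> int N" for N z using that by (simp add: u_def mean_profile_simps)
  qed (use Rb R0 R1 ub harm that in \<open>auto simp: abs_le_iff intro: order.trans[of _ 0]\<close>)
  have ulim: "(\<lambda>N. u N (z N)) \<longlonglongrightarrow> R q" if z: "(\<lambda>N. real_of_int (z N) / real N) \<longlonglongrightarrow> q" for z q
  proof -
    have "(\<lambda>N. u N (z N) - R (real_of_int (z N) / real N)) \<longlonglongrightarrow> 0"
    proof (rule tendstoI)
      fix e :: real assume "e > 0"
      then have "\<forall>\<^sub>F N in sequentially. \<forall>z. \<bar>u N z - R (real_of_int z / real N)\<bar> \<le> e / 2" by (intro conv) simp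
      then show "\<forall>\<^sub>F N in sequentially. dist (u N (z N) - R (real_of_int (z N) / real N)) 0 < e"
      proof eventually_elim
        fix N assume "\<forall>z. \<bar>u N z - R (real_of_int z / real N)\<bar> \<le> e / 2"
        then have "\<bar>u N (z N) - R (real_of_int (z N) / real N)\<bar> \<le> e / 2" by blast
        then show "dist (u N (z N) - R (real_of_int (z N) / real N)) 0 < e" using \<open>e > 0\<close> by (simp add: dist_real_def)
      qed
    qed
    moreover have "(\<lambda>N. R (real_of_int (z N) / real N)) \<longlonglongrightarrow> R q" using isCont_tendsto_compose[OF Rcont z] .
    ultimately show ?thesis using tendsto_add by fastforce
  qed
  \<comment> \<open>The bond joins \<open>m N - 1\<close>, the integer part of \<open>x * N\<close>,
    to \<open>m N\<close>. Since \<open>x < 1\<close>, the bond satisfies \<open>m N \<le> N\<close>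
    and can be reached from bond 1 across sites only.\<close>
  define m where "m N = \<lfloor>x * real N\<rfloor> + 1" for N :: nat
  have mb: "1 \<le> m N" "m N \<le> int N" if "N \<ge> 2" for N
  proof -
    have "0 \<le> x * real N" "x * real N < real N" using x that by auto
    then show "1 \<le> m N" "m N \<le> int N" unfolding m_def by linarith+
  qed
  define a where "a = \<gamma> / 2"
  have a: "0 < a" "a < 1" "a < \<gamma>" "\<gamma> - 1 < a" using \<gamma> by (auto simp: a_def)
  have ylim: "(\<lambda>N. real_of_int (m N - 1 - int (cell_index (1 / real N) s)) / real N) \<longlonglongrightarrow> x - s" if "s > 0" for s
    using tendsto_diff[OF floor_over_tendsto[of x] cell_index_over_tendsto[OF that]]
    by (simp add: m_def diff_divide_distrib)
  have zlim: "(\<lambda>N. real_of_int (m N + int (cell_index (1 / real N) t)) / real N) \<longlonglongrightarrow> x + t" if "t > 0" for t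
  proof -
    have "(\<lambda>N. 1 / real N) \<longlonglongrightarrow> 0" by real_asymp
    from tendsto_add[OF tendsto_add[OF floor_over_tendsto[of x] this] cell_index_over_tendsto[OF that]]
    show ?thesis by (simp add: m_def add_divide_distrib)
  qed

  define A1 where "A1 N i j = u N (m N - 1 - int i) - u N (m N + int j)" for N and i j :: nat
  \<comment> \<open>The pairs joining the two reservoirs, described by their positions relative to
    the bond \<open>m N\<close>.\<close>
  define A2 where "A2 N i j = (if m N - 1 - int i \<le> 0 \<and> m N + int j \<ge> int N then 1 else 0 :: real)" for N and i j :: nat

  \<comment> \<open>Small enough that a site within \<open>\<kappa> * N\<close> of the bond is still
    at distance at least \<open>\<kappa> * N\<close> from the boundary, up to rounding.\<close>
  define \<kappa> where "\<kappa> = min x (1 - x) / 4"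
  have \<kappa>: "0 < \<kappa>" "4 * \<kappa> \<le> x" "4 * \<kappa> \<le> 1 - x" using x by (auto simp: \<kappa>_def)
  obtain C0 where C0: "C0 > 0" and hoelder: "\<And>N u y0 z. (N::nat) > 0 \<Longrightarrow> (\<forall>z. 0 \<le> u z \<and> u z \<le> 1) \<Longrightarrow> (\<forall>x\<in>sites N. second_diff_sum \<gamma> u x = 0) \<Longrightarrow>
     \<kappa> * real N \<le> real_of_int y0 \<Longrightarrow> real_of_int y0 \<le> (1 - \<kappa>) * real N \<Longrightarrow>
     \<bar>u z - u y0\<bar> \<le> C0 * (\<bar>real_of_int (z - y0)\<bar> / real N) powr a"
    using hoelder_estimate[OF \<gamma> a(1,2) \<kappa>(1)] by blast
  define C where "C = C0 + \<kappa> powr - a + 1"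
  have C1: "C \<ge> 1" using C0 by (simp add: C_def)
  have A1b: "\<bar>A1 N i j\<bar> \<le> C" if "N \<ge> 2" for N i j
    using ub[OF that, of "m N - 1 - int i"] ub[OF that, of "m N + int j"] C1 unfolding A1_def by linarith
  have A1h: "\<bar>A1 N i j\<bar> \<le> C * (real (i + j + 1) / real N) powr a" if N: "N \<ge> 2" for N i j
  proof -
    define k where "k = i + j + 1"
    define y where "y = m N - 1 - int i"
    have kz: "m N + int j = y + int k" by (simp add: k_def y_def)
    \<comment> \<open>Short pairs have their left point in the interior, where the Hoelder bound
      applies. For long pairs the trivial bound 1 is at most
      \<open>(k / (\<kappa> * N)) powr a\<close>.\<close>
    have "\<bar>A1 N i j\<bar> \<le> (C0 + \<kappa> powr - a) * (real k / real N) powr a"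
    proof (cases "real k \<le> \<kappa> * real N")
      case True
      have y1: "real_of_int y \<ge> x * real N - real k" unfolding y_def m_def k_def by linarith
      have "\<kappa> * real N \<le> (x - \<kappa>) * real N" using \<kappa> by (intro mult_right_mono) auto
      then have y2: "\<kappa> * real N \<le> real_of_int y" using y1 True by (simp add: algebra_simps)
      have "real_of_int y \<le> x * real N" unfolding y_def m_def by linarith
      also have "\<dots> \<le> (1 - \<kappa>) * real N" using \<kappa> by (intro mult_right_mono) auto
      finally have y3: "real_of_int y \<le> (1 - \<kappa>) * real N" .
      have "\<bar>u N (y + int k) - u N y\<bar> \<le> C0 * (\<bar>real_of_int (y + int k - y)\<bar> / real N) powr a"
        using N ub[OF N] harm[OF N] y2 y3 by (intro hoelder) auto
      then have "\<bar>A1 N i j\<bar> \<le> C0 * (real k / real N) powr a"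
        unfolding A1_def kz y_def[symmetric] by (simp add: abs_minus_commute)
      also have "\<dots> \<le> (C0 + \<kappa> powr - a) * (real k / real N) powr a"
        by (intro mult_right_mono) auto
      finally show ?thesis .
    next
      case False
      have "\<bar>A1 N i j\<bar> \<le> 1" using ub[OF N, of "m N - 1 - int i"] ub[OF N, of "m N + int j"] unfolding A1_def by linarith
      also have "1 \<le> (real k / real N / \<kappa>) powr a"
        using False N \<kappa> a by (intro ge_one_powr_ge_zero) (auto simp: field_simps)
      also have "\<dots> = \<kappa> powr - a * (real k / real N) powr a"
        using \<kappa> by (simp add: powr_divide powr_mult powr_minus field_simps)
      also have "\<dots> \<le> (C0 + \<kappa> powr - a) * (real k / real N) powr a"
        using C0 by (intro mult_right_mono) auto
      finally show ?thesis .
    qed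
    also have "\<dots> \<le> C * (real k / real N) powr a" by (intro mult_right_mono) (auto simp: C_def)
    finally show ?thesis by (simp add: k_def)
  qed
  have L1: "(\<lambda>N. real N powr (\<gamma> - 1) * (\<Sum>i. \<Sum>j. real (i + j + 1) powr - (1 + \<gamma>) * A1 N i j)) \<longlonglongrightarrow>
    (LBINT s:{0<..}. LBINT t:{0<..}. (s + t) powr - (1 + \<gamma>) * (R (x - s) - R (x + t)))"
  proof (rule double_sum_tendsto_integral[OF \<gamma> less_imp_le[OF a(1)] a(3,4) A1b A1h])
    show "(\<lambda>(s, t). R (x - s) - R (x + t)) \<in> borel_measurable (borel \<Otimes>\<^sub>M borel)" by measurable
    show "(\<lambda>N. A1 N (cell_index (1 / real N) s) (cell_index (1 / real N) t)) \<longlonglongrightarrow> R (x - s) - R (x + t)"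
      if "s > 0" "t > 0" for s t
      unfolding A1_def by (intro tendsto_diff ulim ylim zlim that)
  qed
  have L2: "(\<lambda>N. real N powr (\<gamma> - 1) * (\<Sum>i. \<Sum>j. real (i + j + 1) powr - (1 + \<gamma>) * A2 N i j)) \<longlonglongrightarrow>
    (LBINT s:{0<..}. LBINT t:{0<..}. (s + t) powr - (1 + \<gamma>) * (if x \<le> s \<and> 1 - x \<le> t then 1 else 0))"
  \<comment> \<open>The limiting indicator jumps at \<open>s = x\<close> and
    \<open>t = 1 - x\<close>, the two lines that the limit theorem exempts.\<close>
  proof (rule double_sum_tendsto_integral[OF \<gamma> less_imp_le[OF a(1)] a(3,4), where C=1 and ?s0.0=x and ?t0.0="1 - x"])
    show "\<bar>A2 N i j\<bar> \<le> 1" for N i j by (simp add: A2_def)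
    show "\<bar>A2 N i j\<bar> \<le> 1 * (real (i + j + 1) / real N) powr a" if "N \<ge> 2" for N i j
    proof (cases "m N - 1 - int i \<le> 0 \<and> m N + int j \<ge> int N")
      case True
      then have "real (i + j + 1) \<ge> real N" by linarith
      then have "1 \<le> (real (i + j + 1) / real N) powr a"
        using that a by (intro ge_one_powr_ge_zero) (auto simp: field_simps)
      then show ?thesis by (simp add: A2_def)
    next
      case False
      then have "A2 N i j = 0" unfolding A2_def by (rule if_not_P)
      then show ?thesis by simp
    qed
    show "(\<lambda>(s, t). if x \<le> s \<and> 1 - x \<le> t then 1 else 0 :: real) \<in> borel_measurable (borel \<Otimes>\<^sub>M borel)" by measurable
    fix s t :: real assume st: "s > 0" "t > 0" "s \<noteq> x" "t \<noteq> 1 - x"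
    have "(\<lambda>N. 1 - real_of_int (m N + int (cell_index (1 / real N) t)) / real N) \<longlonglongrightarrow> 1 - (x + t)"
      by (intro tendsto_intros zlim st)
    then have "(\<lambda>N. real_of_int (int N - (m N + int (cell_index (1 / real N) t))) / real N) \<longlonglongrightarrow> 1 - (x + t)"
      by (rule Lim_transform_eventually) (use eventually_gt_at_top[of 0] in eventually_elim, simp add: diff_divide_distrib)
    then have e2: "\<forall>\<^sub>F N in sequentially. (int N - (m N + int (cell_index (1 / real N) t)) \<le> 0) = (1 - (x + t) \<le> 0)"
      using st by (intro eventually_nonpos_iff) auto
    have e1: "\<forall>\<^sub>F N in sequentially. (m N - 1 - int (cell_index (1 / real N) s) \<le> 0) = (x - s \<le> 0)"
      using st by (intro eventually_nonpos_iff ylim) auto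
    from e1 e2 have "\<forall>\<^sub>F N in sequentially. A2 N (cell_index (1 / real N) s) (cell_index (1 / real N) t) = (if x \<le> s \<and> 1 - x \<le> t then 1 else 0)"
      by eventually_elim (auto simp: A2_def)
    then show "(\<lambda>N. A2 N (cell_index (1 / real N) s) (cell_index (1 / real N) t)) \<longlonglongrightarrow> (if x \<le> s \<and> 1 - x \<le> t then 1 else 0)"
      by (rule tendsto_eventually)
  qed

  have flux: "measure_pmf.expectation (\<mu> N) (current \<gamma> \<alpha> \<beta> N 1) =
     jump_const \<gamma> * (\<Sum>i. \<Sum>j. real (i + j + 1) powr - (1 + \<gamma>) * A1 N i j)
     + (\<beta> - \<alpha>) * (jump_const \<gamma> * (\<Sum>i. \<Sum>j. real (i + j + 1) powr - (1 + \<gamma>) * A2 N i j))" if N: "N \<ge> 2" for N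
  proof -
    have ub1: "\<bar>u N z\<bar> \<le> 1" for z using ub[OF N, of z] by simp
    define B1 where "B1 y z = u N y - u N z" for y z
    define B2 where "B2 y z = (if y \<le> 0 \<and> z \<ge> int N then 1 else 0 :: real)" for y z :: int
    have B1: "\<bar>B1 y z\<bar> \<le> 1" for y z using ub[OF N, of y] ub[OF N, of z] by (simp add: B1_def abs_le_iff)
    have B2: "\<bar>B2 y z\<bar> \<le> 1" for y z by (simp add: B2_def)
    \<comment> \<open>The flux is transported from bond 1 to bond \<open>m N\<close> before it is
      written in distances from the bond.\<close>
    have 1: "(\<Sum>\<^sub>\<infinity>(y, z)\<in>{..1 - 1} \<times> {1..}. jump_prob \<gamma> (z - y) * (u N y - u N z)) =
       jump_const \<gamma> * (\<Sum>i. \<Sum>j. real (i + j + 1) powr - (1 + \<gamma>) * A1 N i j)"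
      using crossing_infsum[where B=B1, OF \<gamma>(1) B1, of "m N"] crossing_flux_constant[where u="u N", OF \<gamma>(1) ub1 harm[OF N] mb[OF N]]
      by (simp add: B1_def A1_def)
    \<comment> \<open>Every pair joining the reservoirs crosses the bond \<open>m N\<close>, so this
      sum extends by zero to all crossing pairs.\<close>
    have 2: "(\<Sum>\<^sub>\<infinity>(y, z)\<in>{..0} \<times> {int N..}. jump_prob \<gamma> (z - y)) = (\<Sum>\<^sub>\<infinity>(y, z)\<in>{..m N - 1} \<times> {m N..}. jump_prob \<gamma> (z - y) * B2 y z)"
      using mb[OF N] by (intro infsum_cong_neutral) (auto simp: B2_def split: if_splits)
    show ?thesis
      unfolding expectation_current[OF \<gamma>(1) \<alpha> \<beta> supp[OF N]] u_def[symmetric] 1 2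
        crossing_infsum[where B=B2, OF \<gamma>(1) B2]
      by (simp add: B2_def A2_def)
  qed
  have "(\<lambda>N. jump_const \<gamma> * (real N powr (\<gamma> - 1) * (\<Sum>i. \<Sum>j. real (i + j + 1) powr - (1 + \<gamma>) * A1 N i j))
      + (\<beta> - \<alpha>) * (jump_const \<gamma> * (real N powr (\<gamma> - 1) * (\<Sum>i. \<Sum>j. real (i + j + 1) powr - (1 + \<gamma>) * A2 N i j)))) \<longlonglongrightarrow>
    jump_const \<gamma> * (LBINT s:{0<..}. LBINT t:{0<..}. (s + t) powr - (1 + \<gamma>) * (R (x - s) - R (x + t)))
      + (\<beta> - \<alpha>) * (jump_const \<gamma> * (1 / (\<gamma> * (\<gamma> - 1))))"
    using L2 unfolding reservoir_integral[OF \<gamma>(1) x] by (intro tendsto_intros L1)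
  moreover have "\<forall>\<^sub>F N in sequentially. jump_const \<gamma> * (real N powr (\<gamma> - 1) * (\<Sum>i. \<Sum>j. real (i + j + 1) powr - (1 + \<gamma>) * A1 N i j))
      + (\<beta> - \<alpha>) * (jump_const \<gamma> * (real N powr (\<gamma> - 1) * (\<Sum>i. \<Sum>j. real (i + j + 1) powr - (1 + \<gamma>) * A2 N i j))) =
     real N powr (\<gamma> - 1) * measure_pmf.expectation (\<mu> N) (current \<gamma> \<alpha> \<beta> N 1)"
    using eventually_ge_at_top[of 2]
  proof eventually_elim
    fix N :: nat assume "2 \<le> N"
    show "jump_const \<gamma> * (real N powr (\<gamma> - 1) * (\<Sum>i. \<Sum>j. real (i + j + 1) powr - (1 + \<gamma>) * A1 N i j))
      + (\<beta> - \<alpha>) * (jump_const \<gamma> * (real N powr (\<gamma> - 1) * (\<Sum>i. \<Sum>j. real (i + j + 1) powr - (1 + \<gamma>) * A2 N i j))) =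
     real N powr (\<gamma> - 1) * measure_pmf.expectation (\<mu> N) (current \<gamma> \<alpha> \<beta> N 1)"
      unfolding flux[OF \<open>2 \<le> N\<close>] by (simp add: algebra_simps)
  qed
  ultimately have lim: "(\<lambda>N. real N powr (\<gamma> - 1) * measure_pmf.expectation (\<mu> N) (current \<gamma> \<alpha> \<beta> N 1)) \<longlonglongrightarrow>
    jump_const \<gamma> * (LBINT s:{0<..}. LBINT t:{0<..}. (s + t) powr - (1 + \<gamma>) * (R (x - s) - R (x + t)))
      + (\<beta> - \<alpha>) * (jump_const \<gamma> * (1 / (\<gamma> * (\<gamma> - 1))))"
    by (rule Lim_transform_eventually)
  have "(LBINT y:{..<x}. LBINT z:{x<..}. (R y - R z) / (z - y) powr (1 + \<gamma>)) =
     (LBINT s:{0<..}. LBINT t:{0<..}. (R (x - s) - R (x + t)) / ((x + t) - (x - s)) powr (1 + \<gamma>))"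
    unfolding set_integral_shift(2)[of x] set_integral_shift(1)[of x] ..
  also have "\<dots> = (LBINT s:{0<..}. LBINT t:{0<..}. (s + t) powr - (1 + \<gamma>) * (R (x - s) - R (x + t)))"
  proof -
    have "(R (x - s) - R (x + t)) / ((x + t) - (x - s)) powr (1 + \<gamma>) = (s + t) powr - (1 + \<gamma>) * (R (x - s) - R (x + t))" for s t
      by (subst powr_minus) (simp add: divide_inverse add.commute mult.commute)
    then show ?thesis by simp
  qed
  finally show ?thesis using lim unfolding R_def by (simp add: mult_ac)
qed

end
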